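(* Let $A$ be a graded algebra and $\sigma$ a graded automorphism of $A$. Then $A$ is $\mathcal{K}_2$ if and only if the twisted algebra $A^\sigma$ is $\mathcal{K}_2$.
   Context: Conventions. $K$ is a field. A "graded algebra" is a connected $\mathbb{N}$-graded $K$-algebra of the form $A=T(V)/I$, where $V$ is a finite-dimensional $K$-vector space placed in degree 1, $T(V)$ is its tensor algebra, and $I$ is an ideal generated by a (minimal) finite set of homogeneous elements of degree at least 2 (not necessarily all of the same degree). The field $K$ is identified with the trivial $A$-module $A/A_+$. The bigraded Yoneda algebra is $E(A)=\bigoplus_{n,m} E^{n,m}(A)$ with $E^{n,m}(A)=\mathrm{Ext}_A^{n}(K,K)_{-m}$ ($n$ is the cohomological degree, $-m$ the internal degree; Ext is computed in the category of $\mathbb{Z}$-graded locally finite $A$-modules with graded Hom spaces), with the Yoneda (cup) product; $E^n(A)=\bigoplus_m E^{n,m}(A)$. The graded algebra $A$ is called $\mathcal{K}_2$ if $E(A)$ is generated as an algebra by $E^1(A)$ and $E^2(A)$. Twist: for a graded (degree-preserving $K$-algebra) automorphism $\sigma$ of $A$, $A^\sigma$ is the graded algebra with the same underlying graded vector space as $A$ and product of homogeneous elements $a\cdot b = a\,\sigma^{|a|}(b)$, where $|a|$ is the degree of $a$. *)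

theory Defs
  imports Complex_Main "HOL-Library.Function_Algebras"
begin

section \<open>Internal direct sums\<close>

text \<open>
  A grading is an indexed family \<open>G\<close> of additive subgroups of an ambient abelian group.
  \<open>decomp G x c\<close>: \<open>c\<close> is a family of homogeneous components of \<open>x\<close>.
\<close>

definition decomp :: "('i \<Rightarrow> 'm::ab_group_add set) \<Rightarrow> 'm \<Rightarrow> ('i \<Rightarrow> 'm) \<Rightarrow> bool" where
  "decomp G x c \<longleftrightarrow>
     (\<forall>i. c i \<in> G i) \<and> finite {i. c i \<noteq> 0} \<and> x = (\<Sum>i | c i \<noteq> 0. c i)"

definition dsum :: "('i \<Rightarrow> 'm::ab_group_add set) \<Rightarrow> 'm set" where
  "dsum G = {x. \<exists>c. decomp G x c}"

definition independent_parts :: "('i \<Rightarrow> 'm::ab_group_add set) \<Rightarrow> bool" where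
  "independent_parts G \<longleftrightarrow> (\<forall>x\<in>dsum G. \<exists>!c. decomp G x c)"

definition hcomp :: "('i \<Rightarrow> 'm::ab_group_add set) \<Rightarrow> 'm \<Rightarrow> 'i \<Rightarrow> 'm" where
  "hcomp G x = (THE c. decomp G x c)"


section \<open>Connected \<open>\<nat>\<close>-graded algebras\<close>

record ('k, 'a) galgebra =
  smul :: "'k \<Rightarrow> 'a \<Rightarrow> 'a"
  gmul :: "'a \<Rightarrow> 'a \<Rightarrow> 'a"
  gone :: 'a
  apart :: "nat \<Rightarrow> 'a set"

definition connected_graded_algebra :: "('k::field, 'a::ab_group_add) galgebra \<Rightarrow> bool" where
  "connected_graded_algebra A \<longleftrightarrow>
     vector_space (smul A) \<and>
     (\<forall>a b c. gmul A (gmul A a b) c = gmul A a (gmul A b c)) \<and>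
     (\<forall>a. gmul A (gone A) a = a \<and> gmul A a (gone A) = a) \<and>
     (\<forall>a b c. gmul A (a + b) c = gmul A a c + gmul A b c) \<and>
     (\<forall>a b c. gmul A a (b + c) = gmul A a b + gmul A a c) \<and>
     (\<forall>r a b. gmul A (smul A r a) b = smul A r (gmul A a b)) \<and>
     (\<forall>r a b. gmul A a (smul A r b) = smul A r (gmul A a b)) \<and>
     (\<forall>i. module.subspace (smul A) (apart A i)) \<and>
     dsum (apart A) = UNIV \<and> independent_parts (apart A) \<and>
     (\<forall>i j. \<forall>a\<in>apart A i. \<forall>b\<in>apart A j. gmul A a b \<in> apart A (i + j)) \<and>
     gone A \<noteq> 0 \<and> apart A 0 = range (\<lambda>r. smul A r (gone A))"


subsection \<open>Presentations \<open>A = T(V)/I\<close>\<close>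

text \<open>
  For \<open>V\<close> with basis \<open>x\<^sub>0, \<dots>, x\<^sub>r\<^sub>-\<^sub>1\<close>, the tensor algebra \<open>T(V)\<close> has as basis the words in
  \<open>{..<r}\<close>; its elements are the finitely supported coefficient functions on words.
\<close>

definition tensor_alg :: "nat \<Rightarrow> (nat list \<Rightarrow> 'k::field) set" where
  "tensor_alg r = {f. finite {w. f w \<noteq> 0} \<and> (\<forall>w. f w \<noteq> 0 \<longrightarrow> set w \<subseteq> {..<r})}"

definition tensor_mul ::
  "(nat list \<Rightarrow> 'k::field) \<Rightarrow> (nat list \<Rightarrow> 'k) \<Rightarrow> nat list \<Rightarrow> 'k" where
  "tensor_mul f g w = (\<Sum>i\<le>length w. f (take i w) * g (drop i w))"

definition tensor_homogeneous :: "nat \<Rightarrow> (nat list \<Rightarrow> 'k::field) \<Rightarrow> bool" where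
  "tensor_homogeneous n f \<longleftrightarrow> (\<forall>w. f w \<noteq> 0 \<longrightarrow> length w = n)"

definition tensor_ideal :: "nat \<Rightarrow> (nat list \<Rightarrow> 'k::field) set \<Rightarrow> bool" where
  "tensor_ideal r J \<longleftrightarrow>
     J \<subseteq> tensor_alg r \<and> (\<lambda>w. 0) \<in> J \<and>
     (\<forall>f\<in>J. \<forall>g\<in>J. (\<lambda>w. f w + g w) \<in> J) \<and>
     (\<forall>f\<in>tensor_alg r. \<forall>g\<in>J. tensor_mul f g \<in> J \<and> tensor_mul g f \<in> J)"

definition tensor_ideal_gen ::
  "nat \<Rightarrow> (nat list \<Rightarrow> 'k::field) set \<Rightarrow> (nat list \<Rightarrow> 'k) set" where
  "tensor_ideal_gen r R = \<Inter>{J. tensor_ideal r J \<and> R \<subseteq> J}"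

text \<open>The algebra homomorphism \<open>T(V) \<rightarrow> A\<close> determined by the images \<open>x i\<close> of the basis vectors.\<close>

definition tensor_eval ::
  "('k::field, 'a::ab_group_add) galgebra \<Rightarrow> (nat \<Rightarrow> 'a) \<Rightarrow> (nat list \<Rightarrow> 'k) \<Rightarrow> 'a" where
  "tensor_eval A x f =
     (\<Sum>w | f w \<noteq> 0. smul A (f w) (foldr (\<lambda>i. gmul A (x i)) w (gone A)))"

text \<open>
  \<open>A\<close> is (canonically isomorphic to) \<open>T(V)/I\<close> with \<open>V\<close> in degree 1 and \<open>I\<close> minimally generated by
  the finite set \<open>R\<close> of homogeneous elements of degrees at least 2. The kernel condition forces
  the \<open>x i\<close> to be linearly independent, and surjectivity then makes them a basis of the
  degree 1 part.
\<close>

definition finitely_presented_deg1 :: "('k::field, 'a::ab_group_add) galgebra \<Rightarrow> bool" where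
  "finitely_presented_deg1 A \<longleftrightarrow>
     (\<exists>r x R. (\<forall>i<r. x i \<in> apart A 1) \<and>
        finite R \<and> R \<subseteq> tensor_alg r \<and> (\<forall>f\<in>R. \<exists>n\<ge>2. tensor_homogeneous n f) \<and>
        (\<forall>R'. R' \<subset> R \<longrightarrow> tensor_ideal_gen r R' \<noteq> tensor_ideal_gen r R) \<and>
        tensor_eval A x ` tensor_alg r = UNIV \<and>
        {f \<in> tensor_alg r. tensor_eval A x f = 0} = tensor_ideal_gen r R)"

definition graded_algebra :: "('k::field, 'a::ab_group_add) galgebra \<Rightarrow> bool" where
  "graded_algebra A \<longleftrightarrow> connected_graded_algebra A \<and> finitely_presented_deg1 A"


subsection \<open>Graded automorphisms and twists\<close>

definition graded_automorphism ::
  "('k::field, 'a::ab_group_add) galgebra \<Rightarrow> ('a \<Rightarrow> 'a) \<Rightarrow> bool" where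
  "graded_automorphism A \<sigma> \<longleftrightarrow>
     bij \<sigma> \<and> Vector_Spaces.linear (smul A) (smul A) \<sigma> \<and>
     (\<forall>a b. \<sigma> (gmul A a b) = gmul A (\<sigma> a) (\<sigma> b)) \<and> \<sigma> (gone A) = gone A \<and>
     (\<forall>i. \<sigma> ` apart A i \<subseteq> apart A i)"

text \<open>The product \<open>a \<cdot> b = a \<sigma>\<^bsup>|a|\<^esup>(b)\<close> on homogeneous \<open>a\<close>, extended additively in \<open>a\<close>.\<close>

definition twist ::
  "('k::field, 'a::ab_group_add) galgebra \<Rightarrow> ('a \<Rightarrow> 'a) \<Rightarrow> ('k, 'a) galgebra" where
  "twist A \<sigma> = A\<lparr>gmul := \<lambda>a b. \<Sum>i | hcomp (apart A) a i \<noteq> 0.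
                           gmul A (hcomp (apart A) a i) ((\<sigma> ^^ i) b)\<rparr>"


section \<open>\<open>\<int>\<close>-graded left modules\<close>

text \<open>
  The underlying group of a module is \<open>dsum (mpart M)\<close> inside the ambient type; the action and
  all maps are only relevant there. Scalars act through \<open>c \<mapsto> c \<cdot> 1\<close>.
\<close>

record ('a, 'm) gmodule =
  act :: "'a \<Rightarrow> 'm \<Rightarrow> 'm"
  mpart :: "int \<Rightarrow> 'm set"

abbreviation mcarrier :: "('a, 'm::ab_group_add) gmodule \<Rightarrow> 'm set" where
  "mcarrier M \<equiv> dsum (mpart M)"

definition graded_module ::
  "('k::field, 'a::ab_group_add) galgebra \<Rightarrow> ('a, 'm::ab_group_add) gmodule \<Rightarrow> bool" where
  "graded_module A M \<longleftrightarrow>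
     (\<forall>d. 0 \<in> mpart M d \<and> (\<forall>x\<in>mpart M d. \<forall>y\<in>mpart M d. x + y \<in> mpart M d)) \<and>
     independent_parts (mpart M) \<and>
     (\<forall>i d. \<forall>a\<in>apart A i. \<forall>x\<in>mpart M d. act M a x \<in> mpart M (int i + d)) \<and>
     (\<forall>x\<in>mcarrier M. act M (gone A) x = x) \<and>
     (\<forall>a b. \<forall>x\<in>mcarrier M. act M (gmul A a b) x = act M a (act M b x)) \<and>
     (\<forall>a b. \<forall>x\<in>mcarrier M. act M (a + b) x = act M a x + act M b x) \<and>
     (\<forall>a. \<forall>x\<in>mcarrier M. \<forall>y\<in>mcarrier M. act M a (x + y) = act M a x + act M a y)"

definition locally_finite_module ::
  "('k::field, 'a::ab_group_add) galgebra \<Rightarrow> ('a, 'm::ab_group_add) gmodule \<Rightarrow> bool" where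
  "locally_finite_module A M \<longleftrightarrow>
     (\<forall>d. \<exists>S. finite S \<and> S \<subseteq> mpart M d \<and>
        (\<forall>x\<in>mpart M d. \<exists>c. x = (\<Sum>s\<in>S. act M (smul A (c s) (gone A)) s)))"

text \<open>\<open>M\<close> has a basis consisting of homogeneous elements, i.e. is a direct sum of shifts of \<open>A\<close>.\<close>

definition graded_free :: "('a::ab_group_add, 'm::ab_group_add) gmodule \<Rightarrow> bool" where
  "graded_free M \<longleftrightarrow>
     (\<exists>B \<subseteq> (\<Union>d. mpart M d). \<forall>x\<in>mcarrier M. \<exists>!c.
        finite {b. c b \<noteq> 0} \<and> {b. c b \<noteq> 0} \<subseteq> B \<and> x = (\<Sum>b | c b \<noteq> 0. act M (c b) b))"

text \<open>\<open>deg_hom M N e\<close> is \<open>Hom\<^sub>A(M, N)\<^sub>e\<close>, and \<open>ghom M N\<close> is the graded Hom space, their sum over all \<open>e\<close>.\<close>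

definition deg_hom ::
  "('a, 'm::ab_group_add) gmodule \<Rightarrow> ('a, 'n::ab_group_add) gmodule \<Rightarrow> int \<Rightarrow> ('m \<Rightarrow> 'n) set" where
  "deg_hom M N e = {f.
     (\<forall>x\<in>mcarrier M. \<forall>y\<in>mcarrier M. f (x + y) = f x + f y) \<and>
     (\<forall>a. \<forall>x\<in>mcarrier M. f (act M a x) = act N a (f x)) \<and>
     (\<forall>d. f ` mpart M d \<subseteq> mpart N (d + e))}"

definition ghom ::
  "('a, 'm::ab_group_add) gmodule \<Rightarrow> ('a, 'n::ab_group_add) gmodule \<Rightarrow> ('m \<Rightarrow> 'n) set" where
  "ghom M N = {f. \<exists>E F. finite E \<and> (\<forall>e\<in>E. F e \<in> deg_hom M N e) \<and>
                   (\<forall>x\<in>mcarrier M. f x = (\<Sum>e\<in>E. F e x))}"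

text \<open>The trivial module \<open>K = A/A\<^sub>+\<close>: \<open>a\<close> acts by the scalar that is its degree 0 component.\<close>

definition augmentation :: "('k::field, 'a::ab_group_add) galgebra \<Rightarrow> 'a \<Rightarrow> 'k" where
  "augmentation A a = (THE c. hcomp (apart A) a 0 = smul A c (gone A))"

definition trivial_module ::
  "('k::field, 'a::ab_group_add) galgebra \<Rightarrow> ('a, 'k) gmodule" where
  "trivial_module A = \<lparr>act = \<lambda>a c. augmentation A a * c,
                       mpart = \<lambda>d. if d = 0 then UNIV else {0}\<rparr>"


section \<open>The Yoneda algebra \<open>E(A)\<close>\<close>

record ('k, 'a, 'm) resolution =
  rmod :: "nat \<Rightarrow> ('a, 'm) gmodule"
  rdiff :: "nat \<Rightarrow> 'm \<Rightarrow> 'm"   \<comment> \<open>\<open>rdiff n : P\<^sub>n\<^sub>+\<^sub>1 \<rightarrow> P\<^sub>n\<close>\<close>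
  raug :: "'m \<Rightarrow> 'k"           \<comment> \<open>\<open>P\<^sub>0 \<rightarrow> K\<close>\<close>

definition free_resolution ::
  "('k::field, 'a::ab_group_add) galgebra \<Rightarrow> ('k, 'a, 'm::ab_group_add) resolution \<Rightarrow> bool" where
  "free_resolution A P \<longleftrightarrow>
     (\<forall>n. graded_module A (rmod P n) \<and> locally_finite_module A (rmod P n) \<and>
          graded_free (rmod P n) \<and> rdiff P n \<in> deg_hom (rmod P (Suc n)) (rmod P n) 0) \<and>
     raug P \<in> deg_hom (rmod P 0) (trivial_module A) 0 \<and>
     raug P ` mcarrier (rmod P 0) = UNIV \<and>
     {x \<in> mcarrier (rmod P 0). raug P x = 0} = rdiff P 0 ` mcarrier (rmod P (Suc 0)) \<and>
     (\<forall>n. {x \<in> mcarrier (rmod P (Suc n)). rdiff P n x = 0}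
           = rdiff P (Suc n) ` mcarrier (rmod P (Suc (Suc n))))"

text \<open>
  \<open>ext A P n\<close> is the cohomology of the complex of graded Hom spaces \<open>Hom\<^sub>A(P, K)\<close>, that is
  \<open>E\<^sup>n(A) = \<Oplus>\<^sub>m E\<^bsup>n,m\<^esup>(A)\<close>. Its elements are classes of cocycles; cocycles that agree on the
  carrier of \<open>P\<^sub>n\<close> lie in the same class.
\<close>

definition cocycles ::
  "('k::field, 'a::ab_group_add) galgebra \<Rightarrow> ('k, 'a, 'm::ab_group_add) resolution \<Rightarrow> nat
    \<Rightarrow> ('m \<Rightarrow> 'k) set" where
  "cocycles A P n = {f \<in> ghom (rmod P n) (trivial_module A).
                       \<forall>x\<in>mcarrier (rmod P (Suc n)). f (rdiff P n x) = 0}"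

definition coboundary ::
  "('k::field, 'a::ab_group_add) galgebra \<Rightarrow> ('k, 'a, 'm::ab_group_add) resolution \<Rightarrow> nat
    \<Rightarrow> ('m \<Rightarrow> 'k) \<Rightarrow> bool" where
  "coboundary A P n f \<longleftrightarrow>
     (case n of
        0 \<Rightarrow> \<forall>x\<in>mcarrier (rmod P 0). f x = 0
      | Suc k \<Rightarrow> \<exists>h\<in>ghom (rmod P k) (trivial_module A).
                   \<forall>x\<in>mcarrier (rmod P (Suc k)). f x = h (rdiff P k x))"

definition ext_rel ::
  "('k::field, 'a::ab_group_add) galgebra \<Rightarrow> ('k, 'a, 'm::ab_group_add) resolution \<Rightarrow> nat
    \<Rightarrow> (('m \<Rightarrow> 'k) \<times> ('m \<Rightarrow> 'k)) set" where
  "ext_rel A P n = {(f, g). f \<in> cocycles A P n \<and> g \<in> cocycles A P n \<and>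
                             coboundary A P n (\<lambda>x. f x - g x)}"

definition ext ::
  "('k::field, 'a::ab_group_add) galgebra \<Rightarrow> ('k, 'a, 'm::ab_group_add) resolution \<Rightarrow> nat
    \<Rightarrow> ('m \<Rightarrow> 'k) set set" where
  "ext A P n = cocycles A P n // ext_rel A P n"

definition ext_zero ::
  "('k::field, 'a::ab_group_add) galgebra \<Rightarrow> ('k, 'a, 'm::ab_group_add) resolution \<Rightarrow> nat
    \<Rightarrow> ('m \<Rightarrow> 'k) set" where
  "ext_zero A P n = ext_rel A P n `` {\<lambda>x. 0}"

definition ext_add ::
  "('k::field, 'a::ab_group_add) galgebra \<Rightarrow> ('k, 'a, 'm::ab_group_add) resolution \<Rightarrow> nat
    \<Rightarrow> ('m \<Rightarrow> 'k) set \<Rightarrow> ('m \<Rightarrow> 'k) set \<Rightarrow> ('m \<Rightarrow> 'k) set" where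
  "ext_add A P n X Y = (\<Union>\<xi>\<in>X. \<Union>\<eta>\<in>Y. ext_rel A P n `` {\<lambda>x. \<xi> x + \<eta> x})"

definition ext_scale ::
  "('k::field, 'a::ab_group_add) galgebra \<Rightarrow> ('k, 'a, 'm::ab_group_add) resolution \<Rightarrow> nat
    \<Rightarrow> 'k \<Rightarrow> ('m \<Rightarrow> 'k) set \<Rightarrow> ('m \<Rightarrow> 'k) set" where
  "ext_scale A P n c X = (\<Union>\<xi>\<in>X. ext_rel A P n `` {\<lambda>x. c * \<xi> x})"

text \<open>
  Yoneda product: a cocycle \<open>\<eta> : P\<^sub>n \<rightarrow> K\<close> lifts to a chain map \<open>\<phi>\<^sub>i : P\<^sub>n\<^sub>+\<^sub>i \<rightarrow> P\<^sub>i\<close>, unique up to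
  homotopy, and \<open>[\<xi>][\<eta>] = [\<xi> \<circ> \<phi>\<^sub>m]\<close> for \<open>\<xi> : P\<^sub>m \<rightarrow> K\<close>. The class does not depend on the choices,
  so the union below is over copies of one class.
\<close>

definition chain_lifts ::
  "('k::field, 'a::ab_group_add) galgebra \<Rightarrow> ('k, 'a, 'm::ab_group_add) resolution \<Rightarrow> nat
    \<Rightarrow> ('m \<Rightarrow> 'k) \<Rightarrow> (nat \<Rightarrow> 'm \<Rightarrow> 'm) set" where
  "chain_lifts A P n \<eta> = {\<phi>.
     (\<forall>i. \<phi> i \<in> ghom (rmod P (n + i)) (rmod P i)) \<and>
     (\<forall>x\<in>mcarrier (rmod P n). raug P (\<phi> 0 x) = \<eta> x) \<and>
     (\<forall>i. \<forall>x\<in>mcarrier (rmod P (Suc (n + i))).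
        rdiff P i (\<phi> (Suc i) x) = \<phi> i (rdiff P (n + i) x))}"

definition ext_prod ::
  "('k::field, 'a::ab_group_add) galgebra \<Rightarrow> ('k, 'a, 'm::ab_group_add) resolution \<Rightarrow> nat \<Rightarrow> nat
    \<Rightarrow> ('m \<Rightarrow> 'k) set \<Rightarrow> ('m \<Rightarrow> 'k) set \<Rightarrow> ('m \<Rightarrow> 'k) set" where
  "ext_prod A P m n X Y =
     (\<Union>\<xi>\<in>X. \<Union>\<eta>\<in>Y. \<Union>\<phi>\<in>chain_lifts A P n \<eta>. ext_rel A P (m + n) `` {\<lambda>x. \<xi> (\<phi> m x)})"

text \<open>
  The algebra \<open>E(A) = \<Oplus>\<^sub>n E\<^sup>n(A)\<close>: an element is the family of its components, almost all of
  which vanish.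
\<close>

definition yoneda_carrier ::
  "('k::field, 'a::ab_group_add) galgebra \<Rightarrow> ('k, 'a, 'm::ab_group_add) resolution
    \<Rightarrow> (nat \<Rightarrow> ('m \<Rightarrow> 'k) set) set" where
  "yoneda_carrier A P =
     {u. (\<forall>n. u n \<in> ext A P n) \<and> finite {n. u n \<noteq> ext_zero A P n}}"

definition yoneda_one ::
  "('k::field, 'a::ab_group_add) galgebra \<Rightarrow> ('k, 'a, 'm::ab_group_add) resolution
    \<Rightarrow> nat \<Rightarrow> ('m \<Rightarrow> 'k) set" where
  "yoneda_one A P n = (if n = 0 then ext_rel A P 0 `` {raug P} else ext_zero A P n)"

definition yoneda_add ::
  "('k::field, 'a::ab_group_add) galgebra \<Rightarrow> ('k, 'a, 'm::ab_group_add) resolution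
    \<Rightarrow> (nat \<Rightarrow> ('m \<Rightarrow> 'k) set) \<Rightarrow> (nat \<Rightarrow> ('m \<Rightarrow> 'k) set) \<Rightarrow> nat \<Rightarrow> ('m \<Rightarrow> 'k) set" where
  "yoneda_add A P u v n = ext_add A P n (u n) (v n)"

definition yoneda_scale ::
  "('k::field, 'a::ab_group_add) galgebra \<Rightarrow> ('k, 'a, 'm::ab_group_add) resolution
    \<Rightarrow> 'k \<Rightarrow> (nat \<Rightarrow> ('m \<Rightarrow> 'k) set) \<Rightarrow> nat \<Rightarrow> ('m \<Rightarrow> 'k) set" where
  "yoneda_scale A P c u n = ext_scale A P n c (u n)"

text \<open>The sum, in \<open>E\<^sup>n\<close>, of the products \<open>u i \<cdot> v (n - i)\<close> for \<open>i \<le> n\<close>.\<close>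

definition yoneda_mul ::
  "('k::field, 'a::ab_group_add) galgebra \<Rightarrow> ('k, 'a, 'm::ab_group_add) resolution
    \<Rightarrow> (nat \<Rightarrow> ('m \<Rightarrow> 'k) set) \<Rightarrow> (nat \<Rightarrow> ('m \<Rightarrow> 'k) set) \<Rightarrow> nat \<Rightarrow> ('m \<Rightarrow> 'k) set" where
  "yoneda_mul A P u v n =
     foldr (\<lambda>i. ext_add A P n (ext_prod A P i (n - i) (u i) (v (n - i))))
       [0..<Suc n] (ext_zero A P n)"

definition yoneda_degree ::
  "('k::field, 'a::ab_group_add) galgebra \<Rightarrow> ('k, 'a, 'm::ab_group_add) resolution \<Rightarrow> nat
    \<Rightarrow> (nat \<Rightarrow> ('m \<Rightarrow> 'k) set) set" where
  "yoneda_degree A P n = {u \<in> yoneda_carrier A P. \<forall>i. i \<noteq> n \<longrightarrow> u i = ext_zero A P i}"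

inductive_set yoneda_generated ::
  "('k::field, 'a::ab_group_add) galgebra \<Rightarrow> ('k, 'a, 'm::ab_group_add) resolution
    \<Rightarrow> (nat \<Rightarrow> ('m \<Rightarrow> 'k) set) set \<Rightarrow> (nat \<Rightarrow> ('m \<Rightarrow> 'k) set) set"
  for A P S where
  one: "yoneda_one A P \<in> yoneda_generated A P S"
| gen: "u \<in> S \<Longrightarrow> u \<in> yoneda_generated A P S"
| scale: "u \<in> yoneda_generated A P S \<Longrightarrow> yoneda_scale A P c u \<in> yoneda_generated A P S"
| add: "u \<in> yoneda_generated A P S \<Longrightarrow> v \<in> yoneda_generated A P S
         \<Longrightarrow> yoneda_add A P u v \<in> yoneda_generated A P S"
| mul: "u \<in> yoneda_generated A P S \<Longrightarrow> v \<in> yoneda_generated A P S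
         \<Longrightarrow> yoneda_mul A P u v \<in> yoneda_generated A P S"

text \<open>
  Up to isomorphism \<open>E(A)\<close> does not depend on the resolution used to compute it. The trivial module of
  a finitely generated connected \<open>A\<close> has a resolution by locally finite graded free modules;
  these have countable bases, so they can be realised as subgroups of \<open>nat \<Rightarrow> 'a\<close>, the
  \<open>x\<close>-th coordinate of an element being its coefficient at the \<open>x\<close>-th basis vector.
\<close>

definition K2 :: "('k::field, 'a::ab_group_add) galgebra \<Rightarrow> bool" where
  "K2 A \<longleftrightarrow>
     (\<exists>P :: ('k, 'a, nat \<Rightarrow> 'a) resolution. free_resolution A P \<and>
        yoneda_generated A P (yoneda_degree A P 1 \<union> yoneda_degree A P 2) = yoneda_carrier A P)"

end

theory Submission
  imports Defs
begin

text \<open>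
  A graded \<open>A\<close>-module \<open>M\<close> becomes an \<open>A\<^sup>\<sigma>\<close>-module with the action
  \<open>a * x = \<sigma>\<^bsup>-|a|-|x|\<^esup>(a) x\<close>. The homogeneous parts and the linear maps of degree 0 stay the same,
  a homogeneous basis stays a basis, and \<open>K\<close> goes to \<open>K\<close> because \<open>\<sigma>\<close> preserves the augmentation.
  So a free resolution \<open>P\<close> of \<open>K\<close> over \<open>A\<close> is also one over \<open>A\<^sup>\<sigma>\<close>
  (\<open>free_twist\<close>), and the complexes of graded maps from \<open>P\<close> to \<open>K\<close> coincide
  (\<open>twist_cocycles\<close>, \<open>twist_coboundary\<close>). Thus \<open>E\<^sup>n(A)\<close> and \<open>E\<^sup>n(A\<^sup>\<sigma>)\<close> are the same groups.

  Only the product changes. A map of degree \<open>e\<close> that is linear over \<open>A\<^sup>\<sigma>\<close> is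
  \<open>\<sigma>\<^bsup>-e\<^esup>\<close>-semilinear over \<open>A\<close> (\<open>twist_deg_hom\<close>). It becomes linear after composition with a
  \<open>\<sigma>\<^sup>e\<close>-semilinear chain map \<open>T\<^sub>e : P \<rightarrow> P\<close> over the identity of \<open>K\<close>, which the comparison theorem
  provides. So the product in \<open>E(A)\<close> of \<open>\<xi>\<close> with a homogeneous \<open>\<eta>\<close> of degree \<open>e\<close> is the product in
  \<open>E(A\<^sup>\<sigma>)\<close> of \<open>\<xi> T\<^sub>e\<close> with \<open>\<eta>\<close>, where \<open>\<xi> T\<^sub>e\<close> has the same cohomological degree as \<open>\<xi>\<close>.

  To exploit this, generation is restated linearly. As \<open>E\<^sup>0(A) = K\<close> and the product is associative,
  \<open>E(A)\<close> is generated by \<open>E\<^sup>1(A)\<close> and \<open>E\<^sup>2(A)\<close> if and only if, for \<open>n \<ge> 3\<close>, every class in \<open>E\<^sup>n(A)\<close>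
  is a sum of products with left factor in \<open>E\<^sup>1(A)\<close> or \<open>E\<^sup>2(A)\<close> (\<open>generated_iff_decomposable\<close>).
  Splitting right factors into homogeneous components turns such a sum for \<open>A\<close> into one for \<open>A\<^sup>\<sigma>\<close>
  (\<open>decomposable_twist\<close>). Hence the property passes from \<open>A\<close> to \<open>A\<^sup>\<sigma>\<close>; it passes back because
  \<open>(A\<^sup>\<sigma>)\<^sup>\<tau> = A\<close> for \<open>\<tau> = \<sigma>\<^sup>-\<^sup>1\<close> (\<open>twist_twist\<close>).
\<close>

section \<open>Graded abelian groups\<close>

locale graded_group =
  fixes G :: "'i \<Rightarrow> 'm::ab_group_add set"
  assumes part_zero: "0 \<in> G i"
    and part_add: "x \<in> G i \<Longrightarrow> y \<in> G i \<Longrightarrow> x + y \<in> G i"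
    and part_minus: "x \<in> G i \<Longrightarrow> - x \<in> G i"
    and indep: "independent_parts G"
begin

lemma decompI:
  assumes "\<And>i. c i \<in> G i" "finite F" "\<And>i. i \<notin> F \<Longrightarrow> c i = 0" "x = sum c F"
  shows "decomp G x c"
proof -
  have sub: "{i. c i \<noteq> 0} \<subseteq> F" using assms(3) by blast
  have eq: "sum c {i. c i \<noteq> 0} = sum c F"
    by (rule sum.mono_neutral_left[OF assms(2) sub]) simp
  show ?thesis
    unfolding decomp_def eq
    using assms(1,4) finite_subset[OF sub assms(2)] by blast
qed

lemma decomp_hcomp: "x \<in> dsum G \<Longrightarrow> decomp G x (hcomp G x)"
  unfolding hcomp_def
  using theI'[of "decomp G x"] indep unfolding independent_parts_def by simp

lemma hcomp_unique:
  assumes "decomp G x c" shows "hcomp G x = c"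
proof -
  have "x \<in> dsum G" using assms unfolding dsum_def by blast
  then show ?thesis
    using indep decomp_hcomp[of x] assms unfolding independent_parts_def by blast
qed

lemma hcomp_in: "x \<in> dsum G \<Longrightarrow> hcomp G x i \<in> G i"
  and finite_hcomp: "x \<in> dsum G \<Longrightarrow> finite {i. hcomp G x i \<noteq> 0}"
  and sum_hcomp: "x \<in> dsum G \<Longrightarrow> (\<Sum>i | hcomp G x i \<noteq> 0. hcomp G x i) = x"
  using decomp_hcomp[of x] unfolding decomp_def by (blast, blast, metis (lifting))

lemma decomp_homogeneous:
  "x \<in> G i \<Longrightarrow> decomp G x (\<lambda>j. if j = i then x else 0)"
  by (rule decompI[where F = "{i}"]) (auto simp: part_zero)

lemma part_dsum: "x \<in> G i \<Longrightarrow> x \<in> dsum G"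
  using decomp_homogeneous unfolding dsum_def by blast

lemma hcomp_homogeneous: "x \<in> G i \<Longrightarrow> hcomp G x = (\<lambda>j. if j = i then x else 0)"
  using decomp_homogeneous hcomp_unique by blast

lemma part_sum: "(\<And>s. s \<in> S \<Longrightarrow> f s \<in> G i) \<Longrightarrow> sum f S \<in> G i"
  by (induction S rule: infinite_finite_induct) (auto simp: part_zero part_add)

lemma sum_hcomp_superset:
  assumes "x \<in> dsum G" "finite F" "{i. hcomp G x i \<noteq> 0} \<subseteq> F"
  shows "sum (hcomp G x) F = x"
  using sum.mono_neutral_right[OF assms(2,3), of "hcomp G x"] sum_hcomp[OF assms(1)] by simp

lemma decomp_add:
  assumes "x \<in> dsum G" "y \<in> dsum G"
  shows "decomp G (x + y) (\<lambda>i. hcomp G x i + hcomp G y i)"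
proof (rule decompI[where F = "{i. hcomp G x i \<noteq> 0} \<union> {i. hcomp G y i \<noteq> 0}"])
  let ?F = "{i. hcomp G x i \<noteq> 0} \<union> {i. hcomp G y i \<noteq> 0}"
  show "finite ?F" using assms finite_hcomp by blast
  then show "x + y = (\<Sum>i\<in>?F. hcomp G x i + hcomp G y i)"
    using sum_hcomp_superset[OF assms(1), of ?F] sum_hcomp_superset[OF assms(2), of ?F]
    by (simp add: sum.distrib)
qed (use assms in \<open>auto intro: part_add hcomp_in\<close>)

lemma dsum_add: "x \<in> dsum G \<Longrightarrow> y \<in> dsum G \<Longrightarrow> x + y \<in> dsum G"
  using decomp_add unfolding dsum_def by blast

lemma hcomp_add:
  "x \<in> dsum G \<Longrightarrow> y \<in> dsum G \<Longrightarrow> hcomp G (x + y) i = hcomp G x i + hcomp G y i"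
  using fun_cong[OF hcomp_unique[OF decomp_add], of x y i] by simp

lemma dsum_zero: "0 \<in> dsum G"
  using part_dsum part_zero by blast

lemma dsum_sum: "(\<And>s. s \<in> S \<Longrightarrow> f s \<in> dsum G) \<Longrightarrow> sum f S \<in> dsum G"
  by (induction S rule: infinite_finite_induct) (auto simp: dsum_zero dsum_add)

lemma dsum_induct [consumes 1, case_names homogeneous add]:
  assumes "x \<in> dsum G"
    and hom: "\<And>i x. x \<in> G i \<Longrightarrow> P x"
    and add: "\<And>x y. x \<in> dsum G \<Longrightarrow> y \<in> dsum G \<Longrightarrow> P x \<Longrightarrow> P y \<Longrightarrow> P (x + y)"
  shows "P x"
proof -
  have *: "sum (hcomp G x) F \<in> dsum G \<and> P (sum (hcomp G x) F)" if "finite F" for F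
    using that
  proof (induction F)
    case empty
    then show ?case using hom[OF part_zero] by (simp add: dsum_zero)
  next
    case (insert i F)
    have "hcomp G x i \<in> G i" using assms(1) by (rule hcomp_in)
    then show ?case using insert add hom part_dsum dsum_add by simp
  qed
  show ?thesis using *[OF finite_hcomp[OF assms(1)]] sum_hcomp[OF assms(1)] by simp
qed

lemma dsum_minus: "x \<in> dsum G \<Longrightarrow> - x \<in> dsum G"
proof (induction x rule: dsum_induct)
  case (homogeneous i x)
  then show ?case by (intro part_dsum part_minus)
next
  case (add x y)
  then show ?case using dsum_add[of "- x" "- y"] by simp
qed

lemma dsum_diff: "x \<in> dsum G \<Longrightarrow> y \<in> dsum G \<Longrightarrow> x - y \<in> dsum G"
  using dsum_add[of x "- y"] dsum_minus[of y] by simp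

lemma hcomp_zero: "hcomp G 0 i = 0"
  using hcomp_homogeneous[OF part_zero] by simp

lemma hcomp_sum:
  "(\<And>s. s \<in> S \<Longrightarrow> f s \<in> dsum G) \<Longrightarrow> hcomp G (sum f S) i = (\<Sum>s\<in>S. hcomp G (f s) i)"
  by (induction S rule: infinite_finite_induct) (auto simp: hcomp_zero hcomp_add dsum_sum)

lemma homogeneous_sum_zero:
  assumes "finite E" "\<And>e. e \<in> E \<Longrightarrow> y e \<in> G (p e)" "inj_on p E" "sum y E = 0" "e \<in> E"
  shows "y e = 0"
proof -
  have "0 = hcomp G (sum y E) (p e)" using assms(4) by (simp add: hcomp_zero)
  also have "\<dots> = (\<Sum>e'\<in>E. hcomp G (y e') (p e))"
    by (rule hcomp_sum) (use assms(2) part_dsum in blast)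
  also have "\<dots> = (\<Sum>e'\<in>E. if e' = e then y e else 0)"
    by (rule sum.cong[OF refl])
      (use assms(3,5) in \<open>auto simp: hcomp_homogeneous[OF assms(2)] inj_on_eq_iff\<close>)
  also have "\<dots> = y e" using assms(1,5) by simp
  finally show ?thesis by simp
qed

end

text \<open>
  The twisted product and the twisted action are both of this form, so that their laws need to
  be checked on homogeneous elements only.
\<close>

definition additive_ext :: "('i \<Rightarrow> 'm::ab_group_add set) \<Rightarrow> ('i \<Rightarrow> 'm \<Rightarrow> 'n::ab_group_add) \<Rightarrow> 'm \<Rightarrow> 'n" where
  "additive_ext G f x = (\<Sum>i | hcomp G x i \<noteq> 0. f i (hcomp G x i))"

context graded_group
begin

lemma additive_ext_homogeneous:
  assumes "f i 0 = 0" "x \<in> G i" shows "additive_ext G f x = f i x"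
proof -
  have "{j. hcomp G x j \<noteq> 0} = (if x = 0 then {} else {i})"
    using hcomp_homogeneous[OF assms(2)] by auto
  then show ?thesis
    unfolding additive_ext_def using hcomp_homogeneous[OF assms(2)] assms(1) by simp
qed

lemma additive_ext_add:
  assumes f: "\<And>i x y. x \<in> G i \<Longrightarrow> y \<in> G i \<Longrightarrow> f i (x + y) = f i x + f i y"
    and x: "x \<in> dsum G" and y: "y \<in> dsum G"
  shows "additive_ext G f (x + y) = additive_ext G f x + additive_ext G f y"
proof -
  have f0: "f i 0 = 0" for i using f[OF part_zero part_zero, of i] by simp
  let ?F = "{i. hcomp G x i \<noteq> 0} \<union> {i. hcomp G y i \<noteq> 0}"
  have fin: "finite ?F" using x y finite_hcomp by blast
  have eq: "additive_ext G f z = (\<Sum>i\<in>?F. f i (hcomp G z i))" if "{i. hcomp G z i \<noteq> 0} \<subseteq> ?F" for z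
    unfolding additive_ext_def
    by (rule sum.mono_neutral_left) (use fin that f0 in auto)
  have "additive_ext G f (x + y) = (\<Sum>i\<in>?F. f i (hcomp G (x + y) i))"
    by (rule eq) (auto simp: hcomp_add[OF x y])
  also have "\<dots> = (\<Sum>i\<in>?F. f i (hcomp G x i)) + (\<Sum>i\<in>?F. f i (hcomp G y i))"
    by (simp add: hcomp_add[OF x y] f hcomp_in x y sum.distrib)
  also have "\<dots> = additive_ext G f x + additive_ext G f y"
    using eq[of x] eq[of y] by auto
  finally show ?thesis .
qed

end

section \<open>Graded algebras, automorphisms and twists\<close>

locale connected_algebra =
  fixes A :: "('k::field, 'a::ab_group_add) galgebra"
  assumes connected: "connected_graded_algebra A"
begin

lemma vector_space: "vector_space (smul A)"
  and mul_assoc: "gmul A (gmul A a b) c = gmul A a (gmul A b c)"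
  and one_mul [simp]: "gmul A (gone A) a = a"
  and mul_one [simp]: "gmul A a (gone A) = a"
  and mul_add_left: "gmul A (a + b) c = gmul A a c + gmul A b c"
  and mul_add_right: "gmul A a (b + c) = gmul A a b + gmul A a c"
  and mul_smul_left: "gmul A (smul A r a) b = smul A r (gmul A a b)"
  and mul_smul_right: "gmul A a (smul A r b) = smul A r (gmul A a b)"
  and subspace_part: "module.subspace (smul A) (apart A i)"
  and carrier_UNIV: "dsum (apart A) = UNIV"
  and independent: "independent_parts (apart A)"
  and mul_part: "a \<in> apart A i \<Longrightarrow> b \<in> apart A j \<Longrightarrow> gmul A a b \<in> apart A (i + j)"
  and one_neq_zero: "gone A \<noteq> 0"
  and part_0: "apart A 0 = range (\<lambda>r. smul A r (gone A))"
  using connected unfolding connected_graded_algebra_def by (simp_all, blast?)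

sublocale scalars: vector_space "smul A" by (rule vector_space)

lemma smul_part: "a \<in> apart A i \<Longrightarrow> smul A r a \<in> apart A i"
  using subspace_part by (rule scalars.subspace_scale)

sublocale parts: graded_group "apart A"
proof
  show "0 \<in> apart A i" for i using subspace_part by (rule scalars.subspace_0)
  show "x + y \<in> apart A i" if "x \<in> apart A i" "y \<in> apart A i" for x y i
    using subspace_part that by (rule scalars.subspace_add)
  show "- x \<in> apart A i" if "x \<in> apart A i" for x i
    using subspace_part that by (rule scalars.subspace_neg)
qed (rule independent)

lemma in_dsum [simp]: "a \<in> dsum (apart A)"
  by (simp add: carrier_UNIV)

lemma algebra_induct [case_names homogeneous add]:
  assumes "\<And>i a. a \<in> apart A i \<Longrightarrow> P a" "\<And>a b. P a \<Longrightarrow> P b \<Longrightarrow> P (a + b)"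
  shows "P a"
  using in_dsum[of a] by (induction a rule: parts.dsum_induct) (use assms in auto)

lemma scalar_part: "smul A r (gone A) \<in> apart A 0"
  and one_part: "gone A \<in> apart A 0"
  using part_0 by (auto intro: range_eqI[of _ _ 1])

lemma mul_zero [simp]: "gmul A a 0 = 0" "gmul A 0 a = 0"
  using mul_add_right[of a 0 0] mul_add_left[of 0 0 a] by simp_all

lemma augmentation_eq: "hcomp (apart A) a 0 = smul A (augmentation A a) (gone A)"
proof -
  have "hcomp (apart A) a 0 \<in> apart A 0" by (rule parts.hcomp_in) simp
  then obtain c where c: "hcomp (apart A) a 0 = smul A c (gone A)" using part_0 by auto
  have "\<exists>!c. hcomp (apart A) a 0 = smul A c (gone A)"
    using c one_neq_zero by (auto simp: scalars.scale_cancel_right)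
  then show ?thesis unfolding augmentation_def by (rule theI')
qed

lemma augmentation_unique:
  "hcomp (apart A) a 0 = smul A c (gone A) \<Longrightarrow> augmentation A a = c"
  using augmentation_eq[of a] one_neq_zero by (simp add: scalars.scale_cancel_right)

lemma augmentation_add: "augmentation A (a + b) = augmentation A a + augmentation A b"
  by (rule augmentation_unique)
    (subst parts.hcomp_add; simp add: augmentation_eq scalars.scale_left_distrib)

lemma augmentation_scalar [simp]: "augmentation A (smul A c (gone A)) = c"
  by (rule augmentation_unique) (simp add: parts.hcomp_homogeneous[OF scalar_part])

lemma augmentation_one [simp]: "augmentation A (gone A) = 1"
  using augmentation_scalar[of 1] by simp

lemma augmentation_positive: "a \<in> apart A i \<Longrightarrow> i \<noteq> 0 \<Longrightarrow> augmentation A a = 0"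
  by (rule augmentation_unique) (simp add: parts.hcomp_homogeneous)

lemma augmentation_mul: "augmentation A (gmul A a b) = augmentation A a * augmentation A b"
proof (induction a rule: algebra_induct)
  case (add a a')
  then show ?case by (simp add: mul_add_left augmentation_add distrib_right)
next
  case (homogeneous i a)
  then show ?case
  proof (induction b rule: algebra_induct)
    case (add b b')
    then show ?case by (simp add: mul_add_right augmentation_add distrib_left)
  next
    case (homogeneous j b)
    show ?case
    proof (cases "i = 0 \<and> j = 0")
      case True
      then obtain c d where "a = smul A c (gone A)" "b = smul A d (gone A)"
        using homogeneous part_0 by auto
      then show ?thesis by (simp add: mul_smul_left)
    next
      case False
      then have "augmentation A (gmul A a b) = 0"
        using homogeneous by (intro augmentation_positive[OF mul_part]) auto
      then show ?thesis
        using False homogeneous augmentation_positive by auto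
    qed
  qed
qed

end


subsection \<open>Automorphisms and their integer powers\<close>

lemma graded_automorphism_iff:
  "graded_automorphism A \<rho> \<longleftrightarrow>
     bij \<rho> \<and> Vector_Spaces.linear (smul A) (smul A) \<rho> \<and>
     (\<forall>a b. \<rho> (gmul A a b) = gmul A (\<rho> a) (\<rho> b)) \<and> \<rho> (gone A) = gone A \<and>
     (\<forall>i. \<forall>a\<in>apart A i. \<rho> a \<in> apart A i)"
  unfolding graded_automorphism_def by (simp add: image_subset_iff)

lemma
  assumes "graded_automorphism A \<rho>"
  shows automorphism_bij: "bij \<rho>"
    and automorphism_linear: "Vector_Spaces.linear (smul A) (smul A) \<rho>"
    and automorphism_mul: "\<rho> (gmul A a b) = gmul A (\<rho> a) (\<rho> b)"
    and automorphism_one: "\<rho> (gone A) = gone A"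
    and automorphism_part: "a \<in> apart A i \<Longrightarrow> \<rho> a \<in> apart A i"
  using assms unfolding graded_automorphism_iff by blast+

lemma
  assumes "graded_automorphism A \<rho>"
  shows automorphism_add: "\<rho> (a + b) = \<rho> a + \<rho> b"
    and automorphism_smul: "\<rho> (smul A r a) = smul A r (\<rho> a)"
    and automorphism_zero: "\<rho> 0 = 0"
proof -
  interpret Vector_Spaces.linear "smul A" "smul A" \<rho> using automorphism_linear[OF assms] .
  show "\<rho> (a + b) = \<rho> a + \<rho> b" "\<rho> (smul A r a) = smul A r (\<rho> a)" "\<rho> 0 = 0"
    by (rule add scale zero)+
qed

definition zpow :: "('a \<Rightarrow> 'a) \<Rightarrow> int \<Rightarrow> 'a \<Rightarrow> 'a" where
  "zpow \<sigma> k = (if 0 \<le> k then \<sigma> ^^ nat k else inv \<sigma> ^^ nat (- k))"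

lemma zpow_of_nat [simp]: "zpow \<sigma> (int i) = \<sigma> ^^ i"
  and zpow_0 [simp]: "zpow \<sigma> 0 x = x"
  and zpow_minus_one: "zpow \<sigma> (- 1) = inv \<sigma>"
  by (simp_all add: zpow_def)

lemma zpow_succ:
  assumes "bij \<sigma>" shows "zpow \<sigma> (k + 1) x = \<sigma> (zpow \<sigma> k x)"
proof (cases "0 \<le> k")
  case True
  then show ?thesis by (simp add: zpow_def nat_add_distrib)
next
  case False
  then obtain m where m: "k = - int (Suc m)" by (metis int_cases linorder_not_less of_nat_0_le_iff)
  have "nat (- (k + 1)) = m" "nat (- k) = Suc m" using m by simp_all
  moreover have "zpow \<sigma> (k + 1) = inv \<sigma> ^^ nat (- (k + 1))" using m by (simp add: zpow_def)
  ultimately show ?thesis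
    using assms False by (simp add: zpow_def bij_is_surj surj_f_inv_f)
qed

lemma zpow_add:
  assumes "bij \<sigma>" shows "zpow \<sigma> (j + k) x = zpow \<sigma> j (zpow \<sigma> k x)"
proof (induction j rule: int_induct[where k = 0])
  case base
  then show ?case by simp
next
  case (step1 i)
  then show ?case
    using zpow_succ[OF assms, of "i + k" x] zpow_succ[OF assms, of i] by (simp add: algebra_simps)
next
  case (step2 i)
  have "\<sigma> (zpow \<sigma> (i - 1 + k) x) = \<sigma> (zpow \<sigma> (i - 1) (zpow \<sigma> k x))"
    using step2 zpow_succ[OF assms, of "i - 1 + k" x] zpow_succ[OF assms, of "i - 1"] by simp
  then show ?case using assms by (simp add: bij_is_inj inj_eq)
qed

lemma zpow_cancel:
  assumes "bij \<sigma>" shows "zpow \<sigma> k (zpow \<sigma> (- k) x) = x" "zpow \<sigma> (- k) (zpow \<sigma> k x) = x"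
  using zpow_add[OF assms, of k "- k" x] zpow_add[OF assms, of "- k" k x] by simp_all

context connected_algebra
begin

lemma hcomp_automorphism:
  assumes "graded_automorphism A \<rho>"
  shows "hcomp (apart A) (\<rho> a) i = \<rho> (hcomp (apart A) a i)"
proof (induction a rule: algebra_induct)
  case (homogeneous j a)
  show ?case
    using parts.hcomp_homogeneous[OF homogeneous]
      parts.hcomp_homogeneous[OF automorphism_part[OF assms homogeneous]]
    by (simp add: automorphism_zero[OF assms])
next
  case (add a b)
  then show ?case by (simp add: automorphism_add[OF assms] parts.hcomp_add)
qed

lemma augmentation_automorphism:
  "graded_automorphism A \<rho> \<Longrightarrow> augmentation A (\<rho> a) = augmentation A a"
  by (rule augmentation_unique)
    (subst hcomp_automorphism; simp add: augmentation_eq automorphism_smul automorphism_one)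

lemma automorphism_inv:
  assumes "graded_automorphism A \<rho>" shows "graded_automorphism A (inv \<rho>)"
  unfolding graded_automorphism_iff
proof (intro conjI allI ballI)
  note b = automorphism_bij[OF assms]
  have inv: "\<rho> (inv \<rho> a) = a" "inv \<rho> (\<rho> a) = a" for a
    using b by (simp_all add: bij_is_surj surj_f_inv_f bij_is_inj)
  have eqI: "inv \<rho> a = c" if "a = \<rho> c" for a c using inv that by simp
  show "bij (inv \<rho>)" by (rule bij_imp_bij_inv[OF b])
  show "Vector_Spaces.linear (smul A) (smul A) (inv \<rho>)"
    by (unfold_locales; rule eqI) (simp_all add: automorphism_add[OF assms] automorphism_smul[OF assms] inv)
  show "inv \<rho> (gmul A a b) = gmul A (inv \<rho> a) (inv \<rho> b)" for a b
    by (rule eqI) (simp add: automorphism_mul[OF assms] inv)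
  show "inv \<rho> (gone A) = gone A"
    by (rule eqI) (simp add: automorphism_one[OF assms])
  show "inv \<rho> a \<in> apart A i" if "a \<in> apart A i" for a i
  proof -
    \<comment> \<open>The component of degree \<open>i\<close> of the preimage of \<open>a\<close> is itself a preimage of \<open>a\<close>.\<close>
    have "a = \<rho> (hcomp (apart A) (inv \<rho> a) i)"
      using hcomp_automorphism[OF assms, of "inv \<rho> a" i] parts.hcomp_homogeneous[OF that]
      by (simp add: inv)
    then show ?thesis using eqI parts.hcomp_in[OF in_dsum] by metis
  qed
qed

lemma automorphism_funpow:
  assumes "graded_automorphism A \<rho>" shows "graded_automorphism A (\<rho> ^^ n)"
proof (induction n)
  case 0
  show ?case
    unfolding graded_automorphism_iff
    by (simp add: scalars.linear_id)
next
  case (Suc n)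
  then show ?case
    unfolding graded_automorphism_iff funpow.simps
    using assms[unfolded graded_automorphism_iff]
    by (auto simp: bij_comp intro: Vector_Spaces.linear_compose)
qed

lemma automorphism_zpow:
  "graded_automorphism A \<sigma> \<Longrightarrow> graded_automorphism A (zpow \<sigma> k)"
  unfolding zpow_def by (simp add: automorphism_funpow automorphism_inv)

end


subsection \<open>The twisted algebra\<close>

lemma twist_simps [simp]:
  "smul (twist A \<sigma>) = smul A" "gone (twist A \<sigma>) = gone A" "apart (twist A \<sigma>) = apart A"
  by (simp_all add: twist_def)

lemma augmentation_twist [simp]: "augmentation (twist A \<sigma>) = augmentation A"
  and trivial_module_twist [simp]: "trivial_module (twist A \<sigma>) = trivial_module A"
  by (simp_all add: augmentation_def trivial_module_def fun_eq_iff)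

locale twisted_algebra = connected_algebra A for A :: "('k::field, 'a::ab_group_add) galgebra" +
  fixes \<sigma> :: "'a \<Rightarrow> 'a"
  assumes automorphism: "graded_automorphism A \<sigma>"
begin

lemmas zpow_automorphism = automorphism_zpow[OF automorphism]
lemmas bij = automorphism_bij[OF automorphism]
lemmas zpow_simps = automorphism_add[OF zpow_automorphism] automorphism_mul[OF zpow_automorphism]
  automorphism_one[OF zpow_automorphism] automorphism_smul[OF zpow_automorphism]
  automorphism_zero[OF zpow_automorphism]
lemmas zpow_part = automorphism_part[OF zpow_automorphism]

lemma twist_mul_eq:
  "gmul (twist A \<sigma>) a b = additive_ext (apart A) (\<lambda>i a. gmul A a (zpow \<sigma> (int i) b)) a"
  by (simp add: twist_def additive_ext_def)

lemma twist_mul_homogeneous: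
  "a \<in> apart A i \<Longrightarrow> gmul (twist A \<sigma>) a b = gmul A a (zpow \<sigma> (int i) b)"
  unfolding twist_mul_eq by (rule parts.additive_ext_homogeneous) simp

lemma twist_mul_add_left:
  "gmul (twist A \<sigma>) (a + a') b = gmul (twist A \<sigma>) a b + gmul (twist A \<sigma>) a' b"
  unfolding twist_mul_eq by (rule parts.additive_ext_add) (simp_all add: mul_add_left)

lemma twist_mul_add_right:
  "gmul (twist A \<sigma>) a (b + b') = gmul (twist A \<sigma>) a b + gmul (twist A \<sigma>) a b'"
  by (simp only: twist_mul_eq additive_ext_def zpow_simps mul_add_right sum.distrib)

text \<open>
  Associativity: for homogeneous \<open>a\<close> and \<open>b\<close>, both bracketings of a threefold twisted product are
  \<open>a \<sigma>\<^bsup>|a|\<^esup>(b) \<sigma>\<^bsup>|a|+|b|\<^esup>(c)\<close>.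
\<close>

lemma connected_twist: "connected_graded_algebra (twist A \<sigma>)"
  unfolding connected_graded_algebra_def twist_simps
proof (intro conjI allI ballI vector_space subspace_part carrier_UNIV independent
    one_neq_zero part_0 twist_mul_add_left twist_mul_add_right)
  show "gmul (twist A \<sigma>) (gmul (twist A \<sigma>) a b) c = gmul (twist A \<sigma>) a (gmul (twist A \<sigma>) b c)" for a b c
  proof (induction a rule: algebra_induct)
    case (add a a')
    then show ?case by (simp add: twist_mul_add_left)
  next
    case (homogeneous i a)
    then show ?case
    proof (induction b rule: algebra_induct)
      case (add b b')
      then show ?case by (simp add: twist_mul_add_left twist_mul_add_right)
    next
      case (homogeneous j b)
      have "gmul A a (zpow \<sigma> (int i) b) \<in> apart A (i + j)"
        using homogeneous zpow_part mul_part by blast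
      then show ?case
        using homogeneous
        by (simp add: twist_mul_homogeneous mul_assoc zpow_simps flip: zpow_of_nat)
          (simp add: zpow_add[OF bij] flip: zpow_of_nat)
    qed
  qed
  show "gmul (twist A \<sigma>) (gone A) a = a" for a
    by (simp add: twist_mul_homogeneous[OF one_part])
  show "gmul (twist A \<sigma>) a (gone A) = a" for a
    by (induction a rule: algebra_induct)
      (simp_all add: twist_mul_add_left twist_mul_homogeneous zpow_simps flip: zpow_of_nat)
  show "gmul (twist A \<sigma>) (smul A r a) b = smul A r (gmul (twist A \<sigma>) a b)" for r a b
  proof (induction a rule: algebra_induct)
    case (homogeneous i a)
    then show ?case
      using twist_mul_homogeneous[OF smul_part[OF homogeneous, of r]]
      by (simp add: twist_mul_homogeneous mul_smul_left)
  qed (simp add: twist_mul_add_left scalars.scale_right_distrib)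
  show "gmul (twist A \<sigma>) a (smul A r b) = smul A r (gmul (twist A \<sigma>) a b)" for r a b
    by (induction a rule: algebra_induct)
      (simp_all add: twist_mul_add_left twist_mul_homogeneous mul_smul_right
        scalars.scale_right_distrib zpow_simps flip: zpow_of_nat)
  show "gmul (twist A \<sigma>) a b \<in> apart A (i + j)" if "a \<in> apart A i" "b \<in> apart A j" for i j a b
    using that by (simp add: twist_mul_homogeneous mul_part zpow_part flip: zpow_of_nat)
qed

lemma automorphism_inv_twist: "graded_automorphism (twist A \<sigma>) (inv \<sigma>)"
proof -
  note inv = automorphism_inv[OF automorphism]
  have "inv \<sigma> (gmul (twist A \<sigma>) a b) = gmul (twist A \<sigma>) (inv \<sigma> a) (inv \<sigma> b)" for a b
  proof (induction a rule: algebra_induct)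
    case (add a a')
    then show ?case by (simp add: twist_mul_add_left automorphism_add[OF inv])
  next
    case (homogeneous i a)
    have "zpow \<sigma> (- 1) (zpow \<sigma> (int i) b) = zpow \<sigma> (int i) (zpow \<sigma> (- 1) b)"
      by (simp only: add.commute flip: zpow_add[OF bij])
    then show ?case
      using homogeneous automorphism_part[OF inv homogeneous]
      by (simp add: twist_mul_homogeneous automorphism_mul[OF inv] zpow_minus_one)
  qed
  then show ?thesis
    using inv unfolding graded_automorphism_iff by simp
qed

text \<open>Twisting back replaces \<open>b\<close> by \<open>\<sigma>\<^bsup>-|a|\<^esup>(b)\<close> in \<open>a \<sigma>\<^bsup>|a|\<^esup>(b)\<close>.\<close>

lemma twist_twist: "twist (twist A \<sigma>) (inv \<sigma>) = A"
proof -
  interpret T: twisted_algebra "twist A \<sigma>" "inv \<sigma>"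
    by unfold_locales (rule connected_twist, rule automorphism_inv_twist)
  have "gmul (twist (twist A \<sigma>) (inv \<sigma>)) a b = gmul A a b" for a b
  proof (induction a rule: algebra_induct)
    case (add a a')
    then show ?case by (simp add: T.twist_mul_add_left mul_add_left)
  next
    case (homogeneous i a)
    have "(\<sigma> ^^ i) ((inv \<sigma> ^^ i) b) = b"
      using zpow_cancel(1)[OF bij, of "int i" b] by (cases "i = 0") (simp_all add: zpow_def)
    then show ?case
      using homogeneous T.twist_mul_homogeneous[of a i b] by (simp add: twist_mul_homogeneous)
  qed
  then have "gmul (twist (twist A \<sigma>) (inv \<sigma>)) = gmul A" by blast
  then show ?thesis by (intro galgebra.equality) simp_all
qed

end

section \<open>Graded modules and their homomorphisms\<close>

locale module_over = connected_algebra A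
  for A :: "('k::field, 'a::ab_group_add) galgebra" +
  fixes M :: "('a, 'm::ab_group_add) gmodule"
  assumes graded: "graded_module A M"
begin

lemma act_part: "a \<in> apart A i \<Longrightarrow> x \<in> mpart M d \<Longrightarrow> act M a x \<in> mpart M (int i + d)"
  and act_one: "x \<in> mcarrier M \<Longrightarrow> act M (gone A) x = x"
  and act_mul: "x \<in> mcarrier M \<Longrightarrow> act M (gmul A a b) x = act M a (act M b x)"
  and act_add_left: "x \<in> mcarrier M \<Longrightarrow> act M (a + b) x = act M a x + act M b x"
  and act_add_right: "x \<in> mcarrier M \<Longrightarrow> y \<in> mcarrier M \<Longrightarrow> act M a (x + y) = act M a x + act M a y"
  using graded unfolding graded_module_def by (simp_all, blast?)

lemma act_zero_left: "x \<in> mcarrier M \<Longrightarrow> act M 0 x = 0"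
  using act_add_left[of x 0 0] by simp

sublocale mod: graded_group "mpart M"
proof
  show zero: "0 \<in> mpart M d" for d
    using graded unfolding graded_module_def by blast
  show "x + y \<in> mpart M d" if "x \<in> mpart M d" "y \<in> mpart M d" for x y d
    using graded that unfolding graded_module_def by blast
  show "independent_parts (mpart M)"
    using graded unfolding graded_module_def by blast
  show "- x \<in> mpart M d" if x: "x \<in> mpart M d" for x d
  proof -
    have "decomp (mpart M) x (\<lambda>j. if j = d then x else 0)"
      unfolding decomp_def using x zero by (cases "x = 0") auto
    then have carrier: "x \<in> mcarrier M" unfolding dsum_def by blast
    \<comment> \<open>Closure under negation comes from the action of \<open>-1\<close>, which has degree 0.\<close>
    have "act M (gone A) x + act M (- gone A) x = 0"
      using act_add_left[OF carrier, of "gone A" "- gone A"] act_zero_left[OF carrier] by simp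
    then have "- x = act M (- gone A) x"
      by (simp add: act_one[OF carrier] add_eq_0_iff)
    also have "\<dots> \<in> mpart M (int 0 + d)"
      by (rule act_part[OF parts.part_minus[OF one_part] x])
    finally show ?thesis by simp
  qed
qed

lemma act_carrier: "x \<in> mcarrier M \<Longrightarrow> act M a x \<in> mcarrier M"
proof (induction x rule: mod.dsum_induct)
  case (homogeneous d x)
  show ?case
  proof (induction a rule: algebra_induct)
    case (homogeneous i a)
    then show ?case using \<open>x \<in> mpart M d\<close> act_part mod.part_dsum by blast
  next
    case (add a b)
    then show ?case
      using \<open>x \<in> mpart M d\<close> by (simp add: act_add_left mod.part_dsum mod.dsum_add)
  qed
qed (simp add: act_add_right mod.dsum_add)

lemma act_zero_right: "act M a 0 = 0"
  using act_add_right[of 0 0 a] mod.dsum_zero by simp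

lemma act_minus_right: "x \<in> mcarrier M \<Longrightarrow> act M a (- x) = - act M a x"
  using act_add_right[of x "- x" a] act_zero_right mod.dsum_minus[of x]
  by (simp add: eq_neg_iff_add_eq_0 add.commute)

lemma act_sum_right:
  "(\<And>s. s \<in> S \<Longrightarrow> f s \<in> mcarrier M) \<Longrightarrow> act M a (sum f S) = (\<Sum>s\<in>S. act M a (f s))"
  by (induction S rule: infinite_finite_induct)
    (auto simp: act_zero_right act_add_right mod.dsum_sum)

lemma hcomp_act:
  assumes "b \<in> mpart M q"
  shows "hcomp (mpart M) (act M a b) d =
    (if q \<le> d then act M (hcomp (apart A) a (nat (d - q))) b else 0)"
proof (induction a rule: algebra_induct)
  case (homogeneous i a)
  have "act M a b \<in> mpart M (int i + q)" by (rule act_part[OF homogeneous assms])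
  from mod.hcomp_homogeneous[OF this] parts.hcomp_homogeneous[OF homogeneous]
  show ?case using act_zero_left[OF mod.part_dsum[OF assms]] by auto
next
  case (add a a')
  have b: "b \<in> mcarrier M" using assms by (rule mod.part_dsum)
  show ?case
    using add by (simp add: act_add_left[OF b] mod.hcomp_add act_carrier[OF b] parts.hcomp_add)
qed

end

context connected_algebra
begin

lemma module_overI: "graded_module A M \<Longrightarrow> module_over A M"
  by unfold_locales

lemma mcarrier_trivial [simp]: "mcarrier (trivial_module A) = UNIV"
proof -
  have "decomp (mpart (trivial_module A)) x (\<lambda>d. if d = 0 then x else 0)" for x
    by (cases "x = 0") (auto simp: decomp_def trivial_module_def)
  then show ?thesis unfolding dsum_def by blast
qed

lemma act_trivial [simp]: "act (trivial_module A) a c = augmentation A a * c"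
  by (simp add: trivial_module_def)

lemma graded_module_trivial: "graded_module A (trivial_module A)"
proof -
  have unique: "c = (\<lambda>d. if d = 0 then x else 0)" if "decomp (mpart (trivial_module A)) x c" for x c
  proof -
    have "c d \<in> mpart (trivial_module A) d" for d using that unfolding decomp_def by blast
    then have "c d \<in> (if d = 0 then UNIV else {0})" for d by (simp add: trivial_module_def)
    then have nz: "c d = 0" if "d \<noteq> 0" for d
      using that by (metis (full_types) singletonD)
    have "x = (\<Sum>d | c d \<noteq> 0. c d)" using that unfolding decomp_def by blast
    also have "\<dots> = (\<Sum>d\<in>{0}. c d)"
      by (rule sum.mono_neutral_left) (use nz in auto)
    finally show ?thesis using nz by auto
  qed
  have "independent_parts (mpart (trivial_module A))"
    unfolding independent_parts_def
  proof
    fix x assume "x \<in> mcarrier (trivial_module A)"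
    then obtain c where c: "decomp (mpart (trivial_module A)) x c" unfolding dsum_def by blast
    show "\<exists>!c. decomp (mpart (trivial_module A)) x c"
      by (rule ex1I[where a = c], rule c, rule trans[OF unique unique[OF c, symmetric]])
  qed
  then show ?thesis
    unfolding graded_module_def
    by (auto simp: augmentation_mul augmentation_add algebra_simps)
      (auto simp: trivial_module_def augmentation_positive split: if_splits)
qed

end

lemma
  assumes "f \<in> deg_hom M N e"
  shows deg_hom_add: "x \<in> mcarrier M \<Longrightarrow> y \<in> mcarrier M \<Longrightarrow> f (x + y) = f x + f y"
    and deg_hom_act: "x \<in> mcarrier M \<Longrightarrow> f (act M a x) = act N a (f x)"
    and deg_hom_part: "x \<in> mpart M d \<Longrightarrow> f x \<in> mpart N (d + e)"
  using assms unfolding deg_hom_def by blast+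

locale module_pair = M: module_over A M + N: module_over A N
  for A :: "('k::field, 'a::ab_group_add) galgebra"
    and M :: "('a, 'm::ab_group_add) gmodule" and N :: "('a, 'n::ab_group_add) gmodule"
begin

lemma deg_homI:
  assumes add: "\<And>x y. x \<in> mcarrier M \<Longrightarrow> y \<in> mcarrier M \<Longrightarrow> f (x + y) = f x + f y"
    and part: "\<And>d x. x \<in> mpart M d \<Longrightarrow> f x \<in> mpart N (d + e)"
    and act: "\<And>i a d x. a \<in> apart A i \<Longrightarrow> x \<in> mpart M d \<Longrightarrow> f (act M a x) = act N a (f x)"
  shows "f \<in> deg_hom M N e"
proof -
  have carrier: "f x \<in> mcarrier N" if "x \<in> mcarrier M" for x
    using that
    by (induction rule: M.mod.dsum_induct) (auto simp: add N.mod.dsum_add intro: N.mod.part_dsum part)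
  have "f (act M a x) = act N a (f x)" if "x \<in> mcarrier M" for a x
    using that
  proof (induction x rule: M.mod.dsum_induct)
    case (homogeneous d x)
    note x = M.mod.part_dsum[OF homogeneous]
    show ?case
    proof (induction a rule: M.algebra_induct)
      case (homogeneous i a)
      then show ?case using act \<open>x \<in> mpart M d\<close> by blast
    next
      case (add a b)
      then show ?case
        by (simp add: M.act_add_left N.act_add_left assms(1) x carrier M.act_carrier)
    qed
  next
    case (add x y)
    then show ?case
      by (simp add: M.act_add_right N.act_add_right assms(1) carrier M.act_carrier)
  qed
  then show ?thesis unfolding deg_hom_def using add part by blast
qed

lemma deg_hom_carrier: "f \<in> deg_hom M N e \<Longrightarrow> x \<in> mcarrier M \<Longrightarrow> f x \<in> mcarrier N"
proof (rotate_tac, induction x rule: M.mod.dsum_induct)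
  case (homogeneous d x)
  then show ?case using deg_hom_part N.mod.part_dsum by blast
next
  case (add x y)
  then show ?case by (simp add: deg_hom_add N.mod.dsum_add)
qed

lemma deg_hom_zero: "f \<in> deg_hom M N e \<Longrightarrow> f 0 = 0"
  using deg_hom_add[of f M N e 0 0] M.mod.dsum_zero by simp

lemma hcomp_deg_hom:
  assumes f: "f \<in> deg_hom M N e" and x: "x \<in> mcarrier M"
  shows "hcomp (mpart N) (f x) (d + e) = f (hcomp (mpart M) x d)"
  using x
proof (induction x rule: M.mod.dsum_induct)
  case (homogeneous q x)
  show ?case
    using N.mod.hcomp_homogeneous[OF deg_hom_part[OF f homogeneous]]
      M.mod.hcomp_homogeneous[OF homogeneous] deg_hom_zero[OF f] by simp
next
  case (add x y)
  then show ?case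
    by (simp add: deg_hom_add[OF f] N.mod.hcomp_add M.mod.hcomp_add deg_hom_carrier[OF f]
        M.mod.part_dsum[OF M.mod.hcomp_in])
qed

lemma zero_deg_hom: "(\<lambda>x. 0) \<in> deg_hom M N e"
  by (simp add: deg_hom_def N.act_zero_right N.mod.part_zero image_subset_iff)

lemma add_deg_hom:
  "f \<in> deg_hom M N e \<Longrightarrow> g \<in> deg_hom M N e \<Longrightarrow> (\<lambda>x. f x + g x) \<in> deg_hom M N e"
  by (rule deg_homI)
    (auto simp: deg_hom_add deg_hom_act deg_hom_part N.mod.part_add N.act_add_right
      deg_hom_carrier M.mod.part_dsum)

lemma minus_deg_hom: "f \<in> deg_hom M N e \<Longrightarrow> (\<lambda>x. - f x) \<in> deg_hom M N e"
  by (rule deg_homI)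
    (auto simp: deg_hom_add deg_hom_act deg_hom_part N.mod.part_minus N.act_minus_right
      deg_hom_carrier M.mod.part_dsum)

text \<open>Homomorphisms of different degrees have values in different parts, so they cannot cancel.\<close>

lemma deg_hom_sum_zero:
  assumes E: "finite E" "\<And>e. e \<in> E \<Longrightarrow> F e \<in> deg_hom M N e"
    and zero: "\<And>x. x \<in> mcarrier M \<Longrightarrow> (\<Sum>e\<in>E. F e x) = 0"
    and e: "e \<in> E" and x: "x \<in> mcarrier M"
  shows "F e x = 0"
  using x
proof (induction x rule: M.mod.dsum_induct)
  case (homogeneous d x)
  show ?case
    by (rule N.mod.homogeneous_sum_zero[OF E(1), where p = "\<lambda>e. d + e"])
      (use e zero M.mod.part_dsum[OF homogeneous] deg_hom_part[OF E(2) homogeneous] in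
        \<open>auto simp: inj_on_def\<close>)
next
  case (add x y)
  then show ?case by (simp add: deg_hom_add[OF E(2)[OF e]])
qed

lemma deg_hom_ghom: "f \<in> deg_hom M N e \<Longrightarrow> f \<in> ghom M N"
  unfolding ghom_def by (intro CollectI exI[of _ "{e}"] exI[of _ "\<lambda>_. f"]) simp

lemma ghom_cong: "f \<in> ghom M N \<Longrightarrow> (\<And>x. x \<in> mcarrier M \<Longrightarrow> g x = f x) \<Longrightarrow> g \<in> ghom M N"
  unfolding ghom_def by simp

lemma zero_ghom: "(\<lambda>x. 0) \<in> ghom M N"
  using deg_hom_ghom[OF zero_deg_hom] .

lemma add_ghom:
  assumes "f \<in> ghom M N" "g \<in> ghom M N" shows "(\<lambda>x. f x + g x) \<in> ghom M N"
proof -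
  obtain E F where f: "finite E" "\<forall>e\<in>E. F e \<in> deg_hom M N e"
    "\<forall>x\<in>mcarrier M. f x = (\<Sum>e\<in>E. F e x)"
    using assms(1) unfolding ghom_def by blast
  obtain E' F' where g: "finite E'" "\<forall>e\<in>E'. F' e \<in> deg_hom M N e"
    "\<forall>x\<in>mcarrier M. g x = (\<Sum>e\<in>E'. F' e x)"
    using assms(2) unfolding ghom_def by blast
  define H where "H e = (\<lambda>x. (if e \<in> E then F e x else 0) + (if e \<in> E' then F' e x else 0))" for e
  have "H e \<in> deg_hom M N e" for e
    unfolding H_def using f(2) g(2)
    by (intro add_deg_hom) (cases "e \<in> E"; cases "e \<in> E'"; simp add: zero_deg_hom)+
  moreover have "f x + g x = (\<Sum>e\<in>E \<union> E'. H e x)" if "x \<in> mcarrier M" for x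
  proof -
    have "(\<Sum>e\<in>E \<union> E'. if e \<in> E then F e x else 0) = (\<Sum>e\<in>E. F e x)"
      "(\<Sum>e\<in>E \<union> E'. if e \<in> E' then F' e x else 0) = (\<Sum>e\<in>E'. F' e x)"
      using f(1) g(1) by (simp_all add: sum.If_cases Int_absorb1 Int_absorb2)
    then show ?thesis using f(3) g(3) that by (simp add: H_def sum.distrib)
  qed
  ultimately show ?thesis
    unfolding ghom_def using f(1) g(1)
    by (intro CollectI exI[of _ "E \<union> E'"] exI[of _ H]) simp
qed

lemma sum_ghom:
  "(\<And>s. s \<in> S \<Longrightarrow> f s \<in> ghom M N) \<Longrightarrow> (\<lambda>x. \<Sum>s\<in>S. f s x) \<in> ghom M N"
  by (induction S rule: infinite_finite_induct) (auto simp: zero_ghom add_ghom)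

lemma minus_ghom:
  assumes "f \<in> ghom M N" shows "(\<lambda>x. - f x) \<in> ghom M N"
proof -
  obtain E F where f: "finite E" "\<forall>e\<in>E. F e \<in> deg_hom M N e"
    "\<forall>x\<in>mcarrier M. f x = (\<Sum>e\<in>E. F e x)"
    using assms unfolding ghom_def by blast
  have "(\<lambda>x. \<Sum>e\<in>E. - F e x) \<in> ghom M N"
    using f by (intro sum_ghom deg_hom_ghom[OF minus_deg_hom]) blast
  then show ?thesis by (rule ghom_cong) (simp add: f(3) sum_negf)
qed

lemma diff_ghom: "f \<in> ghom M N \<Longrightarrow> g \<in> ghom M N \<Longrightarrow> (\<lambda>x. f x - g x) \<in> ghom M N"
  using add_ghom[OF _ minus_ghom, of f g] by simp

lemma
  assumes "f \<in> ghom M N"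
  shows ghom_add: "x \<in> mcarrier M \<Longrightarrow> y \<in> mcarrier M \<Longrightarrow> f (x + y) = f x + f y"
    and ghom_act: "x \<in> mcarrier M \<Longrightarrow> f (act M a x) = act N a (f x)"
    and ghom_carrier: "x \<in> mcarrier M \<Longrightarrow> f x \<in> mcarrier N"
    and ghom_zero: "f 0 = 0"
    and ghom_minus: "x \<in> mcarrier M \<Longrightarrow> f (- x) = - f x"
proof -
  obtain E F where f: "finite E" "\<And>e. e \<in> E \<Longrightarrow> F e \<in> deg_hom M N e"
    "\<And>x. x \<in> mcarrier M \<Longrightarrow> f x = (\<Sum>e\<in>E. F e x)"
    using assms unfolding ghom_def by blast
  show add: "f (x + y) = f x + f y" if "x \<in> mcarrier M" "y \<in> mcarrier M" for x y
    using that by (simp add: f(3) M.mod.dsum_add deg_hom_add[OF f(2)] sum.distrib)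
  show "f (act M a x) = act N a (f x)" if "x \<in> mcarrier M" for a x
    using that
    by (simp add: f(3) M.act_carrier deg_hom_act[OF f(2)] N.act_sum_right deg_hom_carrier[OF f(2)])
  show "f x \<in> mcarrier N" if "x \<in> mcarrier M" for x
    using that by (simp add: f(3) N.mod.dsum_sum deg_hom_carrier[OF f(2)])
  show zero: "f 0 = 0" using add[of 0 0] M.mod.dsum_zero by simp
  show "f (- x) = - f x" if "x \<in> mcarrier M" for x
    using add[OF that M.mod.dsum_minus[OF that]] zero by (simp add: eq_neg_iff_add_eq_0 add.commute)
qed

lemma ghom_diff:
  "f \<in> ghom M N \<Longrightarrow> x \<in> mcarrier M \<Longrightarrow> y \<in> mcarrier M \<Longrightarrow> f (x - y) = f x - f y"
  using ghom_add[of f x "- y"] ghom_minus[of f y] M.mod.dsum_minus[of y] by simp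

lemma ghom_sum:
  "f \<in> ghom M N \<Longrightarrow> (\<And>s. s \<in> S \<Longrightarrow> g s \<in> mcarrier M) \<Longrightarrow> f (\<Sum>s\<in>S. g s) = (\<Sum>s\<in>S. f (g s))"
  by (induction S rule: infinite_finite_induct) (auto simp: ghom_zero ghom_add M.mod.dsum_sum)

text \<open>Free modules are projective. The lift is prescribed on the basis.\<close>

lemma free_deg_hom_lift:
  assumes free: "graded_free M" and L: "graded_module A L"
    and f: "f \<in> deg_hom M L e" and g: "g \<in> deg_hom N L 0"
    and onto: "\<And>d. f ` mpart M d \<subseteq> g ` mpart N (d + e)"
  shows "\<exists>h\<in>deg_hom M N e. \<forall>x\<in>mcarrier M. g (h x) = f x"
proof -
  interpret L: module_over A L by (rule M.module_overI[OF L])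
  interpret ml: module_pair A M L ..
  interpret nl: module_pair A N L ..
  define coords where
    "coords B x c \<longleftrightarrow> finite {b. c b \<noteq> 0} \<and> {b. c b \<noteq> 0} \<subseteq> B \<and> x = (\<Sum>b | c b \<noteq> 0. act M (c b) b)"
    for B x and c :: "'m \<Rightarrow> 'a"
  obtain B where B: "B \<subseteq> (\<Union>d. mpart M d)" and ex1: "\<forall>x\<in>mcarrier M. \<exists>!c. coords B x c"
    using free unfolding graded_free_def by (elim exE conjE) (rule that; unfold coords_def; assumption)
  have "\<forall>b\<in>B. \<exists>q y. b \<in> mpart M q \<and> y \<in> mpart N (q + e) \<and> g y = f b"
  proof
    fix b assume "b \<in> B"
    then obtain q where q: "b \<in> mpart M q" using B by blast
    with onto[of q] show "\<exists>q y. b \<in> mpart M q \<and> y \<in> mpart N (q + e) \<and> g y = f b"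
      by (metis (no_types, lifting) image_eqI image_iff subsetD)
  qed
  then obtain q v where qv: "\<And>b. b \<in> B \<Longrightarrow> b \<in> mpart M (q b)"
    "\<And>b. b \<in> B \<Longrightarrow> v b \<in> mpart N (q b + e)" "\<And>b. b \<in> B \<Longrightarrow> g (v b) = f b"
    by metis
  have bc: "b \<in> mcarrier M" "v b \<in> mcarrier N" if "b \<in> B" for b
    using M.mod.part_dsum[OF qv(1)[OF that]] N.mod.part_dsum[OF qv(2)[OF that]] by auto
  define cf where "cf x = (THE c. coords B x c)" for x
  have cf: "coords B x (cf x)" if "x \<in> mcarrier M" for x
    unfolding cf_def by (rule theI'[of "coords B x"], rule bspec[OF ex1 that])
  have cf_unique: "cf x = c" if "coords B x c" "x \<in> mcarrier M" for x c
    unfolding cf_def by (rule the1_equality[of "coords B x"], rule bspec[OF ex1 that(2)], rule that(1))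
  have sup: "(\<Sum>b | c b \<noteq> 0. act M (c b) b) = (\<Sum>b\<in>F. act M (c b) b)"
    "(\<Sum>b | c b \<noteq> 0. act N (c b) (v b)) = (\<Sum>b\<in>F. act N (c b) (v b))"
    if F: "finite F" "{b. c b \<noteq> 0} \<subseteq> F" "F \<subseteq> B" for c F
  proof -
    have "act M (c b) b = 0 \<and> act N (c b) (v b) = 0" if "b \<in> F - {b. c b \<noteq> 0}" for b
      using that F(3) M.act_zero_left[OF bc(1), of b] N.act_zero_left[OF bc(2), of b] by auto
    then show "(\<Sum>b | c b \<noteq> 0. act M (c b) b) = (\<Sum>b\<in>F. act M (c b) b)"
      "(\<Sum>b | c b \<noteq> 0. act N (c b) (v b)) = (\<Sum>b\<in>F. act N (c b) (v b))"
      by (intro sum.mono_neutral_left[OF F(1,2)] ballI; blast)+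
  qed
  have coordsI: "coords B x c"
    if F: "finite F" "F \<subseteq> B" "{b. c b \<noteq> 0} \<subseteq> F" and x: "x = (\<Sum>b\<in>F. act M (c b) b)" for x c F
    unfolding coords_def
  proof (intro conjI)
    show "finite {b. c b \<noteq> 0}" "{b. c b \<noteq> 0} \<subseteq> B" using F finite_subset by blast+
    show "x = (\<Sum>b | c b \<noteq> 0. act M (c b) b)" using sup(1)[OF F(1,3,2)] x by (rule trans[OF _ sym, rotated])
  qed
  define h where "h x = (\<Sum>b | cf x b \<noteq> 0. act N (cf x b) (v b))" for x
  have h_eq: "h x = (\<Sum>b\<in>F. act N (cf x b) (v b))"
    if "finite F" "F \<subseteq> B" "{b. cf x b \<noteq> 0} \<subseteq> F" for x F
    unfolding h_def using sup(2)[OF that(1,3,2)] .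
  have x_eq: "(\<Sum>b\<in>F. act M (cf x b) b) = x"
    if "finite F" "F \<subseteq> B" "{b. cf x b \<noteq> 0} \<subseteq> F" "x \<in> mcarrier M" for x F
    using cf[OF that(4)] sup(1)[OF that(1,3,2)] unfolding coords_def by simp
  have "h \<in> deg_hom M N e"
  proof (rule deg_homI)
    fix x y assume x: "x \<in> mcarrier M" and y: "y \<in> mcarrier M"
    define F where "F = {b. cf x b \<noteq> 0} \<union> {b. cf y b \<noteq> 0}"
    have F: "finite F" "F \<subseteq> B" "{b. cf x b \<noteq> 0} \<subseteq> F" "{b. cf y b \<noteq> 0} \<subseteq> F"
      using cf[OF x] cf[OF y] unfolding coords_def F_def by blast+
    have cF: "{b. cf x b + cf y b \<noteq> 0} \<subseteq> F" unfolding F_def by auto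
    have carr: "b \<in> mcarrier M" "v b \<in> mcarrier N" if "b \<in> F" for b using that F(2) bc by blast+
    have "x + y = (\<Sum>b\<in>F. act M (cf x b + cf y b) b)"
      using x_eq[OF F(1,2,3) x] x_eq[OF F(1,2,4) y]
      by (simp add: M.act_add_left carr sum.distrib)
    then have "cf (x + y) = (\<lambda>b. cf x b + cf y b)"
      by (intro cf_unique coordsI[OF F(1,2)] cF M.mod.dsum_add x y)
    then show "h (x + y) = h x + h y"
      using h_eq[OF F(1,2), of "x + y"] cF h_eq[OF F(1,2,3)] h_eq[OF F(1,2,4)]
      by (simp add: N.act_add_left carr sum.distrib)
  next
    fix i a d x assume x: "x \<in> mpart M d"
    note xc = M.mod.part_dsum[OF x]
    define F where "F = {b. cf x b \<noteq> 0}"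
    have F: "finite F" "F \<subseteq> B" "{b. cf x b \<noteq> 0} \<subseteq> F"
      using cf[OF xc] unfolding coords_def F_def by blast+
    have cF: "{b. gmul A a (cf x b) \<noteq> 0} \<subseteq> F" unfolding F_def by auto
    have carr: "b \<in> mcarrier M" "v b \<in> mcarrier N" if "b \<in> F" for b using that F(2) bc by blast+
    have "act M a x = (\<Sum>b\<in>F. act M (gmul A a (cf x b)) b)"
      by (subst x_eq[OF F xc, symmetric])
        (simp add: M.act_mul carr M.act_sum_right M.act_carrier)
    then have "cf (act M a x) = (\<lambda>b. gmul A a (cf x b))"
      by (intro cf_unique coordsI[OF F(1,2)] cF M.act_carrier xc)
    then show "h (act M a x) = act N a (h x)"
      using h_eq[OF F(1,2), of "act M a x"] cF h_eq[OF F]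
      by (simp add: N.act_mul carr N.act_sum_right N.act_carrier)
  next
    fix d x assume x: "x \<in> mpart M d"
    note xc = M.mod.part_dsum[OF x]
    define F where "F = {b. cf x b \<noteq> 0}"
    have F: "finite F" "F \<subseteq> B" "{b. cf x b \<noteq> 0} \<subseteq> F"
      using cf[OF xc] unfolding coords_def F_def by blast+
    \<comment> \<open>Only the part of degree \<open>d - q b\<close> of the coefficient at \<open>b\<close> contributes to \<open>x\<close>.\<close>
    define c where "c b = (if q b \<le> d then hcomp (apart A) (cf x b) (nat (d - q b)) else 0)" for b
    have cF: "{b. c b \<noteq> 0} \<subseteq> F" unfolding F_def c_def by (auto simp: M.parts.hcomp_zero)
    have carr: "b \<in> mcarrier M" "b \<in> mpart M (q b)" "v b \<in> mpart N (q b + e)" if "b \<in> F" for b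
      using that F(2) bc qv by blast+
    have "x = hcomp (mpart M) (\<Sum>b\<in>F. act M (cf x b) b) d"
      using x_eq[OF F xc] M.mod.hcomp_homogeneous[OF x] by simp
    also have "\<dots> = (\<Sum>b\<in>F. hcomp (mpart M) (act M (cf x b) b) d)"
      by (rule M.mod.hcomp_sum) (simp add: M.act_carrier carr)
    also have "\<dots> = (\<Sum>b\<in>F. act M (c b) b)"
      by (rule sum.cong) (auto simp: M.hcomp_act[OF carr(2)] c_def M.act_zero_left carr)
    finally have "cf x = c"
      by (intro cf_unique coordsI[OF F(1,2)] cF xc)
    moreover have "act N (c b) (v b) \<in> mpart N (d + e)" if "b \<in> F" for b
    proof (cases "q b \<le> d")
      case True
      have "act N (hcomp (apart A) (cf x b) (nat (d - q b))) (v b)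
          \<in> mpart N (int (nat (d - q b)) + (q b + e))"
        by (rule N.act_part[OF M.parts.hcomp_in[OF M.in_dsum] carr(3)[OF that]])
      then show ?thesis using True by (simp add: c_def algebra_simps)
    next
      case False
      then show ?thesis
        using N.mod.part_dsum[OF carr(3)[OF that]]
        by (simp add: c_def N.act_zero_left N.mod.part_zero)
    qed
    ultimately show "h x \<in> mpart N (d + e)"
      using h_eq[OF F] N.mod.part_sum[of F] by simp
  qed
  moreover have "g (h x) = f x" if x: "x \<in> mcarrier M" for x
  proof -
    define F where "F = {b. cf x b \<noteq> 0}"
    have F: "finite F" "F \<subseteq> B" "{b. cf x b \<noteq> 0} \<subseteq> F"
      using cf[OF x] unfolding coords_def F_def by blast+
    have carr: "b \<in> mcarrier M" "v b \<in> mcarrier N" "g (v b) = f b" if "b \<in> F" for b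
      using that F(2) bc qv by blast+
    have "g (h x) = (\<Sum>b\<in>F. g (act N (cf x b) (v b)))"
      unfolding h_eq[OF F] by (rule nl.ghom_sum[OF nl.deg_hom_ghom[OF g]]) (simp add: carr N.act_carrier)
    also have "\<dots> = (\<Sum>b\<in>F. f (act M (cf x b) b))"
      by (rule sum.cong) (simp_all add: deg_hom_act[OF g] deg_hom_act[OF f] carr)
    also have "\<dots> = f (\<Sum>b\<in>F. act M (cf x b) b)"
      by (rule ml.ghom_sum[OF ml.deg_hom_ghom[OF f], symmetric]) (simp add: carr M.act_carrier)
    finally show ?thesis using x_eq[OF F x] by simp
  qed
  ultimately show ?thesis by blast
qed

end

context connected_algebra
begin

lemma module_pairI: "graded_module A M \<Longrightarrow> graded_module A N \<Longrightarrow> module_pair A M N"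
  by (simp add: module_pair_def module_overI)

lemma comp_deg_hom:
  assumes M: "graded_module A M" and N: "graded_module A N"
    and f: "f \<in> deg_hom M N e" and g: "g \<in> deg_hom N L e'"
  shows "(\<lambda>x. g (f x)) \<in> deg_hom M L (e + e')"
proof -
  interpret module_pair A M N using M N by (rule module_pairI)
  have "g (f x) \<in> mpart L (d + (e + e'))" if "x \<in> mpart M d" for d x
    using deg_hom_part[OF g deg_hom_part[OF f that]] by (simp add: add.assoc)
  then show ?thesis
    using f g deg_hom_carrier[OF f] unfolding deg_hom_def by (auto simp: image_subset_iff)
qed

lemma comp_ghom:
  assumes M: "graded_module A M" and N: "graded_module A N" and L: "graded_module A L"
    and f: "f \<in> ghom M N" and g: "g \<in> ghom N L"
  shows "(\<lambda>x. g (f x)) \<in> ghom M L"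
proof -
  interpret mn: module_pair A M N using M N by (rule module_pairI)
  interpret ml: module_pair A M L using M L by (rule module_pairI)
  interpret nl: module_pair A N L using N L by (rule module_pairI)
  obtain E F where f': "finite E" "\<And>e. e \<in> E \<Longrightarrow> F e \<in> deg_hom M N e"
    "\<And>x. x \<in> mcarrier M \<Longrightarrow> f x = (\<Sum>e\<in>E. F e x)"
    using f unfolding ghom_def by blast
  obtain E' F' where g': "finite E'" "\<And>e. e \<in> E' \<Longrightarrow> F' e \<in> deg_hom N L e"
    "\<And>x. x \<in> mcarrier N \<Longrightarrow> g x = (\<Sum>e\<in>E'. F' e x)"
    using g unfolding ghom_def by blast
  have "(\<lambda>x. \<Sum>e\<in>E. \<Sum>e'\<in>E'. F' e' (F e x)) \<in> ghom M L"
    using f'(2) g'(2)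
    by (intro ml.sum_ghom) (rule ml.deg_hom_ghom[OF comp_deg_hom[OF M N]], blast+)
  then show ?thesis
  proof (rule ml.ghom_cong)
    fix x assume x: "x \<in> mcarrier M"
    then have "g (f x) = (\<Sum>e\<in>E. g (F e x))"
      by (simp add: f'(3) nl.ghom_sum[OF g] mn.deg_hom_carrier[OF f'(2)])
    also have "\<dots> = (\<Sum>e\<in>E. \<Sum>e'\<in>E'. F' e' (F e x))"
      by (intro sum.cong refl g'(3) mn.deg_hom_carrier[OF f'(2)] x)
    finally show "g (f x) = (\<Sum>e\<in>E. \<Sum>e'\<in>E'. F' e' (F e x))" .
  qed
qed

text \<open>
  If \<open>g\<close> has degree 0, a preimage of a homogeneous element can be replaced by its component of
  that degree, so the values of \<open>f\<close> on a basis have preimages of the degrees required above.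
\<close>

lemma deg_hom_lift:
  assumes M: "graded_module A M" "graded_free M" and N: "graded_module A N" and L: "graded_module A L"
    and f: "f \<in> deg_hom M L e" and g: "g \<in> deg_hom N L 0"
    and onto: "\<And>x. x \<in> mcarrier M \<Longrightarrow> f x \<in> g ` mcarrier N"
  shows "\<exists>h\<in>deg_hom M N e. \<forall>x\<in>mcarrier M. g (h x) = f x"
proof -
  interpret mn: module_pair A M N using M(1) N by (rule module_pairI)
  interpret nl: module_pair A N L using N L by (rule module_pairI)
  have "f x \<in> g ` mpart N (d + e)" if x: "x \<in> mpart M d" for d x
  proof -
    obtain z where z: "z \<in> mcarrier N" "f x = g z"
      using onto[OF mn.M.mod.part_dsum[OF x]] by blast
    have "f x = hcomp (mpart L) (g z) (d + e)"
      using nl.N.mod.hcomp_homogeneous[OF deg_hom_part[OF f x]] z(2) by simp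
    also have "\<dots> = g (hcomp (mpart N) z (d + e))"
      using nl.hcomp_deg_hom[OF g z(1), of "d + e"] by simp
    finally show ?thesis using mn.N.mod.hcomp_in[OF z(1)] by blast
  qed
  then show ?thesis by (intro mn.free_deg_hom_lift[OF M(2) L f g]) blast
qed

text \<open>
  The same comparison of degrees shows that each homogeneous component of \<open>f\<close> maps the parts of \<open>M\<close>
  into the image of \<open>g\<close>; so the components can be lifted one by one.
\<close>

lemma ghom_lift:
  assumes M: "graded_module A M" "graded_free M" and N: "graded_module A N" and L: "graded_module A L"
    and f: "f \<in> ghom M L" and g: "g \<in> deg_hom N L 0"
    and onto: "\<And>x. x \<in> mcarrier M \<Longrightarrow> f x \<in> g ` mcarrier N"
  shows "\<exists>h\<in>ghom M N. \<forall>x\<in>mcarrier M. g (h x) = f x"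
proof -
  interpret mn: module_pair A M N using M(1) N by (rule module_pairI)
  interpret ml: module_pair A M L using M(1) L by (rule module_pairI)
  interpret nl: module_pair A N L using N L by (rule module_pairI)
  obtain E F where f': "finite E" "\<And>e. e \<in> E \<Longrightarrow> F e \<in> deg_hom M L e"
    "\<And>x. x \<in> mcarrier M \<Longrightarrow> f x = (\<Sum>e\<in>E. F e x)"
    using f unfolding ghom_def by blast
  have "F e x \<in> g ` mpart N (d + e)" if e: "e \<in> E" and x: "x \<in> mpart M d" for e d x
  proof -
    note xc = mn.M.mod.part_dsum[OF x]
    obtain z where z: "z \<in> mcarrier N" "f x = g z" using onto[OF xc] by blast
    have "hcomp (mpart L) (f x) (d + e) = (\<Sum>e'\<in>E. hcomp (mpart L) (F e' x) (d + e))"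
      unfolding f'(3)[OF xc]
      by (rule ml.N.mod.hcomp_sum) (use f'(2) xc ml.deg_hom_carrier in blast)
    also have "\<dots> = (\<Sum>e'\<in>E. if e' = e then F e x else 0)"
      by (rule sum.cong)
        (use ml.N.mod.hcomp_homogeneous[OF deg_hom_part[OF f'(2) x]] in auto)
    also have "\<dots> = F e x" using f'(1) e by simp
    finally have "F e x = hcomp (mpart L) (g z) (d + e)" using z(2) by simp
    also have "\<dots> = g (hcomp (mpart N) z (d + e))"
      using nl.hcomp_deg_hom[OF g z(1), of "d + e"] by simp
    finally show ?thesis using mn.N.mod.hcomp_in[OF z(1)] by blast
  qed
  then have "\<exists>h\<in>deg_hom M N e. \<forall>x\<in>mcarrier M. g (h x) = F e x" if "e \<in> E" for e
    using that by (intro mn.free_deg_hom_lift[OF M(2) L f'(2) g]) blast+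
  then obtain H where H: "\<And>e. e \<in> E \<Longrightarrow> H e \<in> deg_hom M N e"
    "\<And>e x. e \<in> E \<Longrightarrow> x \<in> mcarrier M \<Longrightarrow> g (H e x) = F e x"
    by metis
  show ?thesis
  proof (intro bexI[of _ "\<lambda>x. \<Sum>e\<in>E. H e x"] ballI)
    show "(\<lambda>x. \<Sum>e\<in>E. H e x) \<in> ghom M N"
      using H(1) by (intro mn.sum_ghom mn.deg_hom_ghom) blast
    fix x assume "x \<in> mcarrier M"
    then show "g (\<Sum>e\<in>E. H e x) = f x"
      by (simp add: nl.ghom_sum[OF nl.deg_hom_ghom[OF g]] mn.deg_hom_carrier[OF H(1)] H(2) f'(3))
  qed
qed

end

section \<open>Chain maps between resolutions\<close>

locale exact_resolution = connected_algebra A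
  for A :: "('k::field, 'a::ab_group_add) galgebra" +
  fixes Q :: "('k, 'a, 'm::ab_group_add) resolution"
  assumes module: "graded_module A (rmod Q n)"
    and diff: "rdiff Q n \<in> deg_hom (rmod Q (Suc n)) (rmod Q n) 0"
    and aug: "raug Q \<in> deg_hom (rmod Q 0) (trivial_module A) 0"
    and aug_onto: "raug Q ` mcarrier (rmod Q 0) = UNIV"
    and exact_0: "{x \<in> mcarrier (rmod Q 0). raug Q x = 0} = rdiff Q 0 ` mcarrier (rmod Q (Suc 0))"
    and exact_Suc: "{x \<in> mcarrier (rmod Q (Suc n)). rdiff Q n x = 0}
           = rdiff Q (Suc n) ` mcarrier (rmod Q (Suc (Suc n)))"
begin

lemma diff_carrier: "x \<in> mcarrier (rmod Q (Suc n)) \<Longrightarrow> rdiff Q n x \<in> mcarrier (rmod Q n)"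
  by (rule module_pair.deg_hom_carrier[OF module_pairI[OF module module] diff])

lemma diff_diff: "x \<in> mcarrier (rmod Q (Suc (Suc n))) \<Longrightarrow> rdiff Q n (rdiff Q (Suc n) x) = 0"
  using exact_Suc[of n] by blast

lemma aug_diff: "x \<in> mcarrier (rmod Q (Suc 0)) \<Longrightarrow> raug Q (rdiff Q 0 x) = 0"
  using exact_0 by blast

lemma diff_ghom: "rdiff Q n \<in> ghom (rmod Q (Suc n)) (rmod Q n)"
  by (rule module_pair.deg_hom_ghom[OF module_pairI[OF module module] diff])

lemma aug_ghom: "raug Q \<in> ghom (rmod Q 0) (trivial_module A)"
  by (rule module_pair.deg_hom_ghom[OF module_pairI[OF module graded_module_trivial] aug])

end

locale free_resolution_of = connected_algebra A
  for A :: "('k::field, 'a::ab_group_add) galgebra" +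
  fixes P :: "('k, 'a, 'm::ab_group_add) resolution"
  assumes free_resolution: "free_resolution A P"
begin

lemmas resolution_facts = free_resolution[unfolded free_resolution_def]

lemma free: "graded_free (rmod P n)"
  and locally_finite: "locally_finite_module A (rmod P n)"
  using conjunct1[OF resolution_facts] by simp_all

sublocale exact_resolution A P
proof
  show "graded_module A (rmod P n)" "rdiff P n \<in> deg_hom (rmod P (Suc n)) (rmod P n) 0" for n
    using conjunct1[OF resolution_facts] by simp_all
  note rest = conjunct2[OF resolution_facts]
  show "raug P \<in> deg_hom (rmod P 0) (trivial_module A) 0" by (rule conjunct1[OF rest])
  note rest = conjunct2[OF rest]
  show "raug P ` mcarrier (rmod P 0) = UNIV" by (rule conjunct1[OF rest])
  note rest = conjunct2[OF rest]
  show "{x \<in> mcarrier (rmod P 0). raug P x = 0} = rdiff P 0 ` mcarrier (rmod P (Suc 0))"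
    by (rule conjunct1[OF rest])
  show "{x \<in> mcarrier (rmod P (Suc n)). rdiff P n x = 0}
      = rdiff P (Suc n) ` mcarrier (rmod P (Suc (Suc n)))" for n
    by (rule spec[OF conjunct2[OF rest]])
qed

text \<open>The comparison theorem: a chain map is built degree by degree, by projectivity of the source.\<close>

lemma comparison:
  assumes Q: "exact_resolution A Q"
    and \<eta>: "\<eta> \<in> deg_hom (rmod P n) (trivial_module A) e"
    and cocycle: "\<And>x. x \<in> mcarrier (rmod P (Suc n)) \<Longrightarrow> \<eta> (rdiff P n x) = 0"
  obtains \<phi> where "\<And>i. \<phi> i \<in> deg_hom (rmod P (i + n)) (rmod Q i) e"
    "\<And>x. x \<in> mcarrier (rmod P n) \<Longrightarrow> raug Q (\<phi> 0 x) = \<eta> x"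
    "\<And>i x. x \<in> mcarrier (rmod P (Suc (i + n))) \<Longrightarrow>
       rdiff Q i (\<phi> (Suc i) x) = \<phi> i (rdiff P (i + n) x)"
proof -
  interpret Q: exact_resolution A Q by (rule Q)
  \<comment> \<open>Asking that \<open>f\<close> after \<open>d\<close> lands in the image of the next differential makes the next term exist.\<close>
  define ok where "ok i f \<longleftrightarrow> f \<in> deg_hom (rmod P (i + n)) (rmod Q i) e \<and>
    (\<forall>x\<in>mcarrier (rmod P (Suc (i + n))).
       f (rdiff P (i + n) x) \<in> rdiff Q i ` mcarrier (rmod Q (Suc i))) \<and>
    (i = 0 \<longrightarrow> (\<forall>x\<in>mcarrier (rmod P n). raug Q (f x) = \<eta> x))" for i f
  have base: "\<exists>f. ok 0 f"
  proof -
    obtain h where h: "h \<in> deg_hom (rmod P n) (rmod Q 0) e"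
      "\<forall>x\<in>mcarrier (rmod P n). raug Q (h x) = \<eta> x"
      using deg_hom_lift[OF module free Q.module graded_module_trivial \<eta> Q.aug] Q.aug_onto by blast
    have "h (rdiff P n x) \<in> rdiff Q 0 ` mcarrier (rmod Q (Suc 0))"
      if x: "x \<in> mcarrier (rmod P (Suc n))" for x
    proof -
      have "h (rdiff P n x) \<in> mcarrier (rmod Q 0)"
        using module_pair.deg_hom_carrier[OF module_pairI[OF module Q.module] h(1)] diff_carrier[OF x] .
      moreover have "raug Q (h (rdiff P n x)) = 0"
        using h(2) diff_carrier[OF x] cocycle[OF x] by simp
      ultimately show ?thesis using Q.exact_0 by blast
    qed
    then have "ok 0 h" unfolding ok_def using h by simp
    then show ?thesis by blast
  qed
  have step: "\<exists>g. ok (Suc i) g \<and>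
      (\<forall>x\<in>mcarrier (rmod P (Suc (i + n))). rdiff Q i (g x) = f (rdiff P (i + n) x))"
    if f: "ok i f" for i f
  proof -
    have fd: "(\<lambda>x. f (rdiff P (i + n) x)) \<in> deg_hom (rmod P (Suc (i + n))) (rmod Q i) e"
      using comp_deg_hom[OF module module diff[of "i + n"], where g = f and L = "rmod Q i" and e' = e] f unfolding ok_def by simp
    have "\<exists>g\<in>deg_hom (rmod P (Suc (i + n))) (rmod Q (Suc i)) e.
        \<forall>x\<in>mcarrier (rmod P (Suc (i + n))). rdiff Q i (g x) = f (rdiff P (i + n) x)"
      using f unfolding ok_def by (intro deg_hom_lift[OF module free Q.module Q.module fd Q.diff]) blast
    then obtain g where g: "g \<in> deg_hom (rmod P (Suc (i + n))) (rmod Q (Suc i)) e"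
      "\<And>x. x \<in> mcarrier (rmod P (Suc (i + n))) \<Longrightarrow> rdiff Q i (g x) = f (rdiff P (i + n) x)"
      by blast
    have "g (rdiff P (Suc i + n) x) \<in> rdiff Q (Suc i) ` mcarrier (rmod Q (Suc (Suc i)))"
      if x: "x \<in> mcarrier (rmod P (Suc (Suc i + n)))" for x
    proof -
      have x': "rdiff P (Suc i + n) x \<in> mcarrier (rmod P (Suc (i + n)))"
        using diff_carrier[OF x] by simp
      have "g (rdiff P (Suc i + n) x) \<in> mcarrier (rmod Q (Suc i))"
        using module_pair.deg_hom_carrier[OF module_pairI[OF module Q.module] g(1) x'] .
      moreover have "rdiff Q i (g (rdiff P (Suc i + n) x)) = f 0"
        using g(2)[OF x'] diff_diff[of x "i + n"] x by simp
      moreover have "f 0 = 0"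
        using f module_pair.deg_hom_zero[OF module_pairI[OF module Q.module]] unfolding ok_def by blast
      ultimately show ?thesis using Q.exact_Suc[of i] by auto
    qed
    then have "ok (Suc i) g" unfolding ok_def using g(1) by simp
    then show ?thesis using g(2) by blast
  qed
  obtain \<phi> where \<phi>: "\<And>i. ok i (\<phi> i)" "\<And>i. \<forall>x\<in>mcarrier (rmod P (Suc (i + n))).
      rdiff Q i (\<phi> (Suc i) x) = \<phi> i (rdiff P (i + n) x)"
    using dependent_nat_choice[of ok "\<lambda>i f g. \<forall>x\<in>mcarrier (rmod P (Suc (i + n))).
      rdiff Q i (g x) = f (rdiff P (i + n) x)"] base step by blast
  show ?thesis
    using \<phi> by (intro that[of \<phi>]) (auto simp: ok_def)
qed

end


section \<open>Cocycles and lifts\<close>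

context connected_algebra
begin

lemma scale_deg_hom_trivial: "(\<lambda>y. c * y) \<in> deg_hom (trivial_module A) (trivial_module A) 0"
  unfolding deg_hom_def by (auto simp: algebra_simps) (auto simp: trivial_module_def split: if_splits)

lemma scale_ghom:
  assumes M: "graded_module A M" and f: "f \<in> ghom M (trivial_module A)"
  shows "(\<lambda>x. c * f x) \<in> ghom M (trivial_module A)"
  using comp_ghom[OF M graded_module_trivial graded_module_trivial f]
    module_pair.deg_hom_ghom[OF module_pairI[OF graded_module_trivial graded_module_trivial]
      scale_deg_hom_trivial] by blast

end

context free_resolution_of
begin

abbreviation carrier :: "nat \<Rightarrow> 'm set" where "carrier n \<equiv> mcarrier (rmod P n)"

lemma pair: "module_pair A (rmod P n) (rmod P i)"
  and pair_trivial: "module_pair A (rmod P n) (trivial_module A)"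
  by (intro module_pairI module graded_module_trivial)+

lemma cocyclesI:
  "f \<in> ghom (rmod P n) (trivial_module A) \<Longrightarrow> (\<And>x. x \<in> carrier (Suc n) \<Longrightarrow> f (rdiff P n x) = 0)
    \<Longrightarrow> f \<in> cocycles A P n"
  unfolding cocycles_def by blast

lemma cocycle_ghom: "f \<in> cocycles A P n \<Longrightarrow> f \<in> ghom (rmod P n) (trivial_module A)"
  and cocycle_diff: "f \<in> cocycles A P n \<Longrightarrow> x \<in> carrier (Suc n) \<Longrightarrow> f (rdiff P n x) = 0"
  unfolding cocycles_def by blast+

lemma cocycle_cong:
  "f \<in> cocycles A P n \<Longrightarrow> (\<And>x. x \<in> carrier n \<Longrightarrow> g x = f x) \<Longrightarrow> g \<in> cocycles A P n"
  using module_pair.ghom_cong[OF pair_trivial cocycle_ghom] diff_carrier cocycle_diff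
  by (intro cocyclesI) simp_all

lemma cocycle_zero: "(\<lambda>x. 0) \<in> cocycles A P n"
  by (rule cocyclesI) (simp_all add: module_pair.zero_ghom[OF pair_trivial])

lemma cocycle_add:
  "f \<in> cocycles A P n \<Longrightarrow> g \<in> cocycles A P n \<Longrightarrow> (\<lambda>x. f x + g x) \<in> cocycles A P n"
  by (rule cocyclesI) (simp_all add: module_pair.add_ghom[OF pair_trivial] cocycle_ghom cocycle_diff)

lemma cocycle_scale: "f \<in> cocycles A P n \<Longrightarrow> (\<lambda>x. c * f x) \<in> cocycles A P n"
  by (rule cocyclesI) (simp_all add: scale_ghom module cocycle_ghom cocycle_diff)

lemma cocycle_aug: "raug P \<in> cocycles A P 0"
  by (rule cocyclesI[OF aug_ghom]) (rule aug_diff)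

text \<open>Since \<open>P\<close> resolves \<open>K\<close>, a cocycle of degree 0 factors through the augmentation.\<close>

lemma cocycle_0_scalar:
  assumes f: "f \<in> cocycles A P 0"
  obtains c where "\<And>x. x \<in> carrier 0 \<Longrightarrow> f x = c * raug P x"
proof -
  interpret module_over A "rmod P 0" by (rule module_overI[OF module])
  obtain u where u: "u \<in> carrier 0" "raug P u = 1" using aug_onto by (metis UNIV_I imageE)
  have "f x = f u * raug P x" if x: "x \<in> carrier 0" for x
  proof -
    let ?y = "act (rmod P 0) (smul A (raug P x) (gone A)) u"
    have y: "?y \<in> carrier 0" using u(1) by (rule act_carrier)
    have "raug P (x - ?y) = 0"
      using u x y by (simp add: module_pair.ghom_diff[OF pair_trivial aug_ghom] deg_hom_act[OF aug])
    then obtain z where "z \<in> carrier 1" "x - ?y = rdiff P 0 z"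
      using exact_0 mod.dsum_diff[OF x y] by auto
    then have "f (x - ?y) = 0" using cocycle_diff[OF f] by simp
    then show ?thesis
      using module_pair.ghom_diff[OF pair_trivial cocycle_ghom[OF f] x y]
        module_pair.ghom_act[OF pair_trivial cocycle_ghom[OF f] u(1)] by simp
  qed
  then show ?thesis by (rule that)
qed

lemma coboundary_0: "coboundary A P 0 f \<longleftrightarrow> (\<forall>x\<in>carrier 0. f x = 0)"
  and coboundary_Suc: "coboundary A P (Suc k) f \<longleftrightarrow>
    (\<exists>h\<in>ghom (rmod P k) (trivial_module A). \<forall>x\<in>carrier (Suc k). f x = h (rdiff P k x))"
  unfolding coboundary_def by simp_all

lemma coboundary_vanishing:
  "(\<And>x. x \<in> carrier n \<Longrightarrow> f x = 0) \<Longrightarrow> coboundary A P n f"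
  by (cases n) (auto simp: coboundary_0 coboundary_Suc
      intro!: bexI[of _ "\<lambda>x. 0"] module_pair.zero_ghom[OF pair_trivial])

lemma coboundary_cong:
  "coboundary A P n f \<Longrightarrow> (\<And>x. x \<in> carrier n \<Longrightarrow> g x = f x) \<Longrightarrow> coboundary A P n g"
  by (cases n) (auto simp: coboundary_0 coboundary_Suc)

lemma coboundary_add:
  assumes "coboundary A P n f" "coboundary A P n g" shows "coboundary A P n (\<lambda>x. f x + g x)"
proof (cases n)
  case 0
  then show ?thesis using assms by (simp add: coboundary_0)
next
  case (Suc k)
  then obtain h h' where "h \<in> ghom (rmod P k) (trivial_module A)" "\<forall>x\<in>carrier n. f x = h (rdiff P k x)"
    "h' \<in> ghom (rmod P k) (trivial_module A)" "\<forall>x\<in>carrier n. g x = h' (rdiff P k x)"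
    using assms by (auto simp: coboundary_Suc)
  then show ?thesis
    unfolding Suc coboundary_Suc
    by (intro bexI[of _ "\<lambda>x. h x + h' x"] module_pair.add_ghom[OF pair_trivial]) simp_all
qed

lemma coboundary_scale:
  assumes "coboundary A P n f" shows "coboundary A P n (\<lambda>x. c * f x)"
proof (cases n)
  case 0
  then show ?thesis using assms by (simp add: coboundary_0)
next
  case (Suc k)
  then obtain h where "h \<in> ghom (rmod P k) (trivial_module A)" "\<forall>x\<in>carrier n. f x = h (rdiff P k x)"
    using assms by (auto simp: coboundary_Suc)
  then show ?thesis
    unfolding Suc coboundary_Suc
    by (intro bexI[of _ "\<lambda>x. c * h x"] scale_ghom module) simp_all
qed

lemma coboundary_minus: "coboundary A P n f \<Longrightarrow> coboundary A P n (\<lambda>x. - f x)"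
  using coboundary_scale[of n f "- 1"] by simp

lemma coboundary_swap:
  "coboundary A P n (\<lambda>x. f x - g x) \<Longrightarrow> coboundary A P n (\<lambda>x. g x - f x)"
  using coboundary_minus by fastforce

lemma coboundary_cocycle:
  assumes "coboundary A P n f" shows "f \<in> cocycles A P n"
proof (cases n)
  case 0
  then show ?thesis
    using assms cocycle_cong[OF cocycle_zero, of 0 f] by (simp add: coboundary_0)
next
  case (Suc k)
  then obtain h where h: "h \<in> ghom (rmod P k) (trivial_module A)" "\<forall>x\<in>carrier (Suc k). f x = h (rdiff P k x)"
    using assms by (auto simp: coboundary_Suc)
  have "(\<lambda>x. h (rdiff P k x)) \<in> ghom (rmod P (Suc k)) (trivial_module A)"
    by (rule comp_ghom[OF module module graded_module_trivial diff_ghom h(1)])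
  then have "(\<lambda>x. h (rdiff P k x)) \<in> cocycles A P (Suc k)"
    by (rule cocyclesI) (simp add: diff_diff module_pair.ghom_zero[OF pair_trivial h(1)])
  then show ?thesis unfolding Suc by (rule cocycle_cong) (simp add: h(2))
qed

lemma chain_liftsI:
  assumes "\<And>i. \<phi> i \<in> ghom (rmod P (i + n)) (rmod P i)"
    "\<And>x. x \<in> carrier n \<Longrightarrow> raug P (\<phi> 0 x) = \<eta> x"
    "\<And>i x. x \<in> carrier (Suc (i + n)) \<Longrightarrow> rdiff P i (\<phi> (Suc i) x) = \<phi> i (rdiff P (i + n) x)"
  shows "\<phi> \<in> chain_lifts A P n \<eta>"
  using assms unfolding chain_lifts_def by (simp add: add.commute)

lemma
  assumes "\<phi> \<in> chain_lifts A P n \<eta>"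
  shows lift_ghom: "\<phi> i \<in> ghom (rmod P (i + n)) (rmod P i)"
    and lift_aug: "x \<in> carrier n \<Longrightarrow> raug P (\<phi> 0 x) = \<eta> x"
    and lift_diff: "x \<in> carrier (Suc (i + n)) \<Longrightarrow> rdiff P i (\<phi> (Suc i) x) = \<phi> i (rdiff P (i + n) x)"
  using assms unfolding chain_lifts_def by (simp_all add: add.commute)

lemma lift_carrier:
  "\<phi> \<in> chain_lifts A P n \<eta> \<Longrightarrow> x \<in> carrier (i + n) \<Longrightarrow> \<phi> i x \<in> carrier i"
  by (rule module_pair.ghom_carrier[OF pair lift_ghom])

text \<open>As the differential has degree 0, the homogeneous components of a cocycle are cocycles.\<close>

lemma homogeneous_components:
  assumes \<eta>: "\<eta> \<in> cocycles A P n"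
  obtains E F where "finite E" "\<And>e. e \<in> E \<Longrightarrow> F e \<in> deg_hom (rmod P n) (trivial_module A) e"
    "\<And>e x. e \<in> E \<Longrightarrow> x \<in> carrier (Suc n) \<Longrightarrow> F e (rdiff P n x) = 0"
    "\<And>x. x \<in> carrier n \<Longrightarrow> \<eta> x = (\<Sum>e\<in>E. F e x)"
proof -
  obtain E F where EF: "finite E" "\<And>e. e \<in> E \<Longrightarrow> F e \<in> deg_hom (rmod P n) (trivial_module A) e"
    "\<And>x. x \<in> carrier n \<Longrightarrow> \<eta> x = (\<Sum>e\<in>E. F e x)"
    using cocycle_ghom[OF \<eta>] unfolding ghom_def by blast
  have "F e (rdiff P n x) = 0" if "e \<in> E" "x \<in> carrier (Suc n)" for e x
  proof (rule module_pair.deg_hom_sum_zero[OF pair_trivial EF(1) _ _ that])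
    show "(\<lambda>x. F e (rdiff P n x)) \<in> deg_hom (rmod P (Suc n)) (trivial_module A) e" if "e \<in> E" for e
      using comp_deg_hom[OF module module diff EF(2)[OF that]] by simp
    show "(\<Sum>e\<in>E. F e (rdiff P n x)) = 0" if "x \<in> carrier (Suc n)" for x
      using EF(3)[OF diff_carrier[OF that]] cocycle_diff[OF \<eta> that] by simp
  qed
  then show ?thesis using EF by (intro that[of E F]) blast+
qed

lemma lift_sum:
  assumes \<phi>: "\<And>e. e \<in> E \<Longrightarrow> \<phi> e \<in> chain_lifts A P n (F e)"
    and \<eta>: "\<And>x. x \<in> carrier n \<Longrightarrow> \<eta> x = (\<Sum>e\<in>E. F e x)"
  shows "(\<lambda>i x. \<Sum>e\<in>E. \<phi> e i x) \<in> chain_lifts A P n \<eta>"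
proof (rule chain_liftsI)
  show "(\<lambda>x. \<Sum>e\<in>E. \<phi> e i x) \<in> ghom (rmod P (i + n)) (rmod P i)" for i
    by (rule module_pair.sum_ghom[OF pair]) (rule lift_ghom[OF \<phi>])
  show "raug P (\<Sum>e\<in>E. \<phi> e 0 x) = \<eta> x" if "x \<in> carrier n" for x
  proof -
    have "raug P (\<Sum>e\<in>E. \<phi> e 0 x) = (\<Sum>e\<in>E. raug P (\<phi> e 0 x))"
      by (rule module_pair.ghom_sum[OF pair_trivial aug_ghom])
        (use lift_carrier[OF \<phi>, of _ x 0] that in simp)
    also have "\<dots> = \<eta> x" using lift_aug[OF \<phi> that] \<eta>[OF that] by simp
    finally show ?thesis .
  qed
  show "rdiff P i (\<Sum>e\<in>E. \<phi> e (Suc i) x) = (\<Sum>e\<in>E. \<phi> e i (rdiff P (i + n) x))"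
    if "x \<in> carrier (Suc (i + n))" for i x
  proof -
    have "rdiff P i (\<Sum>e\<in>E. \<phi> e (Suc i) x) = (\<Sum>e\<in>E. rdiff P i (\<phi> e (Suc i) x))"
      by (rule module_pair.ghom_sum[OF pair diff_ghom])
        (use lift_carrier[OF \<phi>, of _ x "Suc i"] that in simp)
    then show ?thesis using lift_diff[OF \<phi> that] by simp
  qed
qed

lemma homogeneous_lift_exists:
  assumes "\<eta> \<in> deg_hom (rmod P n) (trivial_module A) e"
    and "\<And>x. x \<in> carrier (Suc n) \<Longrightarrow> \<eta> (rdiff P n x) = 0"
  obtains \<phi> where "\<phi> \<in> chain_lifts A P n \<eta>" "\<And>i. \<phi> i \<in> deg_hom (rmod P (i + n)) (rmod P i) e"
proof -
  obtain \<phi> where \<phi>: "\<And>i. \<phi> i \<in> deg_hom (rmod P (i + n)) (rmod P i) e"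
    "\<And>x. x \<in> carrier n \<Longrightarrow> raug P (\<phi> 0 x) = \<eta> x"
    "\<And>i x. x \<in> carrier (Suc (i + n)) \<Longrightarrow> rdiff P i (\<phi> (Suc i) x) = \<phi> i (rdiff P (i + n) x)"
    using comparison[OF exact_resolution_axioms assms] by blast
  then have "\<phi> \<in> chain_lifts A P n \<eta>"
    by (intro chain_liftsI module_pair.deg_hom_ghom[OF pair]) blast+
  then show ?thesis using \<phi>(1) by (rule that)
qed

lemma lift_exists:
  assumes "\<eta> \<in> cocycles A P n" obtains \<phi> where "\<phi> \<in> chain_lifts A P n \<eta>"
proof -
  obtain E F where EF: "finite E" "\<And>e. e \<in> E \<Longrightarrow> F e \<in> deg_hom (rmod P n) (trivial_module A) e"
    "\<And>e x. e \<in> E \<Longrightarrow> x \<in> carrier (Suc n) \<Longrightarrow> F e (rdiff P n x) = 0"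
    "\<And>x. x \<in> carrier n \<Longrightarrow> \<eta> x = (\<Sum>e\<in>E. F e x)"
    using homogeneous_components[OF assms] by blast
  have "\<forall>e\<in>E. \<exists>\<phi>. \<phi> \<in> chain_lifts A P n (F e)"
    using homogeneous_lift_exists[OF EF(2,3)] by metis
  then obtain \<phi> where "\<And>e. e \<in> E \<Longrightarrow> \<phi> e \<in> chain_lifts A P n (F e)" by metis
  from lift_sum[OF this EF(4)] show ?thesis using that by blast
qed

text \<open>
  A lift of zero is null-homotopic: \<open>\<phi>\<^sub>m = d s + t d\<close>, where \<open>t d\<close> is absent if \<open>m = 0\<close>. The
  differential kills \<open>\<phi>\<^sub>m\<^sub>+\<^sub>1 - s d\<close>, so this map lifts through the next differential; thus the \<open>s\<close> of
  one degree is the \<open>t\<close> of the next.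
\<close>

lemma null_homotopy:
  assumes \<phi>: "\<phi> \<in> chain_lifts A P n (\<lambda>x. 0)"
  shows "\<exists>s\<in>ghom (rmod P (m + n)) (rmod P (Suc m)). \<exists>u.
    (\<forall>x\<in>carrier (m + n). \<phi> m x = rdiff P m (s x) + u x) \<and>
    (case m of 0 \<Rightarrow> u = (\<lambda>x. 0)
      | Suc k \<Rightarrow> \<exists>t\<in>ghom (rmod P (k + n)) (rmod P m). u = (\<lambda>x. t (rdiff P (k + n) x)))"
proof (induction m)
  case 0
  have "\<phi> 0 x \<in> rdiff P 0 ` carrier (Suc 0)" if "x \<in> carrier (0 + n)" for x
    using lift_aug[OF \<phi>] lift_carrier[OF \<phi>, of x 0] that exact_0 by auto
  then have "\<exists>s\<in>ghom (rmod P (0 + n)) (rmod P (Suc 0)). \<forall>x\<in>carrier (0 + n). rdiff P 0 (s x) = \<phi> 0 x"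
    by (rule ghom_lift[OF module free module module lift_ghom[OF \<phi>] diff])
  then show ?case by force
next
  case (Suc m)
  then obtain s u where s: "s \<in> ghom (rmod P (m + n)) (rmod P (Suc m))"
    and su: "\<And>x. x \<in> carrier (m + n) \<Longrightarrow> \<phi> m x = rdiff P m (s x) + u x"
    and u: "case m of 0 \<Rightarrow> u = (\<lambda>x. 0)
      | Suc k \<Rightarrow> \<exists>t\<in>ghom (rmod P (k + n)) (rmod P m). u = (\<lambda>x. t (rdiff P (k + n) x))"
    by blast
  have ud: "u (rdiff P (m + n) x) = 0" if "x \<in> carrier (Suc (m + n))" for x
  proof (cases m)
    case 0
    then show ?thesis using u by simp
  next
    case (Suc k)
    then obtain t where "t \<in> ghom (rmod P (k + n)) (rmod P m)" "u = (\<lambda>x. t (rdiff P (k + n) x))"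
      using u by auto
    then show ?thesis
      using that Suc diff_diff[of x "k + n"] module_pair.ghom_zero[OF pair] by simp
  qed
  let ?f = "\<lambda>x. \<phi> (Suc m) x - s (rdiff P (m + n) x)"
  have sd: "(\<lambda>x. s (rdiff P (m + n) x)) \<in> ghom (rmod P (Suc m + n)) (rmod P (Suc m))"
    using comp_ghom[OF module module module diff_ghom s] by simp
  have f: "?f \<in> ghom (rmod P (Suc m + n)) (rmod P (Suc m))"
    by (rule module_pair.diff_ghom[OF pair lift_ghom[OF \<phi>] sd])
  have "?f x \<in> rdiff P (Suc m) ` carrier (Suc (Suc m))" if x: "x \<in> carrier (Suc m + n)" for x
  proof -
    have x': "x \<in> carrier (Suc (m + n))" using x by simp
    have "rdiff P m (?f x) = rdiff P m (\<phi> (Suc m) x) - rdiff P m (s (rdiff P (m + n) x))"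
      using x by (intro module_pair.ghom_diff[OF pair diff_ghom] lift_carrier[OF \<phi>]
          module_pair.ghom_carrier[OF pair sd])
    also have "\<dots> = 0"
      using lift_diff[OF \<phi> x'] su[OF diff_carrier[OF x']] ud[OF x'] by simp
    finally show ?thesis
      using module_pair.ghom_carrier[OF pair f x] exact_Suc[of m] by blast
  qed
  then have "\<exists>s'\<in>ghom (rmod P (Suc m + n)) (rmod P (Suc (Suc m))).
      \<forall>x\<in>carrier (Suc m + n). rdiff P (Suc m) (s' x) = ?f x"
    by (rule ghom_lift[OF module free module module f diff])
  then obtain s' where "s' \<in> ghom (rmod P (Suc m + n)) (rmod P (Suc (Suc m)))"
    "\<forall>x\<in>carrier (Suc m + n). rdiff P (Suc m) (s' x) = ?f x" by blast
  then show ?case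
    using s by (intro bexI[of _ s'] exI[of _ "\<lambda>x. s (rdiff P (m + n) x)"]) auto
qed

text \<open>A cocycle \<open>\<xi>\<close> vanishes on \<open>d s\<close>, which leaves the coboundary \<open>\<xi> t d\<close>.\<close>

lemma lift_zero_coboundary:
  assumes \<xi>: "\<xi> \<in> cocycles A P m" and \<phi>: "\<phi> \<in> chain_lifts A P n (\<lambda>x. 0)"
  shows "coboundary A P (m + n) (\<lambda>x. \<xi> (\<phi> m x))"
proof -
  obtain s u where s: "s \<in> ghom (rmod P (m + n)) (rmod P (Suc m))"
    and su: "\<And>x. x \<in> carrier (m + n) \<Longrightarrow> \<phi> m x = rdiff P m (s x) + u x"
    and u: "case m of 0 \<Rightarrow> u = (\<lambda>x. 0)
      | Suc k \<Rightarrow> \<exists>t\<in>ghom (rmod P (k + n)) (rmod P m). u = (\<lambda>x. t (rdiff P (k + n) x))"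
    using null_homotopy[OF \<phi>, of m] by blast
  have sc: "s x \<in> carrier (Suc m)" if "x \<in> carrier (m + n)" for x
    by (rule module_pair.ghom_carrier[OF pair s that])
  show ?thesis
  proof (cases m)
    case 0
    then show ?thesis
      using su sc u cocycle_diff[OF \<xi>] by (intro coboundary_vanishing) simp
  next
    case (Suc k)
    then obtain t where t: "t \<in> ghom (rmod P (k + n)) (rmod P m)" "u = (\<lambda>x. t (rdiff P (k + n) x))"
      using u by auto
    have "\<xi> (\<phi> m x) = \<xi> (t (rdiff P (k + n) x))" if x: "x \<in> carrier (Suc (k + n))" for x
    proof -
      have x': "x \<in> carrier (m + n)" using x Suc by simp
      have "t (rdiff P (k + n) x) \<in> carrier m"
        by (rule module_pair.ghom_carrier[OF pair t(1) diff_carrier[OF x]])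
      then show ?thesis
        using module_pair.ghom_add[OF pair_trivial cocycle_ghom[OF \<xi>]]
          diff_carrier[OF sc[OF x']] cocycle_diff[OF \<xi> sc[OF x']] su[OF x'] t(2) by simp
    qed
    moreover have "(\<lambda>x. \<xi> (t x)) \<in> ghom (rmod P (k + n)) (trivial_module A)"
      by (rule comp_ghom[OF module module graded_module_trivial t(1) cocycle_ghom[OF \<xi>]])
    ultimately show ?thesis unfolding Suc using coboundary_Suc by auto
  qed
qed

lemma lift_diff_zero:
  assumes \<phi>: "\<phi> \<in> chain_lifts A P n \<eta>" and \<psi>: "\<psi> \<in> chain_lifts A P n \<eta>"
  shows "(\<lambda>i x. \<phi> i x - \<psi> i x) \<in> chain_lifts A P n (\<lambda>x. 0)"
proof (rule chain_liftsI)
  show "(\<lambda>x. \<phi> i x - \<psi> i x) \<in> ghom (rmod P (i + n)) (rmod P i)" for i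
    by (rule module_pair.diff_ghom[OF pair lift_ghom[OF \<phi>] lift_ghom[OF \<psi>]])
  show "raug P (\<phi> 0 x - \<psi> 0 x) = 0" if x: "x \<in> carrier n" for x
    using module_pair.ghom_diff[OF pair_trivial aug_ghom lift_carrier[OF \<phi>, of x 0] lift_carrier[OF \<psi>, of x 0]]
      lift_aug[OF \<phi> x] lift_aug[OF \<psi> x] x by simp
  show "rdiff P i (\<phi> (Suc i) x - \<psi> (Suc i) x) = \<phi> i (rdiff P (i + n) x) - \<psi> i (rdiff P (i + n) x)"
    if x: "x \<in> carrier (Suc (i + n))" for i x
    using module_pair.ghom_diff[OF pair diff_ghom lift_carrier[OF \<phi>, of x "Suc i"] lift_carrier[OF \<psi>, of x "Suc i"]]
      lift_diff[OF \<phi> x] lift_diff[OF \<psi> x] x by simp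
qed

lemma lift_unique:
  assumes \<xi>: "\<xi> \<in> cocycles A P m"
    and \<phi>: "\<phi> \<in> chain_lifts A P n \<eta>" and \<psi>: "\<psi> \<in> chain_lifts A P n \<eta>"
  shows "coboundary A P (m + n) (\<lambda>x. \<xi> (\<phi> m x) - \<xi> (\<psi> m x))"
  by (rule coboundary_cong[OF lift_zero_coboundary[OF \<xi> lift_diff_zero[OF \<phi> \<psi>]]])
    (simp add: module_pair.ghom_diff[OF pair_trivial cocycle_ghom[OF \<xi>]] lift_carrier[OF \<phi>] lift_carrier[OF \<psi>])

lemma cocycle_comp_lift:
  assumes \<xi>: "\<xi> \<in> cocycles A P m" and \<phi>: "\<phi> \<in> chain_lifts A P n \<eta>"
  shows "(\<lambda>x. \<xi> (\<phi> m x)) \<in> cocycles A P (m + n)"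
proof (rule cocyclesI)
  show "(\<lambda>x. \<xi> (\<phi> m x)) \<in> ghom (rmod P (m + n)) (trivial_module A)"
    by (rule comp_ghom[OF module module graded_module_trivial lift_ghom[OF \<phi>] cocycle_ghom[OF \<xi>]])
  show "\<xi> (\<phi> m (rdiff P (m + n) x)) = 0" if "x \<in> carrier (Suc (m + n))" for x
    using lift_diff[OF \<phi> that] cocycle_diff[OF \<xi> lift_carrier[OF \<phi>, of x "Suc m"]] that by simp
qed

lemma coboundary_comp_lift:
  assumes f: "coboundary A P m f" and \<phi>: "\<phi> \<in> chain_lifts A P n \<eta>"
  shows "coboundary A P (m + n) (\<lambda>x. f (\<phi> m x))"
proof (cases m)
  case 0
  then show ?thesis
    using f lift_carrier[OF \<phi>, of _ 0] by (intro coboundary_vanishing) (simp add: coboundary_0)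
next
  case (Suc k)
  then obtain h where h: "h \<in> ghom (rmod P k) (trivial_module A)"
    "\<And>x. x \<in> carrier (Suc k) \<Longrightarrow> f x = h (rdiff P k x)"
    using f by (auto simp: coboundary_Suc)
  have "(\<lambda>x. h (\<phi> k x)) \<in> ghom (rmod P (k + n)) (trivial_module A)"
    by (rule comp_ghom[OF module module graded_module_trivial lift_ghom[OF \<phi>] h(1)])
  moreover have "f (\<phi> m x) = h (\<phi> k (rdiff P (k + n) x))" if "x \<in> carrier (Suc (k + n))" for x
    using h(2) lift_carrier[OF \<phi>, of x m] lift_diff[OF \<phi> that] that Suc by simp
  ultimately show ?thesis unfolding Suc using coboundary_Suc by auto
qed

lemma lift_cong:
  "\<phi> \<in> chain_lifts A P n \<eta> \<Longrightarrow> (\<And>x. x \<in> carrier n \<Longrightarrow> \<eta>' x = \<eta> x) \<Longrightarrow> \<phi> \<in> chain_lifts A P n \<eta>'"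
  unfolding chain_lifts_def by simp

text \<open>
  Changing \<open>\<eta>\<close> by a coboundary \<open>h d\<close> changes a lift by \<open>\<theta> d\<close> in its first term only, for a lift
  \<open>\<theta>\<close> of \<open>h\<close> to \<open>P\<^sub>0\<close>.
\<close>

lemma lift_respects_coboundary:
  assumes \<xi>: "\<xi> \<in> cocycles A P m" and cob: "coboundary A P n (\<lambda>x. \<eta> x - \<eta>' x)"
    and \<phi>: "\<phi> \<in> chain_lifts A P n \<eta>" and \<psi>: "\<psi> \<in> chain_lifts A P n \<eta>'"
  shows "coboundary A P (m + n) (\<lambda>x. \<xi> (\<phi> m x) - \<xi> (\<psi> m x))"
proof (cases n)
  case 0
  then have "\<phi> \<in> chain_lifts A P n \<eta>'"
    using cob by (intro lift_cong[OF \<phi>]) (simp add: coboundary_0)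
  then show ?thesis by (rule lift_unique[OF \<xi> _ \<psi>])
next
  case (Suc k)
  then obtain h where h: "h \<in> ghom (rmod P k) (trivial_module A)"
    "\<And>x. x \<in> carrier (Suc k) \<Longrightarrow> \<eta> x - \<eta>' x = h (rdiff P k x)"
    using cob by (auto simp: coboundary_Suc)
  obtain \<theta> where \<theta>: "\<theta> \<in> ghom (rmod P k) (rmod P 0)" "\<forall>x\<in>carrier k. raug P (\<theta> x) = h x"
    using ghom_lift[OF module free module graded_module_trivial h(1) aug] aug_onto by blast
  have \<theta>c: "\<theta> (rdiff P k x) \<in> carrier 0" if "x \<in> carrier n" for x
    using module_pair.ghom_carrier[OF pair \<theta>(1)] diff_carrier that Suc by blast
  have \<theta>d: "(\<lambda>x. \<theta> (rdiff P k x)) \<in> ghom (rmod P n) (rmod P 0)"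
    using comp_ghom[OF module module module diff_ghom \<theta>(1)] Suc by simp
  define \<psi>' where "\<psi>' i = (if i = 0 then (\<lambda>x. \<psi> 0 x + \<theta> (rdiff P k x)) else \<psi> i)" for i
  have \<psi>': "\<psi>' \<in> chain_lifts A P n \<eta>"
  proof (rule chain_liftsI)
    show "\<psi>' i \<in> ghom (rmod P (i + n)) (rmod P i)" for i
      using lift_ghom[OF \<psi>, of i] \<theta>d by (cases "i = 0") (auto simp: \<psi>'_def module_pair.add_ghom[OF pair])
    show "raug P (\<psi>' 0 x) = \<eta> x" if x: "x \<in> carrier n" for x
      using module_pair.ghom_add[OF pair_trivial aug_ghom lift_carrier[OF \<psi>, of x 0] \<theta>c[OF x]]
        x lift_aug[OF \<psi> x] \<theta>(2) h(2)[of x] diff_carrier[of x k] Suc by (simp add: \<psi>'_def algebra_simps)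
    show "rdiff P i (\<psi>' (Suc i) x) = \<psi>' i (rdiff P (i + n) x)" if x: "x \<in> carrier (Suc (i + n))" for i x
      using lift_diff[OF \<psi> x] diff_diff[of x k] x Suc module_pair.ghom_zero[OF pair \<theta>(1)]
      by (cases "i = 0") (simp_all add: \<psi>'_def)
  qed
  have "coboundary A P (m + n) (\<lambda>x. \<xi> (\<psi>' m x) - \<xi> (\<psi> m x))"
  proof (cases "m = 0")
    case True
    have "(\<lambda>x. \<xi> (\<theta> x)) \<in> ghom (rmod P k) (trivial_module A)"
      using comp_ghom[OF module module graded_module_trivial \<theta>(1)] cocycle_ghom[OF \<xi>] True by simp
    moreover have "\<xi> (\<psi>' m x) - \<xi> (\<psi> m x) = \<xi> (\<theta> (rdiff P k x))" if "x \<in> carrier n" for x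
      using module_pair.ghom_add[OF pair_trivial cocycle_ghom[OF \<xi>]] True that
        lift_carrier[OF \<psi>, of x 0] \<theta>c[OF that] by (simp add: \<psi>'_def)
    ultimately show ?thesis using True Suc coboundary_Suc by auto
  next
    case False
    then show ?thesis by (intro coboundary_vanishing) (simp add: \<psi>'_def)
  qed
  from coboundary_add[OF lift_unique[OF \<xi> \<phi> \<psi>'] this] show ?thesis by simp
qed

text \<open>
  The chain map that computes \<open>[\<eta>][\<zeta>]\<close> is thus a composite, which makes the Yoneda product
  associative already on cocycles.
\<close>

lemma lift_comp:
  assumes \<phi>: "\<phi> \<in> chain_lifts A P j \<eta>" and \<psi>: "\<psi> \<in> chain_lifts A P p \<zeta>"
  shows "(\<lambda>i x. \<phi> i (\<psi> (i + j) x)) \<in> chain_lifts A P (j + p) (\<lambda>x. \<eta> (\<psi> j x))"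
proof (rule chain_liftsI)
  show "(\<lambda>x. \<phi> i (\<psi> (i + j) x)) \<in> ghom (rmod P (i + (j + p))) (rmod P i)" for i
    using comp_ghom[OF module module module lift_ghom[OF \<psi>, of "i + j"] lift_ghom[OF \<phi>]]
    by (simp add: add.assoc)
  show "raug P (\<phi> 0 (\<psi> (0 + j) x)) = \<eta> (\<psi> j x)" if "x \<in> carrier (j + p)" for x
    using lift_aug[OF \<phi> lift_carrier[OF \<psi> that]] by simp
  show "rdiff P i (\<phi> (Suc i) (\<psi> (Suc i + j) x)) = \<phi> i (\<psi> (i + j) (rdiff P (i + (j + p)) x))"
    if "x \<in> carrier (Suc (i + (j + p)))" for i x
    using lift_diff[OF \<phi>, of "\<psi> (Suc i + j) x" i] lift_diff[OF \<psi>, of x "i + j"]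
      lift_carrier[OF \<psi>, of x "Suc i + j"] that by (simp add: add.assoc)
qed

end

section \<open>Classes and generation in low degree\<close>

text \<open>
  The part of \<open>E\<^sup>n(A)\<close> spanned by products with left factor in \<open>E\<^sup>1(A)\<close> or \<open>E\<^sup>2(A)\<close>, as a set of
  cocycles.
\<close>

inductive_set decomposables ::
  "('k::field, 'a::ab_group_add) galgebra \<Rightarrow> ('k, 'a, 'm::ab_group_add) resolution \<Rightarrow> nat
    \<Rightarrow> ('m \<Rightarrow> 'k) set"
  for A P n where
  coboundary: "coboundary A P n f \<Longrightarrow> f \<in> decomposables A P n"
| product: "i \<in> {1, 2} \<Longrightarrow> i + j = n \<Longrightarrow> \<xi> \<in> cocycles A P i \<Longrightarrow> \<eta> \<in> cocycles A P j
    \<Longrightarrow> \<phi> \<in> chain_lifts A P j \<eta> \<Longrightarrow> (\<lambda>x. \<xi> (\<phi> i x)) \<in> decomposables A P n"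
| add: "f \<in> decomposables A P n \<Longrightarrow> g \<in> decomposables A P n
    \<Longrightarrow> (\<lambda>x. f x + g x) \<in> decomposables A P n"

context free_resolution_of
begin

abbreviation cls :: "nat \<Rightarrow> ('m \<Rightarrow> 'k) \<Rightarrow> ('m \<Rightarrow> 'k) set" where
  "cls n f \<equiv> ext_rel A P n `` {f}"

lemma ext_rel_iff: "(f, g) \<in> ext_rel A P n \<longleftrightarrow> f \<in> cocycles A P n \<and> g \<in> cocycles A P n \<and> coboundary A P n (\<lambda>x. f x - g x)"
  by (simp add: ext_rel_def)

lemma coboundary_trans:
  "coboundary A P n (\<lambda>x. f x - g x) \<Longrightarrow> coboundary A P n (\<lambda>x. g x - h x)
    \<Longrightarrow> coboundary A P n (\<lambda>x. f x - h x)"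
  using coboundary_add[of n "\<lambda>x. f x - g x" "\<lambda>x. g x - h x"] by simp

lemma cls_refl: "f \<in> cocycles A P n \<Longrightarrow> f \<in> cls n f"
  by (simp add: ext_rel_iff coboundary_vanishing)

lemma cls_eqI:
  assumes "f \<in> cocycles A P n" "g \<in> cocycles A P n" "coboundary A P n (\<lambda>x. f x - g x)"
  shows "cls n f = cls n g"
proof (intro set_eqI iffI)
  fix h
  show "h \<in> cls n g" if "h \<in> cls n f"
    using that assms coboundary_trans[OF coboundary_swap[OF assms(3)]] by (simp add: ext_rel_iff)
  show "h \<in> cls n f" if "h \<in> cls n g"
    using that assms coboundary_trans[OF assms(3)] by (simp add: ext_rel_iff)
qed

lemma cls_cong:
  assumes "f \<in> cocycles A P n" "\<And>x. x \<in> carrier n \<Longrightarrow> g x = f x" shows "cls n g = cls n f"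
  using assms by (intro cls_eqI cocycle_cong[OF assms] coboundary_vanishing) auto

lemma ext_iff: "X \<in> ext A P n \<longleftrightarrow> (\<exists>f\<in>cocycles A P n. X = cls n f)"
  by (auto simp: ext_def quotient_def)

lemma ext_zero_cls: "ext_zero A P n = cls n (\<lambda>x. 0)"
  by (simp add: ext_zero_def)

lemma ext_add_cls:
  assumes f: "f \<in> cocycles A P n" and g: "g \<in> cocycles A P n"
  shows "ext_add A P n (cls n f) (cls n g) = cls n (\<lambda>x. f x + g x)"
proof -
  have "cls n (\<lambda>x. \<xi> x + \<eta> x) = cls n (\<lambda>x. f x + g x)" if "\<xi> \<in> cls n f" "\<eta> \<in> cls n g" for \<xi> \<eta>
  proof (rule cls_eqI)
    show "(\<lambda>x. \<xi> x + \<eta> x) \<in> cocycles A P n" using that by (intro cocycle_add) (simp_all add: ext_rel_iff)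
    show "(\<lambda>x. f x + g x) \<in> cocycles A P n" using f g by (rule cocycle_add)
    show "coboundary A P n (\<lambda>x. \<xi> x + \<eta> x - (f x + g x))"
      using coboundary_add[of n "\<lambda>x. \<xi> x - f x" "\<lambda>x. \<eta> x - g x"] that
      by (simp add: ext_rel_iff coboundary_swap algebra_simps)
  qed
  then show ?thesis unfolding ext_add_def using cls_refl[OF f] cls_refl[OF g] by blast
qed

lemma ext_scale_cls:
  assumes f: "f \<in> cocycles A P n"
  shows "ext_scale A P n c (cls n f) = cls n (\<lambda>x. c * f x)"
proof -
  have "cls n (\<lambda>x. c * \<xi> x) = cls n (\<lambda>x. c * f x)" if "\<xi> \<in> cls n f" for \<xi>
  proof (rule cls_eqI)
    show "(\<lambda>x. c * \<xi> x) \<in> cocycles A P n" "(\<lambda>x. c * f x) \<in> cocycles A P n"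
      using that by (simp_all add: ext_rel_iff cocycle_scale)
    show "coboundary A P n (\<lambda>x. c * \<xi> x - c * f x)"
      using coboundary_scale[of n "\<lambda>x. \<xi> x - f x" c] that
      by (simp add: ext_rel_iff coboundary_swap right_diff_distrib)
  qed
  then show ?thesis unfolding ext_scale_def using cls_refl[OF f] by blast
qed

lemma ext_prod_cls:
  assumes \<xi>: "\<xi> \<in> cocycles A P m" and \<eta>: "\<eta> \<in> cocycles A P n" and \<phi>: "\<phi> \<in> chain_lifts A P n \<eta>"
  shows "ext_prod A P m n (cls m \<xi>) (cls n \<eta>) = cls (m + n) (\<lambda>x. \<xi> (\<phi> m x))"
proof -
  have "cls (m + n) (\<lambda>x. \<xi>' (\<psi> m x)) = cls (m + n) (\<lambda>x. \<xi> (\<phi> m x))"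
    if \<xi>': "\<xi>' \<in> cls m \<xi>" and \<eta>': "\<eta>' \<in> cls n \<eta>" and \<psi>: "\<psi> \<in> chain_lifts A P n \<eta>'" for \<xi>' \<eta>' \<psi>
  proof (rule cls_eqI)
    show "(\<lambda>x. \<xi>' (\<psi> m x)) \<in> cocycles A P (m + n)" "(\<lambda>x. \<xi> (\<phi> m x)) \<in> cocycles A P (m + n)"
      using \<xi>' \<xi> \<psi> \<phi> by (auto simp: ext_rel_iff intro: cocycle_comp_lift)
    have "coboundary A P m (\<lambda>x. \<xi>' x - \<xi> x)" using \<xi>' by (simp add: ext_rel_iff coboundary_swap)
    from coboundary_comp_lift[OF this \<psi>]
    have "coboundary A P (m + n) (\<lambda>x. \<xi>' (\<psi> m x) - \<xi> (\<psi> m x))" .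
    moreover have "coboundary A P (m + n) (\<lambda>x. \<xi> (\<psi> m x) - \<xi> (\<phi> m x))"
      using \<eta>' by (intro lift_respects_coboundary[OF \<xi> _ \<psi> \<phi>]) (simp add: ext_rel_iff coboundary_swap)
    ultimately show "coboundary A P (m + n) (\<lambda>x. \<xi>' (\<psi> m x) - \<xi> (\<phi> m x))"
      by (rule coboundary_trans)
  qed
  then show ?thesis
    unfolding ext_prod_def using cls_refl[OF \<xi>] cls_refl[OF \<eta>] \<phi> by blast
qed

lemma ext_add_ext: "X \<in> ext A P n \<Longrightarrow> Y \<in> ext A P n \<Longrightarrow> ext_add A P n X Y \<in> ext A P n"
  using cocycle_add by (auto simp: ext_iff ext_add_cls intro!: bexI)

lemma ext_scale_ext: "X \<in> ext A P n \<Longrightarrow> ext_scale A P n c X \<in> ext A P n"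
  using cocycle_scale by (auto simp: ext_iff ext_scale_cls intro!: bexI)

lemma ext_prod_ext: "X \<in> ext A P m \<Longrightarrow> Y \<in> ext A P n \<Longrightarrow> ext_prod A P m n X Y \<in> ext A P (m + n)"
  unfolding ext_iff using ext_prod_cls lift_exists cocycle_comp_lift by metis

lemma ext_zero_ext: "ext_zero A P n \<in> ext A P n"
  using cocycle_zero by (auto simp: ext_iff ext_zero_cls)

lemma ext_add_zero: "X \<in> ext A P n \<Longrightarrow> ext_add A P n X (ext_zero A P n) = X"
  "X \<in> ext A P n \<Longrightarrow> ext_add A P n (ext_zero A P n) X = X"
  using cocycle_zero by (auto simp: ext_iff ext_add_cls ext_zero_cls)

lemma ext_scale_zero: "ext_scale A P n c (ext_zero A P n) = ext_zero A P n"
  by (simp add: ext_zero_cls ext_scale_cls cocycle_zero)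

lemma ext_scale_by_zero: "X \<in> ext A P n \<Longrightarrow> ext_scale A P n 0 X = ext_zero A P n"
  by (auto simp: ext_iff ext_scale_cls ext_zero_cls)

lemma ext_prod_zero_left:
  assumes "Y \<in> ext A P n" shows "ext_prod A P m n (ext_zero A P m) Y = ext_zero A P (m + n)"
proof -
  obtain \<eta> \<phi> where "\<eta> \<in> cocycles A P n" "Y = cls n \<eta>" "\<phi> \<in> chain_lifts A P n \<eta>"
    using assms lift_exists by (metis ext_iff)
  then show ?thesis using ext_prod_cls[OF cocycle_zero] by (simp add: ext_zero_cls)
qed

lemma ext_prod_zero_right:
  assumes "X \<in> ext A P m" shows "ext_prod A P m n X (ext_zero A P n) = ext_zero A P (m + n)"
proof -
  obtain \<xi> where \<xi>: "\<xi> \<in> cocycles A P m" "X = cls m \<xi>" using assms by (auto simp: ext_iff)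
  have "(\<lambda>i x. 0) \<in> chain_lifts A P n (\<lambda>x. 0)"
    by (rule chain_liftsI)
      (simp_all add: module_pair.zero_ghom[OF pair] module_pair.ghom_zero[OF pair diff_ghom]
        module_pair.ghom_zero[OF pair_trivial aug_ghom])
  from ext_prod_cls[OF \<xi>(1) cocycle_zero this] show ?thesis
    using module_pair.ghom_zero[OF pair_trivial cocycle_ghom[OF \<xi>(1)]]
    by (simp add: ext_zero_cls \<xi>(2))
qed


subsection \<open>Decomposable cocycles\<close>

lemma decomposable_cocycle: "f \<in> decomposables A P n \<Longrightarrow> f \<in> cocycles A P n"
  by (induction rule: decomposables.induct)
    (auto intro: coboundary_cocycle cocycle_comp_lift cocycle_add)

lemma decomposable_scale: "f \<in> decomposables A P n \<Longrightarrow> (\<lambda>x. c * f x) \<in> decomposables A P n"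
proof (induction rule: decomposables.induct)
  case (coboundary f)
  then show ?case by (intro decomposables.coboundary coboundary_scale)
next
  case (product i j \<xi> \<eta> \<phi>)
  show ?case
    by (rule decomposables.product[OF product(1,2) cocycle_scale[OF product(3)] product(4,5)])
next
  case (add f g)
  then show ?case using decomposables.add by (simp add: distrib_left)
qed

lemma decomposable_cong:
  assumes f: "f \<in> decomposables A P n" and fg: "coboundary A P n (\<lambda>x. g x - f x)"
  shows "g \<in> decomposables A P n"
  using decomposables.add[OF f decomposables.coboundary[OF fg]] by simp

lemma decomposable_cls: "f \<in> decomposables A P n \<Longrightarrow> cls n f \<subseteq> decomposables A P n"
  by (rule subsetI, erule decomposable_cong) (simp add: ext_rel_iff coboundary_swap)

lemma decomposable_sum:
  "(\<And>s. s \<in> S \<Longrightarrow> f s \<in> decomposables A P n) \<Longrightarrow> (\<lambda>x. \<Sum>s\<in>S. f s x) \<in> decomposables A P n"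
proof (induction S rule: infinite_finite_induct)
  case (insert s S)
  then show ?case using decomposables.add[of "f s" A P n "\<lambda>x. \<Sum>s\<in>S. f s x"] by simp
qed (simp_all add: decomposables.coboundary coboundary_vanishing)

text \<open>The decomposables form a right ideal: this is the associativity of the Yoneda product.\<close>

lemma decomposable_comp_lift:
  assumes \<psi>: "\<psi> \<in> chain_lifts A P p \<zeta>" and \<zeta>: "\<zeta> \<in> cocycles A P p"
    and f: "f \<in> decomposables A P n"
  shows "(\<lambda>x. f (\<psi> n x)) \<in> decomposables A P (n + p)"
  using f
proof (induction rule: decomposables.induct)
  case (coboundary f)
  then show ?case using \<psi> by (intro decomposables.coboundary coboundary_comp_lift)
next
  case (product i j \<xi> \<eta> \<phi>)
  have "(\<lambda>x. \<xi> ((\<lambda>i x. \<phi> i (\<psi> (i + j) x)) i x)) \<in> decomposables A P (n + p)"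
    by (rule decomposables.product[OF product(1) _ product(3)
          cocycle_comp_lift[OF product(4) \<psi>] lift_comp[OF product(5) \<psi>]])
      (use product(2) in simp)
  then show ?case using product(2) by simp
next
  case (add f g)
  from decomposables.add[OF add.IH] show ?case .
qed

text \<open>
  A left factor of degree 0 is a scalar, one of degree 1 or 2 is as in the definition, and one of
  higher degree is decomposable itself.
\<close>

lemma decomposable_prod:
  assumes X: "X \<in> ext A P i" and Y: "Y \<in> ext A P j"
    and Xd: "i \<ge> 3 \<Longrightarrow> X \<subseteq> decomposables A P i" and Yd: "j \<ge> 3 \<Longrightarrow> Y \<subseteq> decomposables A P j"
    and "i + j \<ge> 3"
  shows "ext_prod A P i j X Y \<subseteq> decomposables A P (i + j)"
proof -
  obtain \<xi> where \<xi>: "\<xi> \<in> cocycles A P i" "X = cls i \<xi>" using X by (auto simp: ext_iff)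
  obtain \<eta> where \<eta>: "\<eta> \<in> cocycles A P j" "Y = cls j \<eta>" using Y by (auto simp: ext_iff)
  obtain \<phi> where \<phi>: "\<phi> \<in> chain_lifts A P j \<eta>" using lift_exists[OF \<eta>(1)] .
  have "(\<lambda>x. \<xi> (\<phi> i x)) \<in> decomposables A P (i + j)"
  proof -
    consider "i = 0" | "i \<in> {1, 2}" | "i \<ge> 3" by force
    then show ?thesis
    proof cases
      case 1
      obtain c where c: "\<And>x. x \<in> carrier 0 \<Longrightarrow> \<xi> x = c * raug P x"
        using cocycle_0_scalar \<xi>(1) 1 by blast
      have "\<eta> \<in> decomposables A P j" using Yd cls_refl[OF \<eta>(1)] \<eta>(2) assms(5) 1 by auto
      then have "(\<lambda>x. c * \<eta> x) \<in> decomposables A P j" by (rule decomposable_scale)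
      then have "(\<lambda>x. \<xi> (\<phi> 0 x)) \<in> decomposables A P j"
      proof (rule decomposable_cong, intro coboundary_vanishing)
        fix x assume "x \<in> carrier j"
        then show "\<xi> (\<phi> 0 x) - c * \<eta> x = 0"
          using c[OF lift_carrier[OF \<phi>, of x 0]] lift_aug[OF \<phi>] by simp
      qed
      then show ?thesis using 1 by simp
    next
      case 2
      show ?thesis by (rule decomposables.product[OF 2 refl \<xi>(1) \<eta>(1) \<phi>])
    next
      case 3
      then have "\<xi> \<in> decomposables A P i" using Xd cls_refl[OF \<xi>(1)] \<xi>(2) by auto
      then show ?thesis by (rule decomposable_comp_lift[OF \<phi> \<eta>(1)])
    qed
  qed
  then show ?thesis
    using decomposable_cls ext_prod_cls[OF \<xi>(1) \<eta>(1) \<phi>] \<xi>(2) \<eta>(2) by simp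
qed

lemma decomposable_ext_add:
  assumes "X \<subseteq> decomposables A P n" "Y \<subseteq> decomposables A P n"
  shows "ext_add A P n X Y \<subseteq> decomposables A P n"
  using assms decomposable_cls decomposables.add unfolding ext_add_def by blast

lemma decomposable_ext_zero: "ext_zero A P n \<subseteq> decomposables A P n"
  unfolding ext_zero_cls
  by (intro decomposable_cls decomposables.coboundary coboundary_vanishing) simp

lemma decomposable_foldr:
  "(\<And>i. i \<in> set is \<Longrightarrow> X i \<subseteq> decomposables A P n)
    \<Longrightarrow> foldr (\<lambda>i. ext_add A P n (X i)) is (ext_zero A P n) \<subseteq> decomposables A P n"
  by (induction "is") (auto simp: decomposable_ext_zero decomposable_ext_add)

lemma yoneda_carrier_ext: "u \<in> yoneda_carrier A P \<Longrightarrow> u n \<in> ext A P n"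
  and yoneda_carrier_finite: "u \<in> yoneda_carrier A P \<Longrightarrow> finite {n. u n \<noteq> ext_zero A P n}"
  unfolding yoneda_carrier_def by simp_all

lemma yoneda_carrierI:
  assumes "\<And>n. u n \<in> ext A P n" "finite F" "\<And>n. n \<notin> F \<Longrightarrow> u n = ext_zero A P n"
  shows "u \<in> yoneda_carrier A P"
proof -
  have "{n. u n \<noteq> ext_zero A P n} \<subseteq> F" using assms(3) by blast
  then show ?thesis unfolding yoneda_carrier_def using assms(1) finite_subset[OF _ assms(2)] by simp
qed

text \<open>
  The elements whose components in degrees at least 3 are decomposable form a subalgebra, and
  this subalgebra contains the generators, which have no such components.
\<close>

lemma generated_decomposable:
  assumes "u \<in> yoneda_generated A P (yoneda_degree A P 1 \<union> yoneda_degree A P 2)"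
    and sub: "yoneda_generated A P (yoneda_degree A P 1 \<union> yoneda_degree A P 2) \<subseteq> yoneda_carrier A P"
  shows "\<forall>n\<ge>3. u n \<subseteq> decomposables A P n"
  using assms(1)
proof (induction rule: yoneda_generated.induct)
  case one
  then show ?case by (simp add: yoneda_one_def decomposable_ext_zero)
next
  case (gen u)
  then show ?case by (auto simp: yoneda_degree_def intro: subsetD[OF decomposable_ext_zero])
next
  case (scale u c)
  have "yoneda_scale A P c u n \<subseteq> decomposables A P n" if "n \<ge> 3" for n
    using scale.IH that decomposable_scale decomposable_cls
    unfolding yoneda_scale_def ext_scale_def by blast
  then show ?case by blast
next
  case (add u v)
  then show ?case unfolding yoneda_add_def by (simp add: decomposable_ext_add)
next
  case (mul u v)
  have ext: "u i \<in> ext A P i" "v i \<in> ext A P i" for i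
    using mul.hyps sub by (simp_all add: yoneda_carrier_ext subset_iff)
  have "ext_prod A P i (n - i) (u i) (v (n - i)) \<subseteq> decomposables A P n"
    if "n \<ge> 3" "i \<in> set [0..<Suc n]" for n i
    using decomposable_prod[OF ext(1)[of i] ext(2)[of "n - i"]] mul.IH that by auto
  then show ?case unfolding yoneda_mul_def by (intro allI impI decomposable_foldr)
qed


subsection \<open>Generation from decomposability\<close>

definition single :: "nat \<Rightarrow> ('m \<Rightarrow> 'k) \<Rightarrow> nat \<Rightarrow> ('m \<Rightarrow> 'k) set" where
  "single n f k = (if k = n then cls n f else ext_zero A P k)"

lemma single_carrier: "f \<in> cocycles A P n \<Longrightarrow> single n f \<in> yoneda_carrier A P"
  by (rule yoneda_carrierI[of _ "{n}"]) (simp_all add: single_def ext_zero_ext, auto simp: ext_iff)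

lemma single_degree: "f \<in> cocycles A P n \<Longrightarrow> single n f \<in> yoneda_degree A P n"
  using single_carrier unfolding yoneda_degree_def single_def by auto

lemma foldr_ext:
  "(\<And>i. i \<in> set is \<Longrightarrow> X i \<in> ext A P n)
    \<Longrightarrow> foldr (\<lambda>i. ext_add A P n (X i)) is (ext_zero A P n) \<in> ext A P n"
  by (induction "is") (auto simp: ext_zero_ext ext_add_ext)

lemma foldr_zero:
  "(\<And>i. i \<in> set is \<Longrightarrow> X i = ext_zero A P n)
    \<Longrightarrow> foldr (\<lambda>i. ext_add A P n (X i)) is (ext_zero A P n) = ext_zero A P n"
  by (induction "is") (auto simp: ext_add_zero ext_zero_ext)

lemma foldr_single:
  "distinct is \<Longrightarrow> k \<in> set is \<Longrightarrow> X k \<in> ext A P n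
    \<Longrightarrow> (\<And>i. i \<in> set is \<Longrightarrow> i \<noteq> k \<Longrightarrow> X i = ext_zero A P n)
    \<Longrightarrow> foldr (\<lambda>i. ext_add A P n (X i)) is (ext_zero A P n) = X k"
proof (induction "is")
  case (Cons i "is")
  show ?case
  proof (cases "i = k")
    case True
    then have "foldr (\<lambda>i. ext_add A P n (X i)) is (ext_zero A P n) = ext_zero A P n"
      using Cons.prems by (intro foldr_zero) auto
    then show ?thesis using True Cons.prems(3) by (simp add: ext_add_zero)
  next
    case False
    then have "foldr (\<lambda>i. ext_add A P n (X i)) is (ext_zero A P n) = X k"
      using Cons by auto
    then show ?thesis using False Cons.prems by (simp add: ext_add_zero)
  qed
qed simp

lemma single_mul:
  assumes \<xi>: "\<xi> \<in> cocycles A P m" and \<eta>: "\<eta> \<in> cocycles A P n" and \<phi>: "\<phi> \<in> chain_lifts A P n \<eta>"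
  shows "yoneda_mul A P (single m \<xi>) (single n \<eta>) = single (m + n) (\<lambda>x. \<xi> (\<phi> m x))"
proof
  fix k
  have ext: "single m \<xi> i \<in> ext A P i" "single n \<eta> i \<in> ext A P i" for i
    using single_carrier \<xi> \<eta> by (simp_all add: yoneda_carrier_ext)
  let ?X = "\<lambda>i. ext_prod A P i (k - i) (single m \<xi> i) (single n \<eta> (k - i))"
  have zero: "?X i = ext_zero A P k" if "i \<in> set [0..<Suc k]" "\<not> (i = m \<and> k = m + n)" for i
  proof -
    have "single m \<xi> i = ext_zero A P i \<or> single n \<eta> (k - i) = ext_zero A P (k - i)"
      using that by (auto simp: single_def)
    then show ?thesis
      using ext_prod_zero_left[OF ext(2), of i "k - i"] ext_prod_zero_right[OF ext(1), of i "k - i"] that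
      by auto
  qed
  show "yoneda_mul A P (single m \<xi>) (single n \<eta>) k = single (m + n) (\<lambda>x. \<xi> (\<phi> m x)) k"
  proof (cases "k = m + n")
    case True
    have "yoneda_mul A P (single m \<xi>) (single n \<eta>) k = ?X m"
      unfolding yoneda_mul_def
      by (rule foldr_single) (use True zero ext_prod_ext[OF ext(1)[of m] ext(2)[of n]] in auto)
    then show ?thesis using True ext_prod_cls[OF \<xi> \<eta> \<phi>] by (simp add: single_def)
  next
    case False
    have "yoneda_mul A P (single m \<xi>) (single n \<eta>) k = ext_zero A P k"
      unfolding yoneda_mul_def by (rule foldr_zero) (use False zero in blast)
    then show ?thesis using False by (simp add: single_def)
  qed
qed

lemma single_add:
  "f \<in> cocycles A P n \<Longrightarrow> g \<in> cocycles A P n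
    \<Longrightarrow> yoneda_add A P (single n f) (single n g) = single n (\<lambda>x. f x + g x)"
  by (auto simp: fun_eq_iff yoneda_add_def single_def ext_add_cls ext_add_zero ext_zero_ext)

lemma generated_carrier:
  assumes "S \<subseteq> yoneda_carrier A P" shows "yoneda_generated A P S \<subseteq> yoneda_carrier A P"
proof
  fix u assume "u \<in> yoneda_generated A P S"
  then show "u \<in> yoneda_carrier A P"
  proof (induction rule: yoneda_generated.induct)
    case one
    have "yoneda_one A P = single 0 (raug P)"
      by (auto simp: yoneda_one_def single_def fun_eq_iff)
    then show ?case using single_carrier[OF cocycle_aug] by simp
  next
    case (gen u)
    then show ?case using assms by blast
  next
    case (scale u c)
    show ?case
      by (rule yoneda_carrierI[OF _ yoneda_carrier_finite[OF scale.IH]])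
        (simp_all add: yoneda_scale_def ext_scale_ext yoneda_carrier_ext[OF scale.IH] ext_scale_zero)
  next
    case (add u v)
    show ?case
      by (rule yoneda_carrierI[OF _ finite_UnI[OF yoneda_carrier_finite[OF add.IH(1)]
              yoneda_carrier_finite[OF add.IH(2)]]])
        (simp_all add: yoneda_add_def ext_add_ext yoneda_carrier_ext[OF add.IH(1)]
          yoneda_carrier_ext[OF add.IH(2)] ext_add_zero ext_zero_ext)
  next
    case (mul u v)
    note ext = yoneda_carrier_ext[OF mul.IH(1)] yoneda_carrier_ext[OF mul.IH(2)]
    obtain a where a: "\<And>n. n \<in> {n. u n \<noteq> ext_zero A P n} \<Longrightarrow> n < a"
      using yoneda_carrier_finite[OF mul.IH(1)] by (auto simp: finite_nat_set_iff_bounded)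
    obtain b where b: "\<And>n. n \<in> {n. v n \<noteq> ext_zero A P n} \<Longrightarrow> n < b"
      using yoneda_carrier_finite[OF mul.IH(2)] by (auto simp: finite_nat_set_iff_bounded)
    show ?case
    proof (rule yoneda_carrierI[of _ "{..<a + b}"])
      show "yoneda_mul A P u v n \<in> ext A P n" for n
        unfolding yoneda_mul_def
      proof (rule foldr_ext)
        fix i assume "i \<in> set [0..<Suc n]"
        then have "i + (n - i) = n" by auto
        with ext_prod_ext[OF ext(1)[of i] ext(2)[of "n - i"]]
        show "ext_prod A P i (n - i) (u i) (v (n - i)) \<in> ext A P n" by simp
      qed
      fix n assume n: "n \<notin> {..<a + b}"
      show "yoneda_mul A P u v n = ext_zero A P n"
        unfolding yoneda_mul_def
      proof (rule foldr_zero)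
        fix i assume "i \<in> set [0..<Suc n]"
        then have i: "i + (n - i) = n" by auto
        have "\<not> i < a \<or> \<not> n - i < b" using n i by auto
        then have "u i = ext_zero A P i \<or> v (n - i) = ext_zero A P (n - i)"
          using a[of i] b[of "n - i"] by simp blast
        then show "ext_prod A P i (n - i) (u i) (v (n - i)) = ext_zero A P n"
          using ext_prod_zero_left[OF ext(2), of i "n - i"] ext_prod_zero_right[OF ext(1), of i "n - i"] i
          by metis
      qed
    qed simp
  qed
qed

text \<open>
  By induction on the degree: a class of degree 0 is a multiple of 1, one of degree 1 or 2 is a
  generator, and the factors of a decomposable class of degree at least 3 have smaller degree.
\<close>

lemma decomposable_generated:
  assumes dec: "\<And>n. n \<ge> 3 \<Longrightarrow> cocycles A P n \<subseteq> decomposables A P n"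
    and S: "yoneda_degree A P 1 \<union> yoneda_degree A P 2 \<subseteq> S"
  shows "yoneda_carrier A P \<subseteq> yoneda_generated A P S"
proof -
  have single: "single n f \<in> yoneda_generated A P S" if "f \<in> cocycles A P n" for n f
    using that
  proof (induction n arbitrary: f rule: less_induct)
    case (less n)
    have zero: "single n f \<in> yoneda_generated A P S" if "coboundary A P n f" for f
    proof -
      have "cls 0 (raug P) \<in> ext A P 0" using cocycle_aug ext_iff by blast
      then have one: "yoneda_one A P k \<in> ext A P k" for k
        by (simp add: yoneda_one_def ext_zero_ext)
      have "cls n f = ext_zero A P n"
        unfolding ext_zero_cls
        by (rule cls_eqI) (use that coboundary_cocycle cocycle_zero in simp_all)
      then have "single n f = yoneda_scale A P 0 (yoneda_one A P)"
        by (auto simp: fun_eq_iff single_def yoneda_scale_def ext_scale_by_zero[OF one])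
      then show ?thesis by (simp add: yoneda_generated.intros)
    qed
    consider "n = 0" | "n \<in> {1, 2}" | "n \<ge> 3" by force
    then show ?case
    proof cases
      case 1
      then obtain c where c: "\<And>x. x \<in> carrier 0 \<Longrightarrow> f x = c * raug P x"
        using cocycle_0_scalar less.prems by blast
      have "cls 0 f = cls 0 (\<lambda>x. c * raug P x)"
        by (rule cls_cong) (simp_all add: cocycle_scale cocycle_aug c)
      then have "single n f = yoneda_scale A P c (yoneda_one A P)"
        using 1 by (auto simp: fun_eq_iff single_def yoneda_scale_def yoneda_one_def
            ext_scale_zero ext_scale_cls cocycle_aug)
      then show ?thesis by (simp add: yoneda_generated.intros)
    next
      case 2
      then show ?thesis using single_degree[OF less.prems] S by (blast intro: yoneda_generated.gen)
    next
      case 3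
      then have "f \<in> decomposables A P n" using dec less.prems by blast
      then show ?thesis
      proof (induction rule: decomposables.induct)
        case (coboundary f)
        then show ?case by (rule zero)
      next
        case (product i j \<xi> \<eta> \<phi>)
        then have "single i \<xi> \<in> yoneda_generated A P S" "single j \<eta> \<in> yoneda_generated A P S"
          using 3 by (auto intro!: less.IH)
        from yoneda_generated.mul[OF this] show ?case
          using single_mul[OF product(3,4,5)] product(2) by simp
      next
        case (add f g)
        then show ?case
          using yoneda_generated.add[OF add.IH] single_add decomposable_cocycle by metis
      qed
    qed
  qed
  have "u \<in> yoneda_generated A P S"
    if "finite N" "\<And>n. u n \<in> ext A P n" "{n. u n \<noteq> ext_zero A P n} \<subseteq> N" for u N
    using that
  proof (induction N arbitrary: u)
    case empty
    then have "u = yoneda_scale A P 0 (yoneda_one A P)"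
      using ext_scale_by_zero[of "cls 0 (raug P)" 0] cocycle_aug
      by (auto simp: fun_eq_iff yoneda_scale_def yoneda_one_def ext_scale_zero ext_iff)
    then show ?case by (simp add: yoneda_generated.intros)
  next
    case (insert m N)
    obtain f where f: "f \<in> cocycles A P m" "u m = cls m f" using insert.prems(1) by (auto simp: ext_iff)
    let ?v = "u(m := ext_zero A P m)"
    have "?v \<in> yoneda_generated A P S"
      using insert.prems by (intro insert.IH) (auto simp: ext_zero_ext)
    moreover have "yoneda_add A P ?v (single m f) = u"
    proof
      fix k
      show "yoneda_add A P ?v (single m f) k = u k"
        using ext_add_zero[OF insert.prems(1), of k] f(2)
        by (cases "k = m") (simp_all add: yoneda_add_def single_def)
    qed
    ultimately show ?case using yoneda_generated.add single[OF f(1)] by metis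
  qed
  from this[OF _ _ order_refl] show ?thesis using yoneda_carrier_ext yoneda_carrier_finite by (intro subsetI) simp
qed

text \<open>
  Since \<open>E\<^sup>0(A) = K\<close>, generation in degrees 1 and 2 means that every class of degree at least 3 is a
  sum of products with left factor in \<open>E\<^sup>1(A)\<close> or \<open>E\<^sup>2(A)\<close>.
\<close>

lemma generated_iff_decomposable:
  "yoneda_generated A P (yoneda_degree A P 1 \<union> yoneda_degree A P 2) = yoneda_carrier A P
    \<longleftrightarrow> (\<forall>n\<ge>3. cocycles A P n \<subseteq> decomposables A P n)"
proof
  assume gen: "yoneda_generated A P (yoneda_degree A P 1 \<union> yoneda_degree A P 2) = yoneda_carrier A P"
  show "\<forall>n\<ge>3. cocycles A P n \<subseteq> decomposables A P n"
  proof (intro allI impI subsetI)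
    fix n f assume n: "n \<ge> (3::nat)" and f: "f \<in> cocycles A P n"
    have "single n f \<in> yoneda_generated A P (yoneda_degree A P 1 \<union> yoneda_degree A P 2)"
      using single_carrier[OF f] gen by simp
    from generated_decomposable[OF this] gen n have "single n f n \<subseteq> decomposables A P n" by simp
    then show "f \<in> decomposables A P n" using cls_refl[OF f] by (auto simp: single_def)
  qed
next
  assume "\<forall>n\<ge>3. cocycles A P n \<subseteq> decomposables A P n"
  moreover have "yoneda_degree A P 1 \<union> yoneda_degree A P 2 \<subseteq> yoneda_carrier A P"
    unfolding yoneda_degree_def by blast
  ultimately show "yoneda_generated A P (yoneda_degree A P 1 \<union> yoneda_degree A P 2) = yoneda_carrier A P"
    by (intro equalityI generated_carrier decomposable_generated) auto
qed

end

section \<open>Twisted modules\<close>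

definition pullback_module :: "('a \<Rightarrow> 'a) \<Rightarrow> ('a, 'm) gmodule \<Rightarrow> ('a, 'm) gmodule" where
  "pullback_module \<rho> M = M\<lparr>act := \<lambda>a. act M (\<rho> a)\<rparr>"

lemma pullback_module_simps [simp]:
  "mpart (pullback_module \<rho> M) = mpart M" "act (pullback_module \<rho> M) a x = act M (\<rho> a) x"
  by (simp_all add: pullback_module_def)

text \<open>
  On homogeneous elements this is \<open>a * x = \<sigma>\<^bsup>-|a|-|x|\<^esup>(a) x\<close>. With this exponent, \<open>a * (b * x)\<close> and
  \<open>(a \<sigma>\<^bsup>|a|\<^esup>(b)) * x\<close> are both \<open>\<sigma>\<^bsup>-|a|-|b|-|x|\<^esup>(a) \<sigma>\<^bsup>-|b|-|x|\<^esup>(b) x\<close>.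
\<close>

definition twist_module ::
  "('k::field, 'a::ab_group_add) galgebra \<Rightarrow> ('a \<Rightarrow> 'a) \<Rightarrow> ('a, 'm::ab_group_add) gmodule \<Rightarrow> ('a, 'm) gmodule" where
  "twist_module A \<sigma> M = M\<lparr>act := \<lambda>a x. additive_ext (apart A)
     (\<lambda>i a. additive_ext (mpart M) (\<lambda>d x. act M (zpow \<sigma> (- (int i + d)) a) x) x) a\<rparr>"

lemma mpart_twist_module [simp]: "mpart (twist_module A \<sigma> M) = mpart M"
  by (simp add: twist_module_def)

context twisted_algebra
begin

lemma graded_module_pullback:
  assumes M: "graded_module A M" and \<rho>: "graded_automorphism A \<rho>"
  shows "graded_module A (pullback_module \<rho> M)"
proof -
  interpret module_over A M by (rule module_overI[OF M])
  show ?thesis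
    unfolding graded_module_def
    by (auto simp: mod.part_zero mod.part_add mod.indep act_add_left act_add_right act_mul act_one
        automorphism_add[OF \<rho>] automorphism_mul[OF \<rho>] automorphism_one[OF \<rho>]
        act_part[OF automorphism_part[OF \<rho>]])
qed

lemma pullback_trivial: "graded_automorphism A \<rho> \<Longrightarrow> pullback_module \<rho> (trivial_module A) = trivial_module A"
  by (simp add: pullback_module_def trivial_module_def augmentation_automorphism)

lemma twist_algebra_connected: "connected_algebra (twist A \<sigma>)"
  by (rule connected_algebra.intro[OF connected_twist])

end

locale twisted_module = twisted_algebra A \<sigma> + module_over A M
  for A :: "('k::field, 'a::ab_group_add) galgebra" and \<sigma> and M :: "('a, 'm::ab_group_add) gmodule"
begin

abbreviation tact :: "'a \<Rightarrow> 'm \<Rightarrow> 'm" where "tact \<equiv> act (twist_module A \<sigma> M)"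

lemma tact_eq: "tact a x = additive_ext (apart A)
    (\<lambda>i a. additive_ext (mpart M) (\<lambda>d x. act M (zpow \<sigma> (- (int i + d)) a) x) x) a"
  by (simp add: twist_module_def)

lemma inner_add:
  assumes "x \<in> mcarrier M"
  shows "additive_ext (mpart M) (\<lambda>d x. act M (zpow \<sigma> (- (int i + d)) (a + b)) x) x
    = additive_ext (mpart M) (\<lambda>d x. act M (zpow \<sigma> (- (int i + d)) a) x) x
      + additive_ext (mpart M) (\<lambda>d x. act M (zpow \<sigma> (- (int i + d)) b) x) x"
  unfolding additive_ext_def
  by (simp add: zpow_simps act_add_left mod.part_dsum[OF mod.hcomp_in[OF assms]] sum.distrib)

lemma inner_zero:
  assumes "x \<in> mcarrier M"
  shows "additive_ext (mpart M) (\<lambda>d x. act M (zpow \<sigma> (- (int i + d)) 0) x) x = 0"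
  using inner_add[OF assms, of i 0 0] by simp

lemma tact_add_left: "x \<in> mcarrier M \<Longrightarrow> tact (a + b) x = tact a x + tact b x"
  unfolding tact_eq by (rule parts.additive_ext_add[OF inner_add in_dsum in_dsum])

lemma tact_add_right:
  assumes "x \<in> mcarrier M" "y \<in> mcarrier M" shows "tact a (x + y) = tact a x + tact a y"
proof -
  have "additive_ext (mpart M) (\<lambda>d x. act M (zpow \<sigma> (- (int i + d)) a) x) (x + y)
    = additive_ext (mpart M) (\<lambda>d x. act M (zpow \<sigma> (- (int i + d)) a) x) x
      + additive_ext (mpart M) (\<lambda>d x. act M (zpow \<sigma> (- (int i + d)) a) x) y" for i a
    by (rule mod.additive_ext_add) (simp_all add: act_add_right mod.part_dsum assms)
  then show ?thesis unfolding tact_eq by (simp add: additive_ext_def[of "apart A"] sum.distrib)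
qed

lemma tact_homogeneous:
  assumes a: "a \<in> apart A i" and x: "x \<in> mpart M d"
  shows "tact a x = act M (zpow \<sigma> (- (int i + d)) a) x"
proof -
  have "tact a x = additive_ext (mpart M) (\<lambda>d x. act M (zpow \<sigma> (- (int i + d)) a) x) x"
    unfolding tact_eq
    by (rule parts.additive_ext_homogeneous[OF _ a]) (rule inner_zero[OF mod.part_dsum[OF x]])
  also have "\<dots> = act M (zpow \<sigma> (- (int i + d)) a) x"
    by (rule mod.additive_ext_homogeneous[OF _ x]) (rule act_zero_right)
  finally show ?thesis .
qed

lemma tact_part:
  "a \<in> apart A i \<Longrightarrow> x \<in> mpart M d \<Longrightarrow> tact a x \<in> mpart M (int i + d)"
  by (simp add: tact_homogeneous act_part zpow_part)

lemma tact_carrier: "x \<in> mcarrier M \<Longrightarrow> tact a x \<in> mcarrier M"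
proof (induction x rule: mod.dsum_induct)
  case (homogeneous d x)
  show ?case
  proof (induction a rule: algebra_induct)
    case (homogeneous i a)
    show ?case by (rule mod.part_dsum[OF tact_part[OF homogeneous \<open>x \<in> mpart M d\<close>]])
  next
    case (add a b)
    then show ?case
      using mod.part_dsum[OF \<open>x \<in> mpart M d\<close>] by (simp add: tact_add_left mod.dsum_add)
  qed
qed (simp add: tact_add_right mod.dsum_add)

lemma graded_module_twist: "graded_module (twist A \<sigma>) (twist_module A \<sigma> M)"
proof -
  have one: "tact (gone A) x = x" if "x \<in> mcarrier M" for x
    using that
  proof (induction x rule: mod.dsum_induct)
    case (homogeneous d x)
    then show ?case
      by (simp add: tact_homogeneous[OF one_part] zpow_simps act_one mod.part_dsum)
  qed (simp add: tact_add_right)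
  have mul: "tact (gmul (twist A \<sigma>) a b) x = tact a (tact b x)" if "x \<in> mcarrier M" for a b x
    using that
  proof (induction x rule: mod.dsum_induct)
    case (add x y)
    then show ?case by (simp add: tact_add_right tact_carrier)
  next
    case (homogeneous d x)
    note x = homogeneous and xc = mod.part_dsum[OF homogeneous]
    show ?case
    proof (induction a rule: algebra_induct)
      case (add a a')
      then show ?case by (simp add: tact_add_left twist_mul_add_left xc tact_carrier)
    next
      case (homogeneous i a)
      note a = homogeneous
      show ?case
      proof (induction b rule: algebra_induct)
        case (add b b')
        then show ?case
          by (simp add: tact_add_left tact_add_right twist_mul_add_right xc tact_carrier)
      next
        case (homogeneous j b)
        have ab: "gmul A a (zpow \<sigma> (int i) b) \<in> apart A (i + j)"
          using a homogeneous by (intro mul_part zpow_part)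
        have "tact (gmul (twist A \<sigma>) a b) x
          = act M (gmul A (zpow \<sigma> (- (int i + (int j + d))) a) (zpow \<sigma> (- (int j + d)) b)) x"
          by (simp only: twist_mul_homogeneous[OF a] tact_homogeneous[OF ab x] zpow_simps
              zpow_add[OF bij, symmetric]) (simp add: algebra_simps)
        also have "\<dots> = tact a (tact b x)"
          by (simp only: tact_homogeneous[OF homogeneous x] act_mul[OF xc]
              tact_homogeneous[OF a act_part[OF zpow_part[OF homogeneous] x]])
        finally show ?case .
      qed
    qed
  qed
  show ?thesis
    unfolding graded_module_def
    using one mul
    by (auto simp: mod.part_zero mod.part_add mod.indep tact_add_left tact_add_right tact_part)
qed

lemma locally_finite_twist:
  assumes "locally_finite_module A M"
  shows "locally_finite_module (twist A \<sigma>) (twist_module A \<sigma> M)"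
proof -
  have scalar: "tact (smul A c (gone A)) s = act M (smul A c (gone A)) s" if "s \<in> mpart M d" for c s d
    by (simp add: tact_homogeneous[OF scalar_part that] zpow_simps)
  show ?thesis
    unfolding locally_finite_module_def
  proof
    fix d
    obtain S where S: "finite S" "S \<subseteq> mpart M d"
      "\<forall>x\<in>mpart M d. \<exists>c. x = (\<Sum>s\<in>S. act M (smul A (c s) (gone A)) s)"
      using assms unfolding locally_finite_module_def by meson
    have "(\<Sum>s\<in>S. tact (smul A (c s) (gone A)) s) = (\<Sum>s\<in>S. act M (smul A (c s) (gone A)) s)" for c
      using S(2) by (intro sum.cong refl scalar) blast
    with S show "\<exists>S. finite S \<and> S \<subseteq> mpart (twist_module A \<sigma> M) d \<and>
        (\<forall>x\<in>mpart (twist_module A \<sigma> M) d. \<exists>c. x = (\<Sum>s\<in>S. act (twist_module A \<sigma> M)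
          (smul (twist A \<sigma>) (c s) (gone (twist A \<sigma>))) s))"
      by (intro exI[of _ S]) simp
  qed
qed

text \<open>
  For a basis element of degree \<open>q\<close>, the twisted multiples \<open>a * b\<close> are the multiples \<open>\<theta>\<^sub>q(a) b\<close> for
  a bijection \<open>\<theta>\<^sub>q\<close>; so a homogeneous basis of \<open>M\<close> is also one of the twisted module.
\<close>

lemma graded_free_twist:
  assumes "graded_free M" shows "graded_free (twist_module A \<sigma> M)"
proof -
  define \<theta> where "\<theta> q a = additive_ext (apart A) (\<lambda>i. zpow \<sigma> (- (int i + q))) a" for q a
  define \<theta>' where "\<theta>' q a = additive_ext (apart A) (\<lambda>i. zpow \<sigma> (int i + q)) a" for q a
  have hom: "\<theta> q a = zpow \<sigma> (- (int i + q)) a" "\<theta>' q a = zpow \<sigma> (int i + q) a"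
    if "a \<in> apart A i" for q a i
    unfolding \<theta>_def \<theta>'_def by (rule parts.additive_ext_homogeneous[OF _ that]; simp add: zpow_simps)+
  have add: "\<theta> q (a + b) = \<theta> q a + \<theta> q b" "\<theta>' q (a + b) = \<theta>' q a + \<theta>' q b" for q a b
    unfolding \<theta>_def \<theta>'_def by (rule parts.additive_ext_add; simp add: zpow_simps)+
  note \<theta>_add = add(1)
  have inverse: "\<theta> q (\<theta>' q a) = a" "\<theta>' q (\<theta> q a) = a" for q a
  proof (induction a rule: algebra_induct)
    case (homogeneous i a)
    { case 1 show ?case
        using homogeneous zpow_part[OF homogeneous, of "int i + q"] zpow_cancel(2)[OF bij, of "int i + q"]
        by (simp only: hom) }
    { case 2 show ?case
        using homogeneous zpow_part[OF homogeneous, of "- (int i + q)"] zpow_cancel(1)[OF bij, of "int i + q"]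
        by (simp only: hom) }
  qed (simp_all add: add)
  have zero: "\<theta> q a = 0 \<longleftrightarrow> a = 0" for q a
    using add(1)[of q 0 0] inverse(2)[of q a] add(2)[of q 0 0] by auto
  have tact_\<theta>: "tact a x = act M (\<theta> q a) x" if x: "x \<in> mpart M q" for q a x
  proof (induction a rule: algebra_induct)
    case (homogeneous i a)
    then show ?case by (simp only: tact_homogeneous[OF _ x] hom)
  next
    case (add a b)
    then show ?case
      using mod.part_dsum[OF x] by (simp add: tact_add_left act_add_left \<theta>_add)
  qed
  define coords where "coords act' B x c \<longleftrightarrow> finite {b. c b \<noteq> 0} \<and> {b. c b \<noteq> 0} \<subseteq> B \<and>
      x = (\<Sum>b | c b \<noteq> 0. act' (c b) b)"
    for act' :: "'a \<Rightarrow> 'm \<Rightarrow> 'm" and B x and c :: "'m \<Rightarrow> 'a"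
  obtain B where B: "B \<subseteq> (\<Union>d. mpart M d)" and ex1: "\<forall>x\<in>mcarrier M. \<exists>!c. coords (act M) B x c"
    using assms unfolding graded_free_def by (elim exE conjE) (rule that; unfold coords_def; assumption)
  have "\<forall>b\<in>B. \<exists>q. b \<in> mpart M q" using B by blast
  then obtain q where q: "\<And>b. b \<in> B \<Longrightarrow> b \<in> mpart M (q b)" by metis
  have coords_iff: "coords tact B x c \<longleftrightarrow> coords (act M) B x (\<lambda>b. \<theta> (q b) (c b))" for x c
  proof (cases "{b. c b \<noteq> 0} \<subseteq> B")
    case True
    have "(\<Sum>b | c b \<noteq> 0. tact (c b) b) = (\<Sum>b | c b \<noteq> 0. act M (\<theta> (q b) (c b)) b)"
      by (rule sum.cong[OF refl]) (rule tact_\<theta>[OF q], use True in blast)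
    then show ?thesis unfolding coords_def zero by (simp only:)
  next
    case False
    then show ?thesis unfolding coords_def zero by (simp only:) simp
  qed
  have "\<exists>!c. coords tact B x c" if x: "x \<in> mcarrier M" for x
  proof -
    obtain c where c: "coords (act M) B x c" and unique: "\<And>c'. coords (act M) B x c' \<Longrightarrow> c' = c"
      using bspec[OF ex1 x] by (elim ex1E) blast
    show ?thesis
    proof (rule ex1I[where a = "\<lambda>b. \<theta>' (q b) (c b)"])
      show "coords tact B x (\<lambda>b. \<theta>' (q b) (c b))" unfolding coords_iff inverse by (rule c)
      fix c' assume "coords tact B x c'"
      then have "(\<lambda>b. \<theta> (q b) (c' b)) = c" by (intro unique) (simp only: coords_iff)
      then show "c' = (\<lambda>b. \<theta>' (q b) (c b))" by (auto simp: inverse(2))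
    qed
  qed
  then have "\<forall>x\<in>mcarrier (twist_module A \<sigma> M). \<exists>!c. coords tact B x c" by simp
  then show ?thesis
    unfolding graded_free_def using B
    by (intro exI[of _ B] conjI) (simp, unfold coords_def, assumption)
qed

end

context twisted_algebra
begin

lemma twisted_moduleI: "graded_module A M \<Longrightarrow> twisted_module A \<sigma> M"
  by (simp add: twisted_module_def twisted_algebra_axioms module_overI)

lemma twist_trivial: "twist_module A \<sigma> (trivial_module A) = trivial_module A"
proof -
  interpret twisted_module A \<sigma> "trivial_module A" by (rule twisted_moduleI[OF graded_module_trivial])
  have "tact a c = augmentation A a * c" for a c
  proof (induction a rule: algebra_induct)
    case (add a b)
    then show ?case by (simp add: tact_add_left augmentation_add distrib_right)
  next
    case (homogeneous i a)
    have "c \<in> mcarrier (trivial_module A)" by simp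
    then show ?case
    proof (induction c rule: mod.dsum_induct)
      case (homogeneous d c)
      then show ?case
        by (simp add: tact_homogeneous[OF \<open>a \<in> apart A i\<close>] augmentation_automorphism zpow_automorphism)
    next
      case (add x y)
      then show ?case by (simp add: tact_add_right distrib_left)
    qed
  qed
  then have "tact = act (trivial_module A)" by (simp add: fun_eq_iff)
  then show ?thesis by (intro gmodule.equality) simp_all
qed

text \<open>
  A map of degree \<open>e\<close> that is linear for the twisted actions is \<open>\<sigma>\<^sup>-\<^sup>e\<close>-semilinear for the
  original ones: on \<open>a * x\<close> with \<open>|a| = i\<close> and \<open>|x| = d\<close>, the exponent is \<open>-(i + d)\<close> before applying the
  map and \<open>-(i + d + e)\<close> after.
\<close>

lemma twist_deg_hom:
  assumes M: "graded_module A M" and N: "graded_module A N"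
  shows "deg_hom (twist_module A \<sigma> M) (twist_module A \<sigma> N) e = deg_hom M (pullback_module (zpow \<sigma> (- e)) N) e"
proof -
  interpret M: twisted_module A \<sigma> M by (rule twisted_moduleI[OF M])
  interpret N: twisted_module A \<sigma> N by (rule twisted_moduleI[OF N])
  interpret T: module_pair "twist A \<sigma>" "twist_module A \<sigma> M" "twist_module A \<sigma> N"
    by (intro connected_algebra.module_pairI twist_algebra_connected M.graded_module_twist N.graded_module_twist)
  interpret S: module_pair A M "pullback_module (zpow \<sigma> (- e)) N"
    by (intro module_pairI M graded_module_pullback N zpow_automorphism)
  have key: "N.tact (zpow \<sigma> (int i + d) a) y = act N (zpow \<sigma> (- e) a) y"
    if "a \<in> apart A i" "y \<in> mpart N (d + e)" for i d a y
  proof -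
    have "- (int i + (d + e)) + (int i + d) = - e" by simp
    then show ?thesis
      by (simp only: N.tact_homogeneous[OF zpow_part[OF that(1)] that(2)] zpow_add[OF bij, symmetric])
  qed
  show ?thesis
  proof (intro set_eqI iffI)
    fix f assume f: "f \<in> deg_hom (twist_module A \<sigma> M) (twist_module A \<sigma> N) e"
    show "f \<in> deg_hom M (pullback_module (zpow \<sigma> (- e)) N) e"
    proof (rule S.deg_homI)
      show "f (x + y) = f x + f y" if "x \<in> mcarrier M" "y \<in> mcarrier M" for x y
        using deg_hom_add[OF f] that by simp
      show "f x \<in> mpart (pullback_module (zpow \<sigma> (- e)) N) (d + e)" if "x \<in> mpart M d" for d x
        using deg_hom_part[OF f] that by simp
      fix i a d x assume a: "a \<in> apart A i" and x: "x \<in> mpart M d"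
      have "f (act M a x) = f (M.tact (zpow \<sigma> (int i + d) a) x)"
        by (simp only: M.tact_homogeneous[OF zpow_part[OF a] x] zpow_cancel[OF bij])
      also have "\<dots> = N.tact (zpow \<sigma> (int i + d) a) (f x)"
        using deg_hom_act[OF f] M.mod.part_dsum[OF x] by simp
      also have "\<dots> = act N (zpow \<sigma> (- e) a) (f x)"
        using deg_hom_part[OF f] x by (intro key a) simp
      finally show "f (act M a x) = act (pullback_module (zpow \<sigma> (- e)) N) a (f x)" by simp
    qed
  next
    fix f assume f: "f \<in> deg_hom M (pullback_module (zpow \<sigma> (- e)) N) e"
    show "f \<in> deg_hom (twist_module A \<sigma> M) (twist_module A \<sigma> N) e"
    proof (rule T.deg_homI)
      show "f (x + y) = f x + f y"
        if "x \<in> mcarrier (twist_module A \<sigma> M)" "y \<in> mcarrier (twist_module A \<sigma> M)" for x y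
        using deg_hom_add[OF f] that by simp
      show "f x \<in> mpart (twist_module A \<sigma> N) (d + e)" if "x \<in> mpart (twist_module A \<sigma> M) d" for d x
        using deg_hom_part[OF f] that by simp
      fix i a d x assume "a \<in> apart (twist A \<sigma>) i" "x \<in> mpart (twist_module A \<sigma> M) d"
      then have a: "a \<in> apart A i" and x: "x \<in> mpart M d" by simp_all
      have a': "zpow \<sigma> (- (int i + d)) a \<in> apart A i" using a by (rule zpow_part)
      have "f (M.tact a x) = f (act M (zpow \<sigma> (- (int i + d)) a) x)"
        by (simp only: M.tact_homogeneous[OF a x])
      also have "\<dots> = act N (zpow \<sigma> (- e) (zpow \<sigma> (- (int i + d)) a)) (f x)"
        using deg_hom_act[OF f M.mod.part_dsum[OF x]] by simp
      also have "\<dots> = N.tact (zpow \<sigma> (int i + d) (zpow \<sigma> (- (int i + d)) a)) (f x)"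
        using deg_hom_part[OF f x] by (intro key[OF a', symmetric]) simp
      also have "\<dots> = N.tact a (f x)" by (simp only: zpow_cancel[OF bij])
      finally show "f (M.tact a x) = N.tact a (f x)" .
    qed
  qed
qed

lemma twist_deg_hom_trivial:
  assumes "graded_module A M"
  shows "deg_hom (twist_module A \<sigma> M) (trivial_module A) e = deg_hom M (trivial_module A) e"
  using twist_deg_hom[OF assms graded_module_trivial, of e]
  by (simp add: twist_trivial pullback_trivial[OF zpow_automorphism])

lemma twist_ghom_trivial:
  assumes "graded_module A M"
  shows "ghom (twist_module A \<sigma> M) (trivial_module A) = ghom M (trivial_module A)"
  unfolding ghom_def by (simp add: twist_deg_hom_trivial[OF assms])

lemma ghom_pullback_trivial:
  assumes \<rho>: "graded_automorphism A \<rho>" and f: "f \<in> ghom M (trivial_module A)"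
  shows "f \<in> ghom (pullback_module \<rho> M) (trivial_module A)"
proof -
  have "deg_hom M (trivial_module A) e \<subseteq> deg_hom (pullback_module \<rho> M) (trivial_module A) e" for e
    unfolding deg_hom_def by (auto simp: augmentation_automorphism[OF \<rho>])
  then show ?thesis using f unfolding ghom_def by simp blast
qed

end


section \<open>Twisting a resolution\<close>

definition twist_resolution ::
  "('k::field, 'a::ab_group_add) galgebra \<Rightarrow> ('a \<Rightarrow> 'a) \<Rightarrow> ('k, 'a, 'm::ab_group_add) resolution
    \<Rightarrow> ('k, 'a, 'm) resolution" where
  "twist_resolution A \<sigma> P = P\<lparr>rmod := \<lambda>n. twist_module A \<sigma> (rmod P n)\<rparr>"

lemma twist_resolution_simps [simp]:
  "rmod (twist_resolution A \<sigma> P) n = twist_module A \<sigma> (rmod P n)"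
  "rdiff (twist_resolution A \<sigma> P) = rdiff P" "raug (twist_resolution A \<sigma> P) = raug P"
  by (simp_all add: twist_resolution_def)

locale twisted_resolution = twisted_algebra A \<sigma> + free_resolution_of A P
  for A :: "('k::field, 'a::ab_group_add) galgebra" and \<sigma>
    and P :: "('k, 'a, 'm::ab_group_add) resolution"
begin

lemma pullback_zpow_0: "pullback_module (zpow \<sigma> 0) M = M"
  by (simp add: pullback_module_def)

lemma free_twist: "free_resolution (twist A \<sigma>) (twist_resolution A \<sigma> P)"
proof -
  have "graded_module (twist A \<sigma>) (twist_module A \<sigma> (rmod P n))"
    "locally_finite_module (twist A \<sigma>) (twist_module A \<sigma> (rmod P n))"
    "graded_free (twist_module A \<sigma> (rmod P n))" for n
    by (intro twisted_module.graded_module_twist twisted_module.locally_finite_twist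
        twisted_module.graded_free_twist twisted_moduleI module free locally_finite)+
  moreover have "rdiff P n \<in> deg_hom (twist_module A \<sigma> (rmod P (Suc n))) (twist_module A \<sigma> (rmod P n)) 0" for n
    using diff by (simp add: twist_deg_hom[OF module module] pullback_zpow_0)
  moreover have "raug P \<in> deg_hom (twist_module A \<sigma> (rmod P 0)) (trivial_module A) 0"
    using aug by (simp add: twist_deg_hom_trivial[OF module])
  ultimately show ?thesis
    unfolding free_resolution_def using aug_onto exact_0 exact_Suc by simp
qed

lemma twist_cocycles: "cocycles (twist A \<sigma>) (twist_resolution A \<sigma> P) n = cocycles A P n"
  unfolding cocycles_def by (simp add: twist_ghom_trivial[OF module])

lemma twist_coboundary: "coboundary (twist A \<sigma>) (twist_resolution A \<sigma> P) n = coboundary A P n"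
  by (cases n) (simp_all add: fun_eq_iff coboundary_def twist_ghom_trivial[OF module])

text \<open>
  A \<open>\<sigma>\<^sup>k\<close>-semilinear map is a linear map into the pullback along \<open>\<sigma>\<^sup>k\<close>, and the pullback of \<open>P\<close> is
  again an exact resolution of \<open>K\<close>; so the comparison theorem applies.
\<close>

lemma semilinear_chain_map:
  obtains T where "\<And>i. T i \<in> deg_hom (rmod P i) (pullback_module (zpow \<sigma> k) (rmod P i)) 0"
    "\<And>x. x \<in> carrier 0 \<Longrightarrow> raug P (T 0 x) = raug P x"
    "\<And>i x. x \<in> carrier (Suc i) \<Longrightarrow> rdiff P i (T (Suc i) x) = T i (rdiff P i x)"
proof -
  define Q where "Q = P\<lparr>rmod := \<lambda>n. pullback_module (zpow \<sigma> k) (rmod P n)\<rparr>"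
  have Q_simps: "rmod Q n = pullback_module (zpow \<sigma> k) (rmod P n)" "rdiff Q = rdiff P" "raug Q = raug P" for n
    by (simp_all add: Q_def)
  have "exact_resolution A Q"
  proof (unfold_locales, unfold Q_simps pullback_module_simps)
    show "graded_module A (pullback_module (zpow \<sigma> k) (rmod P n))" for n
      by (rule graded_module_pullback[OF module zpow_automorphism])
    show "rdiff P n \<in> deg_hom (pullback_module (zpow \<sigma> k) (rmod P (Suc n)))
        (pullback_module (zpow \<sigma> k) (rmod P n)) 0" for n
      using diff unfolding deg_hom_def by simp
    show "raug P \<in> deg_hom (pullback_module (zpow \<sigma> k) (rmod P 0)) (trivial_module A) 0"
      using aug unfolding deg_hom_def by (simp add: augmentation_automorphism[OF zpow_automorphism])
  qed (rule aug_onto exact_0 exact_Suc)+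
  from comparison[OF this aug aug_diff] obtain T where
    "\<And>i. T i \<in> deg_hom (rmod P (i + 0)) (rmod Q i) 0"
    "\<And>x. x \<in> carrier 0 \<Longrightarrow> raug Q (T 0 x) = raug P x"
    "\<And>i x. x \<in> carrier (Suc (i + 0)) \<Longrightarrow> rdiff Q i (T (Suc i) x) = T i (rdiff P (i + 0) x)"
    by blast
  then show ?thesis using that[of T] by (simp add: Q_simps)
qed

text \<open>
  For a homogeneous cocycle \<open>\<eta>\<close> of degree \<open>e\<close>, a lift \<open>\<psi>\<close> of \<open>\<eta>\<close> over the twisted algebra of
  the same degree and a \<open>\<sigma>\<^sup>e\<close>-semilinear chain map \<open>T\<close> over the identity of \<open>K\<close>, the composite \<open>T \<psi>\<close>
  is a lift of \<open>\<eta>\<close> over \<open>A\<close>. Hence \<open>[\<xi>][\<eta>]\<close> over \<open>A\<close> is \<open>[\<xi> T][\<eta>]\<close> over the twisted algebra. A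
  general \<open>\<eta>\<close> is the sum of its homogeneous components.
\<close>

lemma decomposable_twist:
  assumes "f \<in> decomposables A P n"
  shows "f \<in> decomposables (twist A \<sigma>) (twist_resolution A \<sigma> P) n"
proof -
  let ?B = "twist A \<sigma>" and ?R = "twist_resolution A \<sigma> P"
  interpret R: free_resolution_of ?B ?R
    by (intro free_resolution_of.intro free_resolution_of_axioms.intro twist_algebra_connected free_twist)
  show ?thesis
    using assms
  proof (induction rule: decomposables.induct)
    case (coboundary f)
    then show ?case by (intro decomposables.coboundary) (simp add: twist_coboundary)
  next
    case (add f g)
    from decomposables.add[OF add.IH] show ?case .
  next
    case (product i j \<xi> \<eta> \<phi>)
    obtain E F where F: "finite E" "\<And>e. e \<in> E \<Longrightarrow> F e \<in> deg_hom (rmod P j) (trivial_module A) e"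
      "\<And>e x. e \<in> E \<Longrightarrow> x \<in> carrier (Suc j) \<Longrightarrow> F e (rdiff P j x) = 0"
      "\<And>x. x \<in> carrier j \<Longrightarrow> \<eta> x = (\<Sum>e\<in>E. F e x)"
      using homogeneous_components[OF product(4)] by blast
    have "\<exists>\<psi>. \<psi> \<in> chain_lifts ?B ?R j (F e) \<and>
        (\<forall>l. \<psi> l \<in> deg_hom (rmod P (l + j)) (pullback_module (zpow \<sigma> (- e)) (rmod P l)) e)" if "e \<in> E" for e
    proof -
      have "F e \<in> deg_hom (rmod ?R j) (trivial_module ?B) e"
        using F(2)[OF that] by (simp add: twist_deg_hom_trivial[OF module])
      moreover have "F e (rdiff ?R j x) = 0" if "x \<in> R.carrier (Suc j)" for x
        using F(3)[OF \<open>e \<in> E\<close>, of x] that by simp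
      ultimately obtain \<psi> where "\<psi> \<in> chain_lifts ?B ?R j (F e)"
        "\<And>l. \<psi> l \<in> deg_hom (rmod ?R (l + j)) (rmod ?R l) e"
        using R.homogeneous_lift_exists by blast
      then show ?thesis by (auto simp: twist_deg_hom[OF module module])
    qed
    then obtain \<psi> where \<psi>: "\<And>e. e \<in> E \<Longrightarrow> \<psi> e \<in> chain_lifts ?B ?R j (F e)"
      "\<And>e l. e \<in> E \<Longrightarrow> \<psi> e l \<in> deg_hom (rmod P (l + j)) (pullback_module (zpow \<sigma> (- e)) (rmod P l)) e"
      by metis
    have "\<forall>k. \<exists>T. (\<forall>l. T l \<in> deg_hom (rmod P l) (pullback_module (zpow \<sigma> k) (rmod P l)) 0) \<and>
        (\<forall>x\<in>carrier 0. raug P (T 0 x) = raug P x) \<and>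
        (\<forall>l. \<forall>x\<in>carrier (Suc l). rdiff P l (T (Suc l) x) = T l (rdiff P l x))"
      using semilinear_chain_map by metis
    then obtain T where T: "\<And>k l. T k l \<in> deg_hom (rmod P l) (pullback_module (zpow \<sigma> k) (rmod P l)) 0"
      "\<And>k x. x \<in> carrier 0 \<Longrightarrow> raug P (T k 0 x) = raug P x"
      "\<And>k l x. x \<in> carrier (Suc l) \<Longrightarrow> rdiff P l (T k (Suc l) x) = T k l (rdiff P l x)"
      by metis
    have \<psi>c: "\<psi> e l x \<in> carrier l" if "e \<in> E" "x \<in> carrier (l + j)" for e l x
      using R.lift_carrier[OF \<psi>(1), of e x l] that by simp
    have Tc: "T k l x \<in> carrier l" if "x \<in> carrier l" for k l x
      using module_pair.deg_hom_carrier[OF module_pairI[OF module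
            graded_module_pullback[OF module zpow_automorphism]] T(1)] that by simp
    have lift: "(\<lambda>l x. T e l (\<psi> e l x)) \<in> chain_lifts A P j (F e)" if e: "e \<in> E" for e
    proof (rule chain_liftsI)
      fix l
      have "T e l \<in> deg_hom (pullback_module (zpow \<sigma> (- e)) (rmod P l)) (rmod P l) 0"
        using T(1)[of e l] unfolding deg_hom_def by (simp add: zpow_cancel[OF bij])
      from comp_deg_hom[OF module graded_module_pullback[OF module zpow_automorphism] \<psi>(2)[OF e] this]
      show "(\<lambda>x. T e l (\<psi> e l x)) \<in> ghom (rmod P (l + j)) (rmod P l)"
        by (rule module_pair.deg_hom_ghom[OF pair])
      show "rdiff P l (T e (Suc l) (\<psi> e (Suc l) x)) = T e l (\<psi> e l (rdiff P (l + j) x))"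
        if "x \<in> carrier (Suc (l + j))" for x
        using T(3)[OF \<psi>c[OF e, of x "Suc l"]] R.lift_diff[OF \<psi>(1)[OF e], of x l] that by simp
    next
      show "raug P (T e 0 (\<psi> e 0 x)) = F e x" if "x \<in> carrier j" for x
        using T(2)[OF \<psi>c[OF e, of x 0]] R.lift_aug[OF \<psi>(1)[OF e], of x] that by simp
    qed
    have "coboundary A P (i + j) (\<lambda>x. \<xi> (\<phi> i x) - \<xi> (\<Sum>e\<in>E. T e i (\<psi> e i x)))"
      by (rule lift_unique[OF product(3,5) lift_sum[OF lift F(4)]])
    then have "coboundary A P (i + j) (\<lambda>x. \<xi> (\<phi> i x) - (\<Sum>e\<in>E. \<xi> (T e i (\<psi> e i x))))"
      by (rule coboundary_cong)
        (simp add: module_pair.ghom_sum[OF pair_trivial cocycle_ghom[OF product(3)]] Tc \<psi>c)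
    then have cob: "coboundary ?B ?R n (\<lambda>x. \<xi> (\<phi> i x) - (\<Sum>e\<in>E. \<xi> (T e i (\<psi> e i x))))"
      using product(2) by (simp add: twist_coboundary)
    have "(\<lambda>x. \<xi> (T e i (\<psi> e i x))) \<in> decomposables ?B ?R n" if e: "e \<in> E" for e
    proof (rule decomposables.product[OF product(1,2) _ _ \<psi>(1)[OF e], of "\<lambda>x. \<xi> (T e i x)"])
      have "(\<lambda>x. \<xi> (T e i x)) \<in> ghom (rmod P i) (trivial_module A)"
        using comp_ghom[OF module graded_module_pullback[OF module zpow_automorphism] graded_module_trivial
            module_pair.deg_hom_ghom[OF module_pairI[OF module
                graded_module_pullback[OF module zpow_automorphism]] T(1)]
            ghom_pullback_trivial[OF zpow_automorphism cocycle_ghom[OF product(3)]]] .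
      then have "(\<lambda>x. \<xi> (T e i x)) \<in> cocycles A P i"
        by (rule cocyclesI) (simp add: T(3)[symmetric] cocycle_diff[OF product(3)] Tc)
      then show "(\<lambda>x. \<xi> (T e i x)) \<in> cocycles ?B ?R i" by (simp add: twist_cocycles)
      have "F e \<in> cocycles A P j"
        by (rule cocyclesI[OF module_pair.deg_hom_ghom[OF pair_trivial F(2)[OF e]]]) (rule F(3)[OF e])
      then show "F e \<in> cocycles ?B ?R j" by (simp add: twist_cocycles)
    qed
    from R.decomposable_cong[OF R.decomposable_sum[OF this] cob] show ?case .
  qed
qed

end

lemma (in twisted_algebra) K2_twist:
  assumes "K2 A" shows "K2 (twist A \<sigma>)"
proof -
  obtain P :: "('k, 'a, nat \<Rightarrow> 'a) resolution" where P: "free_resolution A P"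
    "yoneda_generated A P (yoneda_degree A P 1 \<union> yoneda_degree A P 2) = yoneda_carrier A P"
    using assms unfolding K2_def by blast
  interpret twisted_resolution A \<sigma> P by unfold_locales (rule P(1))
  let ?B = "twist A \<sigma>" and ?R = "twist_resolution A \<sigma> P"
  interpret R: free_resolution_of ?B ?R
    by (intro free_resolution_of.intro free_resolution_of_axioms.intro twist_algebra_connected free_twist)
  have "cocycles ?B ?R n \<subseteq> decomposables ?B ?R n" if "n \<ge> 3" for n
  proof -
    have "cocycles A P n \<subseteq> decomposables A P n" using P(2) that unfolding generated_iff_decomposable by blast
    then show ?thesis unfolding twist_cocycles using decomposable_twist by blast
  qed
  then have "yoneda_generated ?B ?R (yoneda_degree ?B ?R 1 \<union> yoneda_degree ?B ?R 2) = yoneda_carrier ?B ?R"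
    unfolding R.generated_iff_decomposable by blast
  then show ?thesis unfolding K2_def using free_twist by blast
qed

theorem theorem3p1:
  fixes A :: "('k::field, 'a::ab_group_add) galgebra" and \<sigma> :: "'a \<Rightarrow> 'a"
  assumes "graded_algebra A" and "graded_automorphism A \<sigma>"
  shows "K2 A \<longleftrightarrow> K2 (twist A \<sigma>)"
proof -
  interpret twisted_algebra A \<sigma>
    using assms by unfold_locales (auto simp: graded_algebra_def)
  interpret T: twisted_algebra "twist A \<sigma>" "inv \<sigma>"
    by unfold_locales (rule connected_twist, rule automorphism_inv_twist)
  show ?thesis using K2_twist T.K2_twist unfolding twist_twist by blast
qed
end
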